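(* Let $(G,\mu)$ be a pmp discrete groupoid. If $G$ is generated by a treeing $\mathcal{E}$ (that is, $\mathcal{E}$ is a treeing of $G$ which is also a graphing of $G$), then $C_\mu(G)=C_\mu(\mathcal{E})$.
   Context: A discrete Borel groupoid $G$ with unit space $X\subset G$ is a groupoid that is a standard Borel space, with Borel source and range maps $s,r:G\to X$, Borel product ($g_1g_2$ is defined iff $s(g_1)=r(g_2)$) and Borel inverse, such that $s,r$ are countable-to-one. A Borel set $E\subset G$ is one-sheeted if $s|_E$ and $r|_E$ are injective; then $\varphi_E:=(r|_E)\circ(s|_E)^{-1}:s(E)\to r(E)$; $\mathcal{G}_G$ is the set of one-sheeted sets. $(G,\mu)$ is a pmp discrete groupoid if $\mu$ is a probability measure on $X$ invariant under all $\varphi_E$, $E\in\mathcal G_G$. Put $\mu^G(B)=\int_X\#(s^{-1}(x)\cap B)\,\mu(dx)$. For an at most countable family $\mathcal{E}\subset\mathcal{G}_G$, a reduced word in $\mathcal{E}$ is a non-empty product $E_1^{\epsilon_1}\cdots E_n^{\epsilon_n}$ ($n\ge1$, $E_i\in\mathcal{E}$, $\epsilon_i\in\{1,-1\}$) such that $E_i=E_{i+1}$ implies $\epsilon_i=\epsilon_{i+1}$; $\mathrm{Wr}(\mathcal{E})$ is the set of reduced words. $\mathcal{E}$ is a graphing of $G$ if $\mu^G(G\setminus(X\cup\bigcup_{W\in\mathrm{Wr}(\mathcal{E})}W))=0$. Its cost is $C_\mu(\mathcal{E})=\sum_{E\in\mathcal{E}}\mu^G(E)=\sum_{E\in\mathcal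 E}\mu(s(E))$, and $C_\mu(G)=\inf\{C_\mu(\mathcal{E}):\mathcal{E}\text{ a graphing of }G\}\in[0,\infty]$. $\mathcal{E}$ is a treeing if $\mu^G(W\cap X)=0$ for every reduced word $W$ in $\mathcal{E}$. *)

theory Defs
  imports "HOL-Probability.Probability"
begin

definition standard_borel :: "'a measure \<Rightarrow> bool" where
  "standard_borel M \<longleftrightarrow>
     (\<exists>T. completely_metrizable_space T \<and> second_countable T \<and>
          topspace T = space M \<and> sets M = sigma_sets (topspace T) {U. openin T U})"

text \<open>
  The field \<open>borel_str\<close> carries the set of all elements of the groupoid (as its space) together
  with the Borel structure; the measure stored in it is irrelevant. The product \<open>mul G g h\<close> is
  meaningful only if \<open>src G g = rng G h\<close>, and no operation is constrained outside the space.
\<close>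

record 'g groupoid_data =
  borel_str :: "'g measure"
  units :: "'g set"
  src :: "'g \<Rightarrow> 'g"
  rng :: "'g \<Rightarrow> 'g"
  mul :: "'g \<Rightarrow> 'g \<Rightarrow> 'g"
  ivs :: "'g \<Rightarrow> 'g"

abbreviation elts :: "('g, 'm) groupoid_data_scheme \<Rightarrow> 'g set" where
  "elts G \<equiv> space (borel_str G)"

abbreviation unit_borel :: "('g, 'm) groupoid_data_scheme \<Rightarrow> 'g measure" where
  "unit_borel G \<equiv> restrict_space (borel_str G) (units G)"

locale groupoid =
  fixes G :: "('g, 'm) groupoid_data_scheme" (structure)
  assumes units_subset: "units G \<subseteq> elts G"
    and src_units: "g \<in> elts G \<Longrightarrow> src G g \<in> units G"
    and rng_units: "g \<in> elts G \<Longrightarrow> rng G g \<in> units G"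
    and src_unit: "x \<in> units G \<Longrightarrow> src G x = x"
    and rng_unit: "x \<in> units G \<Longrightarrow> rng G x = x"
    and mul_closed: "\<lbrakk>g \<in> elts G; h \<in> elts G; src G g = rng G h\<rbrakk> \<Longrightarrow> mul G g h \<in> elts G"
    and src_mul: "\<lbrakk>g \<in> elts G; h \<in> elts G; src G g = rng G h\<rbrakk> \<Longrightarrow> src G (mul G g h) = src G h"
    and rng_mul: "\<lbrakk>g \<in> elts G; h \<in> elts G; src G g = rng G h\<rbrakk> \<Longrightarrow> rng G (mul G g h) = rng G g"
    and mul_assoc: "\<lbrakk>g \<in> elts G; h \<in> elts G; k \<in> elts G; src G g = rng G h; src G h = rng G k\<rbrakk>
                    \<Longrightarrow> mul G (mul G g h) k = mul G g (mul G h k)"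
    and mul_src: "g \<in> elts G \<Longrightarrow> mul G g (src G g) = g"
    and rng_mul_left: "g \<in> elts G \<Longrightarrow> mul G (rng G g) g = g"
    and ivs_closed: "g \<in> elts G \<Longrightarrow> ivs G g \<in> elts G"
    and src_ivs: "g \<in> elts G \<Longrightarrow> src G (ivs G g) = rng G g"
    and rng_ivs: "g \<in> elts G \<Longrightarrow> rng G (ivs G g) = src G g"
    and ivs_mul: "g \<in> elts G \<Longrightarrow> mul G (ivs G g) g = src G g"
    and mul_ivs: "g \<in> elts G \<Longrightarrow> mul G g (ivs G g) = rng G g"

locale discrete_borel_groupoid = groupoid +
  assumes standard: "standard_borel (borel_str G)"
    and src_borel: "src G \<in> borel_str G \<rightarrow>\<^sub>M unit_borel G"
    and rng_borel: "rng G \<in> borel_str G \<rightarrow>\<^sub>M unit_borel G"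
    and mul_borel: "(\<lambda>(g, h). mul G g h)
          \<in> restrict_space (borel_str G \<Otimes>\<^sub>M borel_str G) {(g, h). src G g = rng G h} \<rightarrow>\<^sub>M borel_str G"
    and ivs_borel: "ivs G \<in> borel_str G \<rightarrow>\<^sub>M borel_str G"
    and src_countable: "x \<in> units G \<Longrightarrow> countable {g \<in> elts G. src G g = x}"
    and rng_countable: "x \<in> units G \<Longrightarrow> countable {g \<in> elts G. rng G g = x}"

definition one_sheeted :: "('g, 'm) groupoid_data_scheme \<Rightarrow> 'g set set" where
  "one_sheeted G = {E \<in> sets (borel_str G). inj_on (src G) E \<and> inj_on (rng G) E}"

text \<open>Only the values of \<open>sheet_map G E\<close> on \<open>src G ` E\<close> are meaningful.\<close>

definition sheet_map :: "('g, 'm) groupoid_data_scheme \<Rightarrow> 'g set \<Rightarrow> 'g \<Rightarrow> 'g" where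
  "sheet_map G E = rng G \<circ> the_inv_into E (src G)"

locale pmp_discrete_groupoid = discrete_borel_groupoid G + prob_space \<mu>
  for G :: "('g, 'm) groupoid_data_scheme" (structure) and \<mu> :: "'g measure" +
  assumes sets_mu: "sets \<mu> = sets (unit_borel G)"
    and invariant: "\<lbrakk>E \<in> one_sheeted G; A \<in> sets \<mu>; A \<subseteq> src G ` E\<rbrakk>
                    \<Longrightarrow> emeasure \<mu> (sheet_map G E ` A) = emeasure \<mu> A"

text \<open>The measure \<open>\<mu>\<close> on the unit space, lifted to the groupoid: the fibrewise counting measure
  (with value \<open>\<infinity>\<close> on infinite fibres) is integrated over the units.\<close>

definition lifted_measure :: "('g, 'm) groupoid_data_scheme \<Rightarrow> 'g measure \<Rightarrow> 'g set \<Rightarrow> ennreal" where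
  "lifted_measure G \<mu> B = (\<integral>\<^sup>+ x. emeasure (count_space UNIV) {g \<in> B. src G g = x} \<partial>\<mu>)"

definition set_mul :: "('g, 'm) groupoid_data_scheme \<Rightarrow> 'g set \<Rightarrow> 'g set \<Rightarrow> 'g set" where
  "set_mul G A B = {mul G g h | g h. g \<in> A \<and> h \<in> B \<and> src G g = rng G h}"

text \<open>Words are formal: the letter \<open>E\<^sup>\<epsilon>\<close> is the pair of the set \<open>E\<close> and a Boolean, which is
  \<open>True\<close> for \<open>\<epsilon> = 1\<close> and \<open>False\<close> for \<open>\<epsilon> = -1\<close>.\<close>

type_synonym 'g word = "('g set \<times> bool) list"

fun letter_set :: "('g, 'm) groupoid_data_scheme \<Rightarrow> 'g set \<times> bool \<Rightarrow> 'g set" where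
  "letter_set G (E, \<epsilon>) = (if \<epsilon> then E else ivs G ` E)"

text \<open>The unit space is neutral for \<open>set_mul\<close>, so it serves as the empty product.\<close>

fun word_set :: "('g, 'm) groupoid_data_scheme \<Rightarrow> 'g word \<Rightarrow> 'g set" where
  "word_set G [] = units G"
| "word_set G (a # w) = set_mul G (letter_set G a) (word_set G w)"

definition reduced_words :: "'g set set \<Rightarrow> 'g word set" where
  "reduced_words \<E> = {w. w \<noteq> [] \<and> fst ` set w \<subseteq> \<E> \<and>
     successively (\<lambda>(E, \<epsilon>) (F, \<delta>). E = F \<longrightarrow> \<epsilon> = \<delta>) w}"

definition countable_sheets :: "('g, 'm) groupoid_data_scheme \<Rightarrow> 'g set set \<Rightarrow> bool" where
  "countable_sheets G \<E> \<longleftrightarrow> countable \<E> \<and> \<E> \<subseteq> one_sheeted G"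

definition graphing :: "('g, 'm) groupoid_data_scheme \<Rightarrow> 'g measure \<Rightarrow> 'g set set \<Rightarrow> bool" where
  "graphing G \<mu> \<E> \<longleftrightarrow> countable_sheets G \<E> \<and>
     lifted_measure G \<mu> (elts G - (units G \<union> (\<Union>w\<in>reduced_words \<E>. word_set G w))) = 0"

definition treeing :: "('g, 'm) groupoid_data_scheme \<Rightarrow> 'g measure \<Rightarrow> 'g set set \<Rightarrow> bool" where
  "treeing G \<mu> \<E> \<longleftrightarrow> countable_sheets G \<E> \<and>
     (\<forall>w\<in>reduced_words \<E>. lifted_measure G \<mu> (word_set G w \<inter> units G) = 0)"

definition family_cost :: "('g, 'm) groupoid_data_scheme \<Rightarrow> 'g measure \<Rightarrow> 'g set set \<Rightarrow> ennreal" where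
  "family_cost G \<mu> \<E> = (\<Sum>\<^sub>\<infinity>E\<in>\<E>. lifted_measure G \<mu> E)"

definition groupoid_cost :: "('g, 'm) groupoid_data_scheme \<Rightarrow> 'g measure \<Rightarrow> ennreal" where
  "groupoid_cost G \<mu> = (INF \<E>\<in>{\<E>. graphing G \<mu> \<E>}. family_cost G \<mu> \<E>)"

end

theory Submission
  imports Defs
begin

text \<open>
  Let \<open>\<E>\<close> be a treeing that is a graphing and \<open>\<F>\<close> any other graphing. Cut \<open>\<F>\<close> into pieces that each
  lie in a single word of \<open>\<E>\<close>, and finitely many members of \<open>\<E>\<close> into pieces that each lie in a
  single word in the pieces of \<open>\<F>\<close>. Over a fixed unit, the \<open>\<E>\<close>-edges form a forest. Replacing a tree
  edge by its \<open>\<F>\<close>-path gives an operator \<open>B\<close> from finitely supported functions on tree edges to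
  such functions on \<open>\<F>\<close>-edges, and replacing an \<open>\<F>\<close>-edge by its tree path gives a bounded left
  inverse of \<open>B\<close>, because a forest has no cycles. Hence \<open>B\<close> is bounded below, and the powers of
  \<open>S = 1 - B*B / K\<close> tend to \<open>0\<close> geometrically. All operators involved are finite sums of
  partial translations, on which integrating the diagonal over the units defines a trace, because
  \<open>\<mu>\<close> is invariant. With \<open>S' = 1 - BB* / K\<close> one gets
  \<open>tr 1 - tr S^(2n) = tr 1 - tr S'^(2n)\<close>, where the two identity operators have as traces the costs
  of the tree pieces and of the \<open>\<F>\<close>-pieces, \<open>tr S^(2n)\<close> tends to \<open>0\<close>, and \<open>tr S'^(2n)\<close> is nonnegative.
\<close>

text \<open>The comparison is a dimension count: an operator that is bounded below cannot map into a
  space of smaller von Neumann dimension, and the dimension of the functions on tree edges is the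
  cost. Finitely supported functions and a limit of traces of powers take the place of completions
  and spectral theory. Cutting into pieces makes every operator a finite sum, hence bounded;
  infinite costs are reached only at the end, as suprema over finite parts. The exponent is even
  because the operators are self-adjoint: a diagonal entry of an even power is a squared norm, which
  gives decay on one side and positivity on the other. Two obstacles shape the rest. Costs are
  measures of sets of sources, and traces involve products of one-sheeted sets, so injective Borel
  images must be Borel: this is the Lusin-Souslin theorem, proved first. Moreover the words of a
  treeing may meet the units in a nonempty null set, so a null set saturated under the pieces of the
  other graphing has to be avoided before the tree can be used fibre by fibre.\<close>

section \<open>Injective Borel images\<close>

text \<open>\<open>C k z\<close> stands for the set indexed by the first \<open>k\<close> entries of \<open>z\<close>.\<close>

definition souslin_scheme :: "'a set set \<Rightarrow> (nat \<Rightarrow> (nat \<Rightarrow> nat) \<Rightarrow> 'a set) \<Rightarrow> bool" where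
  "souslin_scheme K C \<longleftrightarrow> (\<forall>k z. C k z \<in> K) \<and>
     (\<forall>k z z'. (\<forall>i<k. z i = z' i) \<longrightarrow> C k z = C k z')"

definition souslin :: "'a set set \<Rightarrow> 'a set \<Rightarrow> bool" where
  "souslin K A \<longleftrightarrow> (\<exists>C. souslin_scheme K C \<and> A = {x. \<exists>z. \<forall>k. x \<in> C k z})"

lemma souslin_schemeD:
  assumes "souslin_scheme K C"
  shows "C k z \<in> K" "(\<And>i. i < k \<Longrightarrow> z i = z' i) \<Longrightarrow> C k z = C k z'"
  using assms unfolding souslin_scheme_def by blast+

lemma souslinI:
  fixes C :: "nat \<Rightarrow> (nat \<Rightarrow> nat) \<Rightarrow> 'a set"
  assumes "\<And>k z. C k z \<in> K"
    and "\<And>k z z'. (\<And>i. i < k \<Longrightarrow> z i = z' i) \<Longrightarrow> C k z = C k z'"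
    and "A = {x. \<exists>z. \<forall>k. x \<in> C k z}"
  shows "souslin K A"
  unfolding souslin_def souslin_scheme_def using assms by blast

lemma souslin_base: "A \<in> K \<Longrightarrow> souslin K A"
  by (rule souslinI[where C = "\<lambda>_ _. A"]) auto

text \<open>The first entry of a branch chooses the index \<open>n\<close> and the remaining entries
  form a branch for \<open>A n\<close>. At level 0 no index is chosen yet, so the cell there is the
  whole space \<Omega>.\<close>

lemma souslin_UN:
  assumes "\<And>n::nat. souslin K (A n)" and top: "\<Omega> \<in> K" "\<Union>K \<subseteq> \<Omega>"
  shows "souslin K (\<Union>n. A n)"
proof -
  obtain C where sch: "\<And>n. souslin_scheme K (C n)" and A: "\<And>n. A n = {x. \<exists>z. \<forall>k. x \<in> C n k z}"
    using assms(1) unfolding souslin_def by metis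
  note C = souslin_schemeD[OF sch] A
  let ?D = "\<lambda>k z. case k of 0 \<Rightarrow> \<Omega> | Suc k' \<Rightarrow> C (z 0) k' (\<lambda>i. z (Suc i))"
  show ?thesis
  proof (rule souslinI[where C = ?D])
    show "?D k z \<in> K" for k z using C(1) top(1) by (auto split: nat.split)
    show "?D k z = ?D k z'" if "\<And>i. i < k \<Longrightarrow> z i = z' i" for k z z'
    proof (cases k)
      case (Suc k')
      have "C (z' 0) k' (\<lambda>i. z (Suc i)) = C (z' 0) k' (\<lambda>i. z' (Suc i))"
        by (rule C(2)) (use that Suc in auto)
      moreover have "z 0 = z' 0" using that Suc by auto
      ultimately show ?thesis using Suc by simp
    qed auto
    show "(\<Union>n. A n) = {x. \<exists>z. \<forall>k. x \<in> ?D k z}"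
    proof (intro set_eqI iffI)
      fix x assume "x \<in> (\<Union>n. A n)"
      then obtain n z where "\<forall>k. x \<in> C n k z" using C(3) by blast
      moreover have "x \<in> \<Omega>" using calculation C(1) top(2) by blast
      ultimately have "\<forall>k. x \<in> ?D k (\<lambda>i. case i of 0 \<Rightarrow> n | Suc j \<Rightarrow> z j)"
        by (auto split: nat.split)
      then show "x \<in> {x. \<exists>z. \<forall>k. x \<in> ?D k z}" by blast
    next
      fix x assume "x \<in> {x. \<exists>z. \<forall>k. x \<in> ?D k z}"
      then obtain z where z: "\<And>k. x \<in> ?D k z" by blast
      have "x \<in> C (z 0) k (\<lambda>i. z (Suc i))" for k using z[of "Suc k"] by simp
      then show "x \<in> (\<Union>n. A n)" using C(3) by blast
    qed
  qed
qed

text \<open>One branch codes a branch for every \<open>n\<close> through the pairing function, and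
  level \<open>m\<close> tests a single pair \<open>(n, k)\<close>. Since the pairing is increasing
  in its second argument, that test reads only entries below \<open>m\<close>.\<close>

lemma souslin_INT:
  assumes "\<And>n::nat. souslin K (A n)"
  shows "souslin K (\<Inter>n. A n)"
proof -
  obtain C where sch: "\<And>n. souslin_scheme K (C n)" and A: "\<And>n. A n = {x. \<exists>z. \<forall>k. x \<in> C n k z}"
    using assms(1) unfolding souslin_def by metis
  note C = souslin_schemeD[OF sch] A
  let ?D = "\<lambda>m w. case prod_decode m of (n, k) \<Rightarrow> C n k (\<lambda>i. w (prod_encode (n, i)))"
  have mono: "prod_encode (n, i) < prod_encode (n, k)" if "i < k" for n i k
    using that by (intro less_le_trans[OF _ le_prod_encode_2]
        strict_monoD[of "\<lambda>k. prod_encode (n, k)"])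
      (auto simp: prod_encode_def strict_mono_Suc_iff)
  show ?thesis
  proof (rule souslinI[where C = ?D])
    show "?D k z \<in> K" for k z using C(1) by (auto split: prod.split)
    show "?D m z = ?D m z'" if "\<And>i. i < m \<Longrightarrow> z i = z' i" for m z z'
    proof -
      obtain n k where nk: "prod_decode m = (n, k)" by fastforce
      then have m: "m = prod_encode (n, k)" by (metis prod_decode_inverse)
      show ?thesis unfolding nk prod.case
        by (rule C(2)) (use that mono m in auto)
    qed
    show "(\<Inter>n. A n) = {x. \<exists>z. \<forall>k. x \<in> ?D k z}"
    proof (intro set_eqI iffI)
      fix x assume "x \<in> (\<Inter>n. A n)"
      then have "\<forall>n. \<exists>z. \<forall>k. x \<in> C n k z" using C(3) by blast
      then obtain z where z: "\<And>n k. x \<in> C n k (z n)" by metis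
      have "x \<in> ?D m (\<lambda>i. z (fst (prod_decode i)) (snd (prod_decode i)))" for m
        using z by (auto split: prod.split)
      then show "x \<in> {x. \<exists>z. \<forall>k. x \<in> ?D k z}"
        by (intro CollectI exI[of _ "\<lambda>i. z (fst (prod_decode i)) (snd (prod_decode i))"] allI)
    next
      fix x assume "x \<in> {x. \<exists>z. \<forall>k. x \<in> ?D k z}"
      then obtain w where w: "\<And>k. x \<in> ?D k w" by blast
      have "x \<in> C n k (\<lambda>i. w (prod_encode (n, i)))" for n k
        using w[of "prod_encode (n, k)"] by simp
      then show "x \<in> (\<Inter>n. A n)" using C(3) by blast
    qed
  qed
qed

lemma souslin_Int:
  assumes "souslin K A" "souslin K B"
  shows "souslin K (A \<inter> B)"
proof -
  have "A \<inter> B = (\<Inter>n::nat. if n = 0 then A else B)" by (auto split: if_splits)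
  moreover have "souslin K (\<Inter>n::nat. if n = 0 then A else B)"
    by (rule souslin_INT) (simp add: assms)
  ultimately show ?thesis by simp
qed

lemma souslin_Un:
  assumes "souslin K A" "souslin K B" "\<Omega> \<in> K" "\<Union>K \<subseteq> \<Omega>"
  shows "souslin K (A \<union> B)"
proof -
  have "A \<union> B = (\<Union>n::nat. if n = 0 then A else B)" by (auto split: if_splits)
  moreover have "souslin K (\<Union>n::nat. if n = 0 then A else B)"
    by (rule souslin_UN) (use assms in simp_all)
  ultimately show ?thesis by simp
qed

text \<open>Souslin sets are not closed under complements, so the induction carries a set and its
  complement together.\<close>

lemma souslin_sigma_sets:
  assumes top: "\<Omega> \<in> K" "\<Union>K \<subseteq> \<Omega>" and emp: "{} \<in> K"
    and gen: "\<And>A. A \<in> \<G> \<Longrightarrow> souslin K A \<and> souslin K (\<Omega> - A)" and sub: "\<G> \<subseteq> Pow \<Omega>"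
    and A: "A \<in> sigma_sets \<Omega> \<G>"
  shows "souslin K A \<and> souslin K (\<Omega> - A)"
  using A
proof induction
  case (Basic a) then show ?case using gen by blast
next
  case Empty then show ?case using souslin_base top emp by auto
next
  case (Compl a)
  have "\<Omega> - (\<Omega> - a) = a" using sigma_sets_into_sp[OF sub Compl.hyps] by blast
  then show ?case using Compl by simp
next
  case (Union a)
  have "\<Omega> - (\<Union>i. a i) = (\<Inter>i. \<Omega> - a i)" by blast
  then show ?case using souslin_UN[OF _ top] souslin_INT Union by metis
qed

section \<open>Souslin sets in a metric space and the Lusin separation theorem\<close>

context Metric_space
begin

text \<open>Closed rectangles stand in for the closed sets of the square, so that distances can be
  controlled coordinate by coordinate.\<close>

definition rects :: "('a \<times> 'a) set set" where
  "rects = {A \<times> B | A B. closedin mtopology A \<and> closedin mtopology B}"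

text \<open>In a metric space an open set is a countable union of closed sets, and its complement is
  closed.\<close>

lemma borel_souslin:
  assumes "A \<in> sigma_sets M {U. openin mtopology U}"
  shows "souslin {C. closedin mtopology C} A"
proof -
  have "souslin {C. closedin mtopology C} A \<and> souslin {C. closedin mtopology C} (M - A)"
  proof (rule souslin_sigma_sets[OF _ _ _ _ _ assms])
    fix U assume "U \<in> {U. openin mtopology U}"
    then have U: "openin mtopology U" by simp
    then have "fsigma_in mtopology U"
      using open_imp_fsigma_in metrizable_space_mtopology by blast
    then obtain C where C: "\<forall>n::nat. closedin mtopology (C n)" "\<Union> (range C) = U"
      unfolding fsigma_in_ascending by metis
    have "souslin {C. closedin mtopology C} (\<Union>n. C n)"
      by (rule souslin_UN[where \<Omega> = M])
        (use C(1) closedin_topspace[of mtopology] closedin_subset[of mtopology]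
          in \<open>fastforce intro: souslin_base\<close>)+
    then have "souslin {C. closedin mtopology C} U" using C(2) by simp
    moreover have "closedin mtopology (M - U)" using U by auto
    ultimately show "souslin {C. closedin mtopology C} U \<and> souslin {C. closedin mtopology C} (M
      - U)"
      by (simp add: souslin_base)
  qed (use closedin_topspace[of mtopology] closedin_subset[of mtopology] openin_subset[of mtopology]
    in \<open>fastforce+\<close>)
  then show ?thesis by blast
qed

lemma souslin_Times:
  assumes "souslin {C. closedin mtopology C} A" "souslin {C. closedin mtopology C} B"
  shows "souslin rects (A \<times> B)"
proof -
  have M: "closedin mtopology M" using closedin_topspace[of mtopology] by simp
  have sub: "S \<subseteq> M" if S: "souslin {C. closedin mtopology C} S" for S
  proof
    fix x assume "x \<in> S"
    moreover obtain C where "souslin_scheme {C. closedin mtopology C} C" "S = {x. \<exists>z. \<forall>k. x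
      \<in> C k z}"
      using S unfolding souslin_def by blast
    ultimately obtain z where "souslin_scheme {C. closedin mtopology C} C" "x \<in> C 0 z" by blast
    then show "x \<in> M" using souslin_schemeD(1) closedin_subset by fastforce
  qed
  obtain C where sC: "souslin_scheme {C. closedin mtopology C} C"
    and C: "A = {x. \<exists>z. \<forall>k. x \<in> C k z}"
    using assms(1) unfolding souslin_def by blast
  obtain D where sD: "souslin_scheme {C. closedin mtopology C} D"
    and D: "B = {x. \<exists>z. \<forall>k. x \<in> D k z}"
    using assms(2) unfolding souslin_def by blast
  have "souslin rects (A \<times> M)"
  proof (rule souslinI)
    show "C k z \<times> M \<in> rects" for k z using souslin_schemeD(1)[OF sC, of k z] M
      by (auto simp: rects_def)
    show "C k z \<times> M = C k z' \<times> M" if "\<And>i. i < k \<Longrightarrow> z i = z' i" for k z z'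
      using souslin_schemeD(2)[OF sC that] by simp
  qed (use C in blast)
  moreover have "souslin rects (M \<times> B)"
  proof (rule souslinI)
    show "M \<times> D k z \<in> rects" for k z using souslin_schemeD(1)[OF sD, of k z] M
      by (auto simp: rects_def)
    show "M \<times> D k z = M \<times> D k z'" if "\<And>i. i < k \<Longrightarrow> z i = z' i" for k z z'
      using souslin_schemeD(2)[OF sD that] by simp
  qed (use D in blast)
  ultimately have "souslin rects ((A \<times> M) \<inter> (M \<times> B))" by (rule souslin_Int)
  moreover have "(A \<times> M) \<inter> (M \<times> B) = A \<times> B" using sub assms by blast
  ultimately show ?thesis by simp
qed

lemma borel_souslin_prod:
  assumes "A \<in> sigma_sets (M \<times> M) {A \<times> B | A B. A \<in> sigma_sets M {U. openin mtopology U}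
     \<and> B \<in> sigma_sets M {U. openin mtopology U}}"
  shows "souslin rects A"
proof -
  let ?B = "sigma_sets M {U. openin mtopology U}"
  have M: "closedin mtopology M" using closedin_topspace[of mtopology] by simp
  have MM: "M \<times> M \<in> rects" "\<Union>rects \<subseteq> M \<times> M" "{} \<in> rects"
    using M closedin_subset by (fastforce simp: rects_def)+
  have sB: "?B \<subseteq> Pow M"
    using sigma_sets_into_sp[of "{U. openin mtopology U}" M] openin_subset by fastforce
  have "souslin rects A \<and> souslin rects (M \<times> M - A)"
  proof (rule souslin_sigma_sets[OF MM _ _ assms])
    fix R assume "R \<in> {A \<times> B | A B. A \<in> ?B \<and> B \<in> ?B}"
    then obtain A B where R: "R = A \<times> B" "A \<in> ?B" "B \<in> ?B" by blast
    have c: "M - A \<in> ?B" "M - B \<in> ?B" "M \<in> ?B" using R sigma_sets.Compl sigma_sets_top by auto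
    have "souslin rects (((M - A) \<times> M) \<union> (M \<times> (M - B)))"
      by (intro souslin_Un[OF _ _ MM(1,2)] souslin_Times borel_souslin c)
    moreover have "M \<times> M - A \<times> B = ((M - A) \<times> M) \<union> (M \<times> (M - B))" using sB R by blast
    ultimately show "souslin rects R \<and> souslin rects (M \<times> M - R)"
      using R souslin_Times borel_souslin by simp
  qed (use sB in blast)
  then show ?thesis by blast
qed

lemma dense_sequence:
  assumes "separable_space mtopology" "M \<noteq> {}"
  obtains a :: "nat \<Rightarrow> 'a" where "\<And>n. a n \<in> M" "\<And>x e. x \<in> M \<Longrightarrow> e > 0 \<Longrightarrow> \<exists>n. x \<in> mball (a n) e"
proof -
  obtain U where U: "countable U" "U \<subseteq> M" "mtopology closure_of U = M"
    using assms unfolding separable_space_def by auto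
  have "U \<noteq> {}" using U(3) assms by auto
  then have aU: "range (from_nat_into U) = U" using U(1) by (rule range_from_nat_into)
  have "\<exists>n. x \<in> mball (from_nat_into U n) e" if x: "x \<in> M" "e > 0" for x e
  proof -
    have "\<exists>y\<in>U. y \<in> mball x e" using U(3) x unfolding metric_closure_of by blast
    then obtain n where "from_nat_into U n \<in> mball x e" by (metis aU rangeE)
    then show ?thesis by (auto simp: commute)
  qed
  then show thesis using that[of "from_nat_into U"] U(2) aU by blast
qed

text \<open>Intersecting a scheme with shrinking balls around a dense sequence makes its branches Cauchy.\<close>

lemma souslin_small:
  assumes sep: "separable_space mtopology" and Q: "souslin rects Q"
  obtains C where "souslin_scheme rects C" "Q = {x. \<exists>z. \<forall>k. x \<in> C k z}"
    "\<And>z e. e > 0 \<Longrightarrow> \<exists>k. \<forall>x\<in>C k z. \<forall>y\<in>C k z. d (fst x) (fst y) < e \<and> d (snd x) (snd y) < e"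
proof -
  obtain D where sD: "souslin_scheme rects D" and D: "Q = {x. \<exists>z. \<forall>k. x \<in> D k z}"
    using Q unfolding souslin_def by blast
  have M: "closedin mtopology M" using closedin_topspace[of mtopology] by simp
  have QM: "D k z \<subseteq> M \<times> M" for k z
    using souslin_schemeD(1)[OF sD, of k z] closedin_subset unfolding rects_def by fastforce
  show thesis
  proof (cases "M = {}")
    case True
    then show thesis using that[OF sD D] QM by blast
  next
    case False
    obtain a :: "nat \<Rightarrow> 'a" where a: "\<And>n. a n \<in> M"
      and dense: "\<And>x e. x \<in> M \<Longrightarrow> e > 0 \<Longrightarrow> \<exists>n. x \<in> mball (a n) e"
      by (rule dense_sequence[OF sep False]) blast
    define r :: "nat \<Rightarrow> real" where "r m = 1 / Suc m" for m
    define even odd :: "(nat \<Rightarrow> nat) \<Rightarrow> nat \<Rightarrow> nat" where "even z i = fst (prod_decode (z i))"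
      and "odd z i = snd (prod_decode (z i))" for z i
    \<comment> \<open>An entry of a branch codes three numbers: an entry for \<open>D\<close> and
      the indices of two centres. Level \<open>Suc m\<close> is a cell of \<open>D\<close> for even
      \<open>m\<close> and a product of balls of radius \<open>r m\<close> for odd \<open>m\<close>;
      as \<open>m div 2\<close> is at most \<open>m\<close>, only entries below \<open>Suc m\<close>
      are read. The odd \<open>?m\<close> below therefore selects a level that consists of
      balls.\<close>
    define E where "E k z = (case k of 0 \<Rightarrow> D 0 z | Suc m \<Rightarrow> (if Parity.even m then D (m div 2) (even
      z) else
      mcball (a (fst (prod_decode (odd z m)))) (r m) \<times> mcball (a (snd (prod_decode (odd z m)))) (r
        m)))" for k z
    have rects: "E k z \<in> rects" for k z
      using souslin_schemeD(1)[OF sD] unfolding E_def rects_def by (auto split: nat.split)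
    have det: "E k z = E k z'" if "\<And>i. i < k \<Longrightarrow> z i = z' i" for k z z'
    proof (cases k)
      case 0 then show ?thesis unfolding E_def using souslin_schemeD(2)[OF sD, of 0 z z'] by simp
    next
      case (Suc m)
      have "D (m div 2) (even z) = D (m div 2) (even z')"
        by (rule souslin_schemeD(2)[OF sD]) (use that Suc in \<open>auto simp: even_def\<close>)
      moreover have "odd z m = odd z' m" using that Suc by (auto simp: odd_def)
      ultimately show ?thesis unfolding E_def Suc by simp
    qed
    have sE: "souslin_scheme rects E" unfolding souslin_scheme_def using rects det by blast
    have E0: "D 0 z = D 0 z'" for z z' using souslin_schemeD(2)[OF sD, of 0 z z'] by simp
    have eq: "Q = {x. \<exists>z. \<forall>k. x \<in> E k z}"
    proof (intro set_eqI iffI)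
      fix x assume x: "x \<in> Q"
      then obtain z where z: "\<And>k. x \<in> D k z" using D by blast
      have xM: "fst x \<in> M" "snd x \<in> M" using z[of 0] QM by fastforce+
      have "\<forall>m. \<exists>n1 n2. fst x \<in> mball (a n1) (r m) \<and> snd x \<in> mball (a n2) (r m)"
        using dense[OF xM(1)] dense[OF xM(2)] by (simp add: r_def)
      then obtain n1 n2 where n: "\<And>m. fst x \<in> mball (a (n1 m)) (r m)" "\<And>m. snd x
        \<in> mball (a (n2 m)) (r m)"
        by metis
      define w where "w i = prod_encode (z i, prod_encode (n1 i, n2 i))" for i
      have w: "even w = z" "odd w m = prod_encode (n1 m, n2 m)" for m
        by (auto simp: even_def odd_def w_def)
      have "x \<in> E k w" for k
      proof (cases k)
        case 0 then show ?thesis using z[of 0] E0[of z w] by (simp add: E_def)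
      next
        case (Suc m)
        have "x \<in> mcball (a (n1 m)) (r m) \<times> mcball (a (n2 m)) (r m)"
          using n[of m] mball_subset_mcball by (cases x) (auto simp: subset_iff)
        then show ?thesis using z by (simp add: E_def Suc w)
      qed
      then show "x \<in> {x. \<exists>z. \<forall>k. x \<in> E k z}" by blast
    next
      fix x assume "x \<in> {x. \<exists>z. \<forall>k. x \<in> E k z}"
      then obtain w where w: "\<And>k. x \<in> E k w" by blast
      have "x \<in> D k (even w)" for k using w[of "Suc (2 * k)"] by (simp add: E_def)
      then show "x \<in> Q" using D by blast
    qed
    have small: "\<exists>k. \<forall>x\<in>E k z. \<forall>y\<in>E k z. d (fst x) (fst y) < e \<and> d (snd x) (snd y) < e"
      if e: "e > 0" for z e
    proof -
      obtain n where n: "n > 0" "1 / real n < e / 2" using e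
        by (meson half_gt_zero nat_approx_posE zero_less_Suc)
      let ?m = "Suc (2 * n)"
      have r: "2 * r ?m < e"
      proof -
        have "r ?m \<le> 1 / real n" unfolding r_def using n(1) by (intro divide_left_mono) auto
        then show ?thesis using n by simp
      qed
      have "d u v < e" if "u \<in> mcball c (r ?m)" "v \<in> mcball c (r ?m)" for u v c
      proof -
        have "c \<in> M" "u \<in> M" "v \<in> M" "d c u \<le> r ?m" "d c v \<le> r ?m" using that by auto
        moreover have "d u v \<le> d c u + d c v" using triangle[of u c v] calculation
          by (simp add: commute)
        ultimately show ?thesis using r by linarith
      qed
      then show ?thesis by (intro exI[of _ "Suc ?m"]) (auto simp: E_def)
    qed
    show thesis by (rule that[OF sE eq small])
  qed
qed

text \<open>Separability by a Borel set passes to countable unions on both sides. If the two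
  projections were inseparable, one could fix the entries of a branch on each side one after another
  and keep an inseparable pair at every stage. These two branches shrink to points of
  \<open>Q1\<close> and \<open>Q2\<close> with distinct second coordinates, and a small ball around
  one of the coordinates then separates the pair at a late stage, a contradiction.\<close>

lemma lusin_separation:
  assumes sep: "separable_space mtopology" and comp: mcomplete
    and Q1: "souslin rects Q1" and Q2: "souslin rects Q2" and disj: "snd ` Q1 \<inter> snd ` Q2 = {}"
  shows "\<exists>S\<in>sigma_sets M {U. openin mtopology U}. snd ` Q1 \<subseteq> S \<and> S \<inter> snd ` Q2 = {}"
proof (rule ccontr)
  let ?B = "sigma_sets M {U. openin mtopology U}"
  define separated where "separated X Y \<longleftrightarrow> (\<exists>S\<in>?B. X \<subseteq> S \<and> S \<inter> Y = {})" for X Y :: "'a set"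
  assume "\<not> ?thesis"
  then have nsep: "\<not> separated (snd ` Q1) (snd ` Q2)" unfolding separated_def by blast
  obtain C1 where s1: "souslin_scheme rects C1" and C1: "Q1 = {x. \<exists>z. \<forall>k. x \<in> C1 k z}"
    and sm1: "\<And>z e. e > 0 \<Longrightarrow> \<exists>k. \<forall>x\<in>C1 k z. \<forall>y\<in>C1 k z. d (fst x) (fst y) < e \<and> d (snd x) (snd y) < e"
    by (rule souslin_small[OF sep Q1], rule that)
  obtain C2 where s2: "souslin_scheme rects C2" and C2: "Q2 = {x. \<exists>z. \<forall>k. x \<in> C2 k z}"
    and sm2: "\<And>z e. e > 0 \<Longrightarrow> \<exists>k. \<forall>x\<in>C2 k z. \<forall>y\<in>C2 k z. d (fst x) (fst y) < e \<and> d (snd x) (snd y) < e"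
    by (rule souslin_small[OF sep Q2], rule that)
  \<comment> \<open>The part of the Souslin set that is contributed by the branches agreeing with
    \<open>z\<close> in the first \<open>k\<close> entries.\<close>
  define R where "R C k z = {x. \<exists>z'. (\<forall>i<k. z' i = z i) \<and> (\<forall>k. x \<in> C k z')}"
    for C :: "nat \<Rightarrow> (nat \<Rightarrow> nat) \<Rightarrow> ('a \<times> 'a) set" and k z
  have R_sub: "R C k z \<subseteq> C i z" if "souslin_scheme rects C" "i \<le> k" for C k z i
  proof
    fix x assume "x \<in> R C k z"
    then obtain z' where z': "\<forall>i<k. z' i = z i" "\<forall>k. x \<in> C k z'" unfolding R_def by blast
    have "C i z' = C i z" by (rule souslin_schemeD(2)[OF that(1)]) (use z' that in auto)
    then show "x \<in> C i z" using z' by blast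
  qed
  have R_M: "snd x \<in> M" if "souslin_scheme rects C" "x \<in> R C k z" for C k z x
  proof -
    have "C k z \<in> rects" "x \<in> C k z" using souslin_schemeD(1) R_sub[OF that(1) order.refl] that
      by blast+
    then show ?thesis unfolding rects_def using closedin_subset[of mtopology] by fastforce
  qed
  have R_split: "R C k z = (\<Union>n. R C (Suc k) (z(k := n)))" for C k z
  proof (intro set_eqI iffI)
    fix x assume "x \<in> R C k z"
    then obtain z' where z': "\<forall>i<k. z' i = z i" "\<forall>k. x \<in> C k z'" unfolding R_def by blast
    then have "x \<in> R C (Suc k) (z(k := z' k))" unfolding R_def by (auto simp: less_Suc_eq)
    then show "x \<in> (\<Union>n. R C (Suc k) (z(k := n)))" by blast
  next
    fix x assume "x \<in> (\<Union>n. R C (Suc k) (z(k := n)))"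
    then obtain n z' where "\<forall>i<Suc k. z' i = (z(k := n)) i" "\<forall>k. x \<in> C k z'" unfolding R_def
      by blast
    then have "\<forall>i<k. z' i = z i" "\<forall>k. x \<in> C k z'" by auto
    then show "x \<in> R C k z" unfolding R_def by blast
  qed
  have sep_Un: "separated (\<Union>n. X n) (\<Union>m. Y m)" if XY: "\<And>n m. separated (X n) (Y m)"
    for X Y :: "nat \<Rightarrow> 'a set"
  proof -
    obtain S where S: "\<And>n m. S n m \<in> ?B" "\<And>n m. X n \<subseteq> S n m" "\<And>n m. S n m \<inter> Y m = {}"
      using XY unfolding separated_def by metis
    interpret B: sigma_algebra M ?B
      using openin_subset[of mtopology] by (intro sigma_algebra_sigma_sets) fastforce
    have "(\<Inter>m. S n m) \<in> ?B" for n using S(1) by (intro B.countable_INT) auto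
    then have "(\<Union>n. \<Inter>m. S n m) \<in> ?B" by (intro B.countable_UN) auto
    moreover have "(\<Union>n. X n) \<subseteq> (\<Union>n. \<Inter>m. S n m)" using S(2) by blast
    moreover have "(\<Union>n. \<Inter>m. S n m) \<inter> (\<Union>m. Y m) = {}" using S(3) by blast
    ultimately show ?thesis unfolding separated_def by blast
  qed
  define P where "P k = (\<lambda>(z, w). \<not> separated (snd ` R C1 k z) (snd ` R C2 k w))" for k
  \<comment> \<open>Stage \<open>k\<close> holds an inseparable pair of branch prefixes; the next
    stage changes only entry \<open>k\<close>, so the prefixes converge to the branches
    \<open>z\<close> and \<open>w\<close>.\<close>
  have "\<exists>f. \<forall>k. P k (f k) \<and> (\<forall>i<k. fst (f (Suc k)) i = fst (f k) i \<and> snd (f (Suc k)) i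
    = snd (f k) i)"
  proof (rule dependent_nat_choice)
    have "R C1 0 z = Q1" "R C2 0 z = Q2" for z unfolding R_def C1 C2 by auto
    then show "\<exists>x. P 0 x" unfolding P_def using nsep by auto
  next
    fix x k assume "P k x"
    then obtain z w where x: "x = (z, w)" "\<not> separated (snd ` R C1 k z) (snd ` R C2 k w)"
      unfolding P_def by (cases x) auto
    have "snd ` R C1 k z = (\<Union>n. snd ` R C1 (Suc k) (z(k := n)))" "snd ` R C2 k w
      = (\<Union>n. snd ` R C2 (Suc k) (w(k := n)))"
      by (subst R_split, blast)+
    then obtain n m where "\<not> separated (snd ` R C1 (Suc k) (z(k := n))) (snd ` R C2 (Suc k) (w(k :=
      m)))"
      using sep_Un x(2) by metis
    then show "\<exists>y. P (Suc k) y \<and> (\<forall>i<k. fst y i = fst x i \<and> snd y i = snd x i)"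
      unfolding P_def x by (intro exI[of _ "(z(k := n), w(k := m))"]) auto
  qed
  then obtain f where f: "\<And>k. P k (f k)"
      "\<And>k i. i < k \<Longrightarrow> fst (f (Suc k)) i = fst (f k) i" "\<And>k i. i < k \<Longrightarrow> snd (f (Suc k)) i
        = snd (f k) i"
    by blast
  define z w where "z i = fst (f (Suc i)) i" and "w i = snd (f (Suc i)) i" for i
  have fz: "fst (f k) i = z i" "snd (f k) i = w i" if "i < k" for i k
    using that by (induction k) (auto simp: z_def w_def less_Suc_eq f(2,3))
  have nsepk: "\<not> separated (snd ` R C1 k z) (snd ` R C2 k w)" for k
  proof -
    have "R C1 k (fst (f k)) = R C1 k z" "R C2 k (snd (f k)) = R C2 k w" using fz unfolding R_def
      by auto
    then show ?thesis using f(1)[of k] unfolding P_def by (cases "f k") auto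
  qed
  have emp: "{} \<in> ?B" "M \<in> ?B" by (auto intro: sigma_sets.Empty sigma_sets_top)
  \<comment> \<open>The cells along a branch need not be nested, but \<open>R C k z\<close> lies in
    all cells up to level \<open>k\<close>. This makes any choice of points \<open>x k\<close>
    Cauchy in both coordinates and puts the limit into every closed cell.\<close>
  have lim: "\<exists>x\<in>Q. \<forall>k. x \<in> C k z"
    if s: "souslin_scheme rects C" and C: "Q = {x. \<exists>z. \<forall>k. x \<in> C k z}"
    and sm: "\<And>z e. e > 0 \<Longrightarrow> \<exists>k. \<forall>x\<in>C k z. \<forall>y\<in>C k z. d (fst x) (fst y) < e \<and> d (snd x) (snd y) < e"
    and ne: "\<And>k. R C k z \<noteq> {}" for C Q z
  proof -
    obtain x where "\<And>k. x k \<in> R C k z" using ne by (meson ex_in_conv)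
    then have x: "x k \<in> C i z" if "i \<le> k" for i k using R_sub[OF s that] by blast
    have xM: "fst (x k) \<in> M" "snd (x k) \<in> M" for k
      using x[of k k] souslin_schemeD(1)[OF s, of k z] closedin_subset unfolding rects_def
        by fastforce+
    have "MCauchy (fst \<circ> x) \<and> MCauchy (snd \<circ> x)"
      unfolding MCauchy_def using xM sm[of _ z] x by (auto simp: image_subset_iff) (meson, meson)
    then obtain u v where uv: "limitin mtopology (fst \<circ> x) u sequentially"
      "limitin mtopology (snd \<circ> x) v sequentially"
      using comp unfolding mcomplete_def by blast
    have "(u, v) \<in> C k z" for k
    proof -
      obtain A B where AB: "C k z = A \<times> B" "closedin mtopology A" "closedin mtopology B"
        using souslin_schemeD(1)[OF s, of k z] unfolding rects_def by blast
      have ev: "\<forall>\<^sub>F i in sequentially. x i \<in> A \<times> B"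
        unfolding eventually_sequentially using x[of k] AB(1) by auto
      have "u \<in> A"
        by (rule limitin_closedin[OF uv(1) AB(2)]) (use ev in \<open>auto elim: eventually_mono\<close>)
      moreover have "v \<in> B"
        by (rule limitin_closedin[OF uv(2) AB(3)]) (use ev in \<open>auto elim: eventually_mono\<close>)
      ultimately show ?thesis using AB(1) by blast
    qed
    then show ?thesis using C by blast
  qed
  have ne1: "R C1 k z \<noteq> {}" and ne2: "R C2 k w \<noteq> {}" for k
  proof -
    show "R C1 k z \<noteq> {}" using nsepk[of k] emp unfolding separated_def by auto
    show "R C2 k w \<noteq> {}"
    proof
      assume "R C2 k w = {}"
      moreover have "snd ` R C1 k z \<subseteq> M"
        using R_M[OF s1] by blast
      ultimately show False using nsepk[of k] emp(2) unfolding separated_def by auto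
    qed
  qed
  obtain x where x: "x \<in> Q1" "\<And>k. x \<in> C1 k z" using lim[OF s1 C1 sm1 ne1] by blast
  obtain y where y: "y \<in> Q2" "\<And>k. y \<in> C2 k w" using lim[OF s2 C2 sm2 ne2] by blast
  have xy: "snd x \<noteq> snd y" using x(1) y(1) disj by blast
  have xM: "snd x \<in> M" using x(2)[of 0] souslin_schemeD(1)[OF s1, of 0 z] closedin_subset
    unfolding rects_def by fastforce
  have yM: "snd y \<in> M" using y(2)[of 0] souslin_schemeD(1)[OF s2, of 0 w] closedin_subset
    unfolding rects_def by fastforce
  define e where "e = d (snd x) (snd y) / 2"
  have e: "e > 0" using xy xM yM by (simp add: e_def)
  obtain k1 where k1: "\<And>u v. u \<in> C1 k1 z \<Longrightarrow> v \<in> C1 k1 z \<Longrightarrow> d (snd u) (snd v) < e"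
    using sm1[OF e, of z] by blast
  obtain k2 where k2: "\<And>u v. u \<in> C2 k2 w \<Longrightarrow> v \<in> C2 k2 w \<Longrightarrow> d (snd u) (snd v) < e"
    using sm2[OF e, of w] by blast
  define k where "k = max k1 k2"
  have M1: "snd u \<in> M" if "u \<in> R C1 k z" for u using R_M[OF s1 that] .
  have M2: "snd u \<in> M" if "u \<in> R C2 k w" for u using R_M[OF s2 that] .
  have "snd ` R C1 k z \<subseteq> mball (snd x) e"
  proof
    fix v assume "v \<in> snd ` R C1 k z"
    then obtain u where u: "u \<in> R C1 k z" "v = snd u" by blast
    have "u \<in> C1 k1 z" using R_sub[OF s1, of k1 k z] u(1) by (auto simp: k_def)
    then show "v \<in> mball (snd x) e" using k1[OF x(2)] M1[OF u(1)] u(2) xM by simp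
  qed
  moreover have "mball (snd x) e \<inter> snd ` R C2 k w = {}"
  proof -
    have "d (snd x) (snd u) \<ge> e" if "u \<in> R C2 k w" for u
    proof -
      have "u \<in> C2 k2 w" using R_sub[OF s2, of k2 k w] that by (auto simp: k_def)
      then have "d (snd y) (snd u) < e" using k2[OF y(2)] by blast
      moreover have "d (snd x) (snd y) \<le> d (snd x) (snd u) + d (snd y) (snd u)"
        using triangle[of "snd x" "snd u" "snd y"] xM yM M2[OF that] by (simp add: commute)
      ultimately show ?thesis using e_def by (simp add: field_simps)
    qed
    then have "v \<notin> mball (snd x) e" if "v \<in> snd ` R C2 k w" for v using that
      by auto (metis linorder_not_le snd_conv)
    then show ?thesis by blast
  qed
  moreover have "mball (snd x) e \<in> ?B" by (auto intro: sigma_sets.Basic)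
  ultimately show False using nsepk[of k] unfolding separated_def by blast
qed

end

section \<open>Equalizers and injective images in standard Borel spaces\<close>

lemma standard_borel_metric:
  assumes "standard_borel M"
  obtains d where "Metric_space (space M) d" "Metric_space.mcomplete (space M) d"
    "separable_space (Metric_space.mtopology (space M) d)"
    "sets M = sigma_sets (space M) {U. openin (Metric_space.mtopology (space M) d) U}"
proof -
  obtain T where T: "completely_metrizable_space T" "second_countable T"
     "topspace T = space M" "sets M = sigma_sets (topspace T) {U. openin T U}"
    using assms unfolding standard_borel_def by blast
  obtain S d where d: "Metric_space S d" "Metric_space.mcomplete S d" "T
    = Metric_space.mtopology S d"
    using T(1) unfolding completely_metrizable_space_def by blast
  have "S = space M" using T(3) d by (simp add: Metric_space.topspace_mtopology)
  moreover have "separable_space T" using T(2) by (rule second_countable_imp_separable_space)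
  ultimately show thesis using that[of d] d T by simp
qed

text \<open>Points coincide as soon as every ball of radius \<open>1 / Suc k\<close> around the
  dense sequence that contains the first also contains the second. These are countably many
  measurable conditions.\<close>

lemma measurable_eq_set:
  assumes "standard_borel M" "g \<in> N \<rightarrow>\<^sub>M M" "h \<in> N \<rightarrow>\<^sub>M M"
  shows "{y \<in> space N. g y = h y} \<in> sets N"
proof (cases "space N = {}")
  case True then show ?thesis by simp
next
  case False
  obtain d where d: "Metric_space (space M) d"
    "separable_space (Metric_space.mtopology (space M) d)"
    "sets M = sigma_sets (space M) {U. openin (Metric_space.mtopology (space M) d) U}"
    using standard_borel_metric[OF assms(1)] by blast
  interpret Metric_space "space M" d by fact
  have "space M \<noteq> {}" using False measurable_space[OF assms(2)] by blast
  then obtain a where a: "\<And>n. a n \<in> space M" "\<And>x e. x \<in> space M \<Longrightarrow> e > 0 \<Longrightarrow> \<exists>n::nat. x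
    \<in> mball (a n) e"
    by (rule dense_sequence[OF d(2)]) blast
  have [measurable]: "mball x e \<in> sets M" for x e unfolding d(3) by (auto intro: sigma_sets.Basic)
  note [measurable] = assms(2,3)
  have "(g y = h y) = (\<forall>n k. g y \<in> mball (a n) (1 / real (Suc k)) \<longrightarrow> h y
    \<in> mball (a n) (1 / real (Suc k)))"
    if y: "y \<in> space N" for y
  proof (intro iffI allI impI)
    have m: "g y \<in> space M" "h y \<in> space M" using measurable_space y assms by metis+
    assume R: "\<forall>n k. g y \<in> mball (a n) (1 / real (Suc k)) \<longrightarrow> h y \<in> mball (a n) (1 / real (Suc k))"
    show "g y = h y"
    proof (rule ccontr)
      assume "g y \<noteq> h y"
      then have "d (g y) (h y) / 2 > 0" using m by simp
      then obtain k where k: "1 / real (Suc k) < d (g y) (h y) / 2" by (meson nat_approx_posE)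
      obtain n where n: "g y \<in> mball (a n) (1 / real (Suc k))"
        using a(2)[OF m(1), of "1 / real (Suc k)"] by auto
      then have "h y \<in> mball (a n) (1 / real (Suc k))" using R by blast
      then have "d (a n) (g y) < 1 / real (Suc k)" "d (a n) (h y) < 1 / real (Suc k)" using n
        by auto
      moreover have "d (g y) (h y) \<le> d (a n) (g y) + d (a n) (h y)"
        using triangle[of "g y" "a n" "h y"] m a(1) by (simp add: commute)
      ultimately show False using k by linarith
    qed
  qed simp
  then have "{y \<in> space N. g y = h y} = {y \<in> space N. \<forall>n k. g y \<in> mball (a n) (1 / real (Suc k))
    \<longrightarrow> h y \<in> mball (a n) (1 / real (Suc k))}"
    by blast
  also have "\<dots> \<in> sets N" by measurable
  finally show ?thesis .
qed

text \<open>The inverse is recovered as a limit: at stage \<open>k\<close>, separating the images of the cells of a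
  partition into sets of diameter at most \<open>2 / 2^k\<close> locates the preimage up to that error.\<close>

theorem lusin_souslin:
  assumes M: "standard_borel M" and f: "f \<in> M \<rightarrow>\<^sub>M M" and E: "E \<in> sets M" and inj: "inj_on f E"
  shows "f ` E \<in> sets M"
proof (cases "space M = {}")
  case True
  then have "E = {}" using sets.sets_into_space[OF E] by simp
  then show ?thesis by simp
next
  case False
  obtain d where d: "Metric_space (space M) d" and comp: "Metric_space.mcomplete (space M) d"
    and sep: "separable_space (Metric_space.mtopology (space M) d)"
    and sM: "sets M = sigma_sets (space M) {U. openin (Metric_space.mtopology (space M) d) U}"
    by (rule standard_borel_metric[OF M])
  interpret Metric_space "space M" d by fact
  obtain a :: "nat \<Rightarrow> 'a" where a: "\<And>n. a n \<in> space M"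
      and dense: "\<And>x e. x \<in> space M \<Longrightarrow> e > 0 \<Longrightarrow> \<exists>n. x \<in> mball (a n) e"
    by (rule dense_sequence[OF sep False]) blast
  have open_sets: "U \<in> sets M" if "openin mtopology U" for U unfolding sM using that
    by (auto intro: sigma_sets.Basic)
  have ball [measurable]: "mball x e \<in> sets M" for x e by (rule open_sets) simp
  note [measurable] = f E
  \<comment> \<open>The image is the second projection of the graph of \<open>f\<close> over
    \<open>D\<close>. The graph is an equalizer, hence lies in the product sigma-algebra and is
    Souslin over closed rectangles.\<close>
  have graph: "\<exists>Q. souslin rects Q \<and> snd ` Q = f ` D" if D: "D \<in> sets M" for D
  proof (intro exI conjI)
    let ?Q = "{p \<in> space (M \<Otimes>\<^sub>M M). snd p = f (fst p)} \<inter> {p \<in> space (M \<Otimes>\<^sub>M M). fst p \<in> D}"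
    note [measurable] = D
    have "?Q \<in> sets (M \<Otimes>\<^sub>M M)"
      by (intro sets.Int measurable_eq_set[OF M]) measurable
    then show "souslin rects ?Q"
      unfolding sets_pair_measure sM by (intro borel_souslin_prod) (simp add: conj_commute)
    show "snd ` ?Q = f ` D"
      using sets.sets_into_space[OF D] measurable_space[OF f]
        by (force simp: space_pair_measure image_iff)
  qed
  define r :: "nat \<Rightarrow> real" where "r k = 1 / 2 ^ k" for k
  \<comment> \<open>For each \<open>k\<close> the balls of radius \<open>r k\<close> are made
    disjoint, giving a countable measurable partition of the space.\<close>
  define P where "P k n = mball (a n) (r k) - (\<Union>m<n. mball (a m) (r k))" for k n
  have P_sets: "P k n \<in> sets M" for k n unfolding P_def by auto
  have P_ex: "\<exists>n. x \<in> P k n" if x: "x \<in> space M" for x k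
  proof -
    have ex: "\<exists>n. x \<in> mball (a n) (r k)" using dense[OF x, of "r k"] by (simp add: r_def)
    then have "x \<in> P k (LEAST n. x \<in> mball (a n) (r k))"
      unfolding P_def using LeastI_ex[OF ex] not_less_Least by blast
    then show ?thesis by blast
  qed
  have P_disj: "n = m" if "x \<in> P k n" "x \<in> P k m" for x k n m
    using that unfolding P_def by (metis DiffE UN_I lessThan_iff linorder_neqE_nat)
  \<comment> \<open>Injectivity makes the images of the two parts of \<open>E\<close> disjoint; for
    a point of the image, membership in \<open>S k n\<close> then decides whether its preimage lies
    in the cell \<open>P k n\<close>.\<close>
  have "\<exists>S\<in>sets M. f ` (E \<inter> P k n) \<subseteq> S \<and> S \<inter> f ` (E - P k n) = {}" for k n
  proof -
    obtain Q1 where Q1: "souslin rects Q1" "snd ` Q1 = f ` (E \<inter> P k n)"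
      using graph[of "E \<inter> P k n"] E P_sets by blast
    obtain Q2 where Q2: "souslin rects Q2" "snd ` Q2 = f ` (E - P k n)"
      using graph[of "E - P k n"] E P_sets by blast
    have "f ` (E \<inter> P k n) \<inter> f ` (E - P k n) = {}" using inj by (auto simp: inj_on_def)
    then show ?thesis using lusin_separation[OF sep comp Q1(1) Q2(1)] unfolding Q1(2) Q2(2) sM
      by blast
  qed
  then obtain S where S [measurable]: "\<And>k n. S k n \<in> sets M" and S1: "\<And>k n. f ` (E \<inter> P k n) \<subseteq> S k n"
      and S2: "\<And>k n. S k n \<inter> f ` (E - P k n) = {}" by metis
  define c where "c k y = (LEAST n. y \<in> S k n)" for k y
  have [measurable]: "c k \<in> M \<rightarrow>\<^sub>M count_space UNIV" for k unfolding c_def by measurable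
  \<comment> \<open>Outside the image the located cells may be inconsistent. The distance condition
    keeps the centres Cauchy for every point of \<open>C\<close>, so that the limit map
    \<open>h\<close> is defined there and is measurable.\<close>
  define C where "C = {y \<in> space M. \<forall>k. (\<exists>n. y \<in> S k n) \<and> d (a (c k y)) (a (c (Suc k) y)) \<le> 2
    * r k}"
  have C_sets [measurable]: "C \<in> sets M" unfolding C_def by measurable
  have fE: "f x \<in> C" "\<And>k. x \<in> P k (c k (f x))" if x: "x \<in> E" for x
  proof -
    have xM: "x \<in> space M" using x sets.sets_into_space[OF E] by blast
    have iff: "f x \<in> S k n \<longleftrightarrow> x \<in> P k n" for k n using S1[of k n] S2[of k n] x by blast
    show P: "x \<in> P k (c k (f x))" for k
      unfolding c_def iff by (rule LeastI_ex) (rule P_ex[OF xM])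
    have "d (a (c k (f x))) (a (c (Suc k) (f x))) \<le> 2 * r k" for k
    proof -
      have "d (a (c k (f x))) x < r k" "d (a (c (Suc k) (f x))) x < r (Suc k)"
        using P[of k] P[of "Suc k"] unfolding P_def by auto
      moreover have "r (Suc k) \<le> r k" by (simp add: r_def field_simps)
      moreover have "d (a (c k (f x))) (a (c (Suc k) (f x))) \<le> d (a (c k (f x))) x
        + d (a (c (Suc k) (f x))) x"
        using triangle[of "a (c k (f x))" x "a (c (Suc k) (f x))"] a xM by (simp add: commute)
      ultimately show ?thesis by linarith
    qed
    then show "f x \<in> C" unfolding C_def using measurable_space[OF f xM] P_ex[OF xM] iff by blast
  qed
  have tele: "d (a (c k y)) (a (c (k + m) y)) \<le> 4 * r k - 4 * r (k + m)" if y: "y \<in> C" for y k m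
  proof (induction m)
    case 0 then show ?case using a by simp
  next
    case (Suc m)
    have "d (a (c (k + m) y)) (a (c (Suc (k + m)) y)) \<le> 2 * r (k + m)" using y unfolding C_def
      by blast
    moreover have "2 * r (k + m) = 4 * r (k + m) - 4 * r (Suc (k + m))" by (simp add: r_def)
    moreover have "d (a (c k y)) (a (c (Suc (k + m)) y)) \<le> d (a (c k y)) (a (c (k + m) y))
      + d (a (c (k + m) y)) (a (c (Suc (k + m)) y))"
      using triangle a by blast
    ultimately show ?case using Suc.IH by simp
  qed
  have r_small: "\<exists>k. r k < e" if e: "e > 0" for e :: real
    using real_arch_pow_inv[OF e, of "1/2"] by (simp add: r_def power_one_over)
  have r_anti: "r m \<le> r k" if "k \<le> m" for k m using that by (simp add: r_def frac_le)
  have r_pos: "r k > 0" for k by (simp add: r_def)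
  have "\<exists>h. limitin mtopology (\<lambda>k. a (c k y)) h sequentially" if y: "y \<in> C" for y
  proof -
    have "MCauchy (\<lambda>k. a (c k y))" unfolding MCauchy_def
    proof (intro conjI allI impI)
      fix e :: real assume "e > 0"
      then obtain k where k: "r k < e / 8" using r_small[of "e / 8"] by auto
      have "d (a (c k y)) (a (c n y)) < e / 2" if "n \<ge> k" for n
        using tele[OF y, of k "n - k"] that k r_pos[of n] by simp
      then have "d (a (c n y)) (a (c n' y)) < e" if "n \<ge> k" "n' \<ge> k" for n n'
        using triangle[of "a (c n y)" "a (c k y)" "a (c n' y)"] a that commute
          by (smt (verit) field_sum_of_halves)
      then show "\<exists>N. \<forall>n n'. N \<le> n \<longrightarrow> N \<le> n' \<longrightarrow> d (a (c n y)) (a (c n' y)) < e" by blast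
    qed (use a in blast)
    then show ?thesis using comp unfolding mcomplete_def by blast
  qed
  then obtain h where h: "\<And>y. y \<in> C \<Longrightarrow> limitin mtopology (\<lambda>k. a (c k y)) (h y) sequentially" by metis
  have hM: "h y \<in> space M" if "y \<in> C" for y using h[OF that] limitin_mspace by blast
  have close: "d (a (c k y)) (h y) \<le> 5 * r k" if y: "y \<in> C" for y k
  proof -
    have "\<forall>\<^sub>F n in sequentially. a (c n y) \<in> space M \<and> d (a (c n y)) (h y) < r k"
      using h[OF y] r_pos[of k] unfolding limitin_metric by blast
    then have "\<forall>\<^sub>F n in sequentially. d (a (c n y)) (h y) < r k" by (rule eventually_mono) simp
    then obtain n where n: "n \<ge> k" "d (a (c n y)) (h y) < r k"
      unfolding eventually_sequentially by (meson nle_le)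
    have "d (a (c k y)) (a (c n y)) \<le> 4 * r k" using tele[OF y, of k "n - k"] n r_pos[of n] by simp
    then show ?thesis using triangle[of "a (c k y)" "a (c n y)" "h y"] a hM[OF y] n by simp
  qed
  have h_meas: "h \<in> restrict_space M C \<rightarrow>\<^sub>M M"
  proof (rule measurable_sigma_sets[OF sM])
    fix U assume "U \<in> {U. openin mtopology U}"
    then have U: "openin mtopology U" by simp
    \<comment> \<open>The centre at stage \<open>k\<close> is within \<open>5 * r k\<close> of
      \<open>h y\<close>: 4 from the geometric series, 1 from the approach to the limit. The larger
      radius \<open>6 * r k\<close> makes the open ball contain \<open>h y\<close>, and 11 is 6 + 5.
      The right side depends on \<open>y\<close> only through the discrete values
      \<open>c k y\<close>.\<close>
    have "y \<in> C \<Longrightarrow> h y \<in> U \<longleftrightarrow> (\<exists>k. mball (a (c k y)) (6 * r k) \<subseteq> U)" for y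
    proof
      assume y: "y \<in> C" and "h y \<in> U"
      then obtain e where e: "e > 0" "mball (h y) e \<subseteq> U" using U unfolding openin_mtopology by blast
      obtain k where k: "r k < e / 11" using r_small[of "e / 11"] e by auto
      have "mball (a (c k y)) (6 * r k) \<subseteq> mball (h y) e"
      proof
        fix z assume z: "z \<in> mball (a (c k y)) (6 * r k)"
        then have "d (h y) z \<le> d (a (c k y)) (h y) + d (a (c k y)) z"
          using triangle[of "h y" "a (c k y)" z] a hM[OF y] by (simp add: commute)
        then show "z \<in> mball (h y) e" using close[OF y, of k] z k hM[OF y] by auto
      qed
      then show "\<exists>k. mball (a (c k y)) (6 * r k) \<subseteq> U" using e by blast
    next
      assume y: "y \<in> C" and "\<exists>k. mball (a (c k y)) (6 * r k) \<subseteq> U"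
      then obtain k where k: "mball (a (c k y)) (6 * r k) \<subseteq> U" by blast
      have "h y \<in> mball (a (c k y)) (6 * r k)" using close[OF y, of k] r_pos[of k] a hM[OF y]
        by (simp del: r_def)
      then show "h y \<in> U" using k by blast
    qed
    then have "h -` U \<inter> space (restrict_space M C) = {y \<in> space M. y \<in> C \<and> (\<exists>k n. c k y = n
      \<and> mball (a n) (6 * r k) \<subseteq> U)}"
      using sets.sets_into_space[OF C_sets] by (auto simp: space_restrict_space)
    also have "\<dots> \<in> sets M" by measurable
    finally show "h -` U \<inter> space (restrict_space M C) \<in> sets (restrict_space M C)"
      using C_sets by (subst sets_restrict_space_iff) (auto simp: space_restrict_space)
  qed (use openin_subset[of mtopology] in \<open>fastforce simp: space_restrict_space hM\<close>)+
  have hf: "h (f x) = x" if x: "x \<in> E" for x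
  proof -
    have xM: "x \<in> space M" using x sets.sets_into_space[OF E] by blast
    have "limitin mtopology (\<lambda>k. a (c k (f x))) x sequentially"
      unfolding limitin_metric
    proof (intro conjI allI impI xM)
      fix e :: real assume "e > 0"
      then obtain k where k: "r k < e" using r_small by blast
      have "a (c n (f x)) \<in> space M \<and> d (a (c n (f x))) x < e" if n: "n \<ge> k" for n
        using fE(2)[OF x, of n] r_anti[OF n] k a unfolding P_def by auto
      then show "\<forall>\<^sub>F n in sequentially. a (c n (f x)) \<in> space M \<and> d (a (c n (f x))) x < e"
        unfolding eventually_sequentially by blast
    qed
    then show ?thesis using h[OF fE(1)[OF x]] limitin_metric_unique
      by (metis trivial_limit_sequentially)
  qed
  let ?R = "restrict_space M C"
  \<comment> \<open>\<open>C\<close> may contain points outside the image; these are discarded by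
    checking that \<open>h y\<close> lies in \<open>E\<close> and is sent back to
    \<open>y\<close>.\<close>
  have "f ` E = {y \<in> space ?R. h y \<in> E} \<inter> {y \<in> space ?R. f (h y) = y}"
    using hf fE(1) sets.sets_into_space[OF C_sets] by (force simp: space_restrict_space image_iff)
  also have "\<dots> \<in> sets ?R"
  proof (intro sets.Int measurable_eq_set[OF M])
    show "{y \<in> space ?R. h y \<in> E} \<in> sets ?R" using h_meas E by measurable
    show "(\<lambda>y. f (h y)) \<in> ?R \<rightarrow>\<^sub>M M" using h_meas f by measurable
    show "(\<lambda>y. y) \<in> ?R \<rightarrow>\<^sub>M M" by (rule measurable_restrict_space1) simp
  qed
  finally show ?thesis using sets_restrict_space_iff[of C M] C_sets by simp
qed

section \<open>One-sheeted sets as partial translations\<close>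

context groupoid
begin

lemma src_elts: "g \<in> elts G \<Longrightarrow> src G g \<in> elts G" and rng_elts: "g \<in> elts G \<Longrightarrow> rng G g \<in> elts G"
  using src_units rng_units units_subset by blast+

lemma ivs_mul_cancel:
  assumes "p \<in> elts G" "g \<in> elts G" "src G p = rng G g"
  shows "mul G (ivs G p) (mul G p g) = g"
  using mul_assoc[of "ivs G p" p g] assms
  by (simp add: ivs_closed src_ivs ivs_mul rng_mul_left)

lemma mul_ivs_cancel:
  assumes "p \<in> elts G" "h \<in> elts G" "rng G p = rng G h"
  shows "mul G p (mul G (ivs G p) h) = h"
  using mul_assoc[of p "ivs G p" h] assms
  by (simp add: ivs_closed src_ivs rng_ivs mul_ivs rng_mul_left)

lemma ivs_ivs: "g \<in> elts G \<Longrightarrow> ivs G (ivs G g) = g"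
  using ivs_mul_cancel[of "ivs G g" g] mul_src[of "ivs G (ivs G g)"]
  by (simp add: ivs_closed src_ivs rng_ivs ivs_mul)

lemma ivs_unit: "x \<in> units G \<Longrightarrow> ivs G x = x"
  using mul_ivs[of x] rng_mul_left[of "ivs G x"] units_subset
  by (metis ivs_closed rng_ivs rng_unit src_unit subsetD)

lemma ivs_unique:
  assumes "a \<in> elts G" "b \<in> elts G" "src G b = rng G a" "mul G b a = src G a"
  shows "b = ivs G a"
proof -
  have "mul G (mul G b a) (ivs G a) = b"
    using assms(1-3) mul_src[of b] by (subst mul_assoc) (simp_all add: ivs_closed rng_ivs mul_ivs)
  then show ?thesis using assms rng_mul_left[of "ivs G a"] by (simp add: ivs_closed rng_ivs)
qed

lemma ivs_mul_dist:
  assumes "g \<in> elts G" "h \<in> elts G" "src G g = rng G h"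
  shows "ivs G (mul G g h) = mul G (ivs G h) (ivs G g)"
proof (rule ivs_unique[symmetric])
  have "mul G (mul G (ivs G h) (ivs G g)) (mul G g h)
    = mul G (ivs G h) (mul G (ivs G g) (mul G g h))"
    by (rule mul_assoc) (use assms in \<open>simp_all add: ivs_closed src_ivs rng_ivs mul_closed rng_mul\<close>)
  then show "mul G (mul G (ivs G h) (ivs G g)) (mul G g h) = src G (mul G g h)"
    using assms by (simp add: ivs_mul_cancel ivs_mul src_mul)
qed (use assms in \<open>simp_all add: ivs_closed src_ivs rng_ivs mul_closed rng_mul src_mul\<close>)

lemma mul_eq_right_unit:
  assumes "p \<in> elts G" "g \<in> elts G" "src G p = rng G g" "mul G p g = g"
  shows "p = rng G g"
proof -
  have "mul G (mul G p g) (ivs G g) = p"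
    using assms(1-3) mul_src[of p] by (subst mul_assoc) (simp_all add: ivs_closed rng_ivs mul_ivs)
  then show ?thesis using assms by (simp add: mul_ivs)
qed

definition dom_of :: "'g set \<Rightarrow> 'g set" where
  "dom_of P = {g \<in> elts G. rng G g \<in> src G ` P}"

text \<open>Left translation preserves the source, so the elements with a given source serve as the
  vertices over that unit. Acting on elements instead of units keeps isotropy visible: a loop at a
  unit need not be a closed path.\<close>

definition act :: "'g set \<Rightarrow> 'g \<Rightarrow> 'g" where
  "act P g = mul G (the_inv_into P (src G) (rng G g)) g"

text \<open>Measurability plays no role for the algebra of partial translations.\<close>

definition sheet :: "'g set \<Rightarrow> bool" where
  "sheet P \<longleftrightarrow> P \<subseteq> elts G \<and> inj_on (src G) P \<and> inj_on (rng G) P"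

lemma sheet_elts: "sheet P \<Longrightarrow> p \<in> P \<Longrightarrow> p \<in> elts G"
  unfolding sheet_def by blast

lemma dom_elts: "g \<in> dom_of P \<Longrightarrow> g \<in> elts G" unfolding dom_of_def by blast

lemma act_eq: "sheet P \<Longrightarrow> p \<in> P \<Longrightarrow> src G p = rng G g \<Longrightarrow> act P g = mul G p g"
  unfolding act_def sheet_def by (metis the_inv_into_f_f)

lemma domE:
  assumes "g \<in> dom_of P" "sheet P"
  obtains p where "p \<in> P" "p \<in> elts G" "g \<in> elts G" "src G p = rng G g" "act P g = mul G p g"
  using assms act_eq sheet_elts unfolding dom_of_def by force

lemma domI: "p \<in> P \<Longrightarrow> g \<in> elts G \<Longrightarrow> src G p = rng G g \<Longrightarrow> g \<in> dom_of P"
  unfolding dom_of_def by force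

lemma act_elts: "g \<in> dom_of P \<Longrightarrow> sheet P \<Longrightarrow> act P g \<in> elts G"
  by (metis domE mul_closed)

lemma sheet_subset: "sheet P \<Longrightarrow> Q \<subseteq> P \<Longrightarrow> sheet Q"
  unfolding sheet_def by (meson inj_on_subset order_trans)

lemma sheet_units: "P \<subseteq> units G \<Longrightarrow> sheet P"
  unfolding sheet_def inj_on_def using units_subset src_unit rng_unit by (auto simp: subset_iff)

lemma act_units: "A \<subseteq> units G \<Longrightarrow> g \<in> elts G \<Longrightarrow> g \<in> dom_of A \<longleftrightarrow> rng G g \<in> A"
  "A \<subseteq> units G \<Longrightarrow> g \<in> dom_of A \<Longrightarrow> act A g = g"
proof -
  show "g \<in> dom_of A \<longleftrightarrow> rng G g \<in> A" if "A \<subseteq> units G" "g \<in> elts G"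
    unfolding dom_of_def using that src_unit by (force simp: image_iff)
  show "act A g = g" if "A \<subseteq> units G" "g \<in> dom_of A"
    using that by (metis domE rng_mul_left sheet_units src_unit subsetD)
qed

lemma sheet_inv: "sheet P \<Longrightarrow> sheet (ivs G ` P)"
  unfolding sheet_def inj_on_def by (auto simp: ivs_closed src_ivs rng_ivs subset_iff)

lemma inv_inv: "sheet P \<Longrightarrow> ivs G ` ivs G ` P = P"
  using sheet_elts by (force simp: image_iff ivs_ivs)

lemma act_inv:
  assumes "sheet P" "g \<in> dom_of P"
  shows "act P g \<in> dom_of (ivs G ` P)" "act (ivs G ` P) (act P g) = g"
proof -
  obtain p where p: "p \<in> P" "p \<in> elts G" "g \<in> elts G" "src G p = rng G g" "act P g = mul G p g"
    by (rule domE[OF assms(2,1)])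
  have *: "src G (ivs G p) = rng G (act P g)" "act P g \<in> elts G" using p
    by (simp_all add: src_ivs rng_mul mul_closed)
  show "act P g \<in> dom_of (ivs G ` P)" using domI[OF _ *(2,1)] p(1) by blast
  show "act (ivs G ` P) (act P g) = g"
    using act_eq[OF sheet_inv[OF assms(1)] _ *(1)] p ivs_mul_cancel by simp
qed

lemma act_inv':
  assumes "sheet P" "h \<in> dom_of (ivs G ` P)"
  shows "act (ivs G ` P) h \<in> dom_of P" "act P (act (ivs G ` P) h) = h"
  using act_inv[OF sheet_inv[OF assms(1)] assms(2)] inv_inv[OF assms(1)] by simp_all

lemma sheet_mul:
  assumes "sheet P" "sheet Q"
  shows "sheet (set_mul G P Q)"
  unfolding sheet_def
proof (intro conjI)
  show "set_mul G P Q \<subseteq> elts G" unfolding set_mul_def using mul_closed assms sheet_elts by blast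
  show "inj_on (src G) (set_mul G P Q)"
  proof (rule inj_onI)
    fix a b assume "a \<in> set_mul G P Q" "b \<in> set_mul G P Q" and e: "src G a = src G b"
    then obtain p q p' q' where *: "a = mul G p q" "b = mul G p' q'" "p \<in> P" "q \<in> Q" "p' \<in> P" "q'
      \<in> Q"
      "src G p = rng G q" "src G p' = rng G q'" unfolding set_mul_def by blast
    then have "src G q = src G q'" using e sheet_elts assms by (metis src_mul)
    then have "q = q'" using * assms unfolding sheet_def inj_on_def by blast
    then show "a = b" using * assms unfolding sheet_def inj_on_def by metis
  qed
  show "inj_on (rng G) (set_mul G P Q)"
  proof (rule inj_onI)
    fix a b assume "a \<in> set_mul G P Q" "b \<in> set_mul G P Q" and e: "rng G a = rng G b"
    then obtain p q p' q' where *: "a = mul G p q" "b = mul G p' q'" "p \<in> P" "q \<in> Q" "p' \<in> P" "q'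
      \<in> Q"
      "src G p = rng G q" "src G p' = rng G q'" unfolding set_mul_def by blast
    then have "rng G p = rng G p'" using e sheet_elts assms by (metis rng_mul)
    then have "p = p'" using * assms unfolding sheet_def inj_on_def by blast
    then show "a = b" using * assms unfolding sheet_def inj_on_def by metis
  qed
qed

lemma act_mul:
  assumes "sheet P" "sheet Q"
  shows "g \<in> dom_of (set_mul G P Q) \<longleftrightarrow> g \<in> dom_of Q \<and> act Q g \<in> dom_of P"
    and "g \<in> dom_of Q \<Longrightarrow> act Q g \<in> dom_of P \<Longrightarrow> act (set_mul G P Q) g = act P (act Q g)"
proof -
  have *: "g \<in> dom_of (set_mul G P Q) \<and> act (set_mul G P Q) g = act P (act Q g)"
    if 1: "g \<in> dom_of Q" and 2: "act Q g \<in> dom_of P"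
  proof -
    obtain q where q: "q \<in> Q" "q \<in> elts G" "g \<in> elts G" "src G q = rng G g" "act Q g = mul G q g"
      by (rule domE[OF 1 assms(2)])
    obtain p where p: "p \<in> P" "p \<in> elts G" "src G p = rng G (act Q g)" "act P (act Q g)
      = mul G p (act Q g)"
      by (rule domE[OF 2 assms(1)])
    have pq: "src G p = rng G q" using p q by (simp add: rng_mul)
    then have m: "mul G p q \<in> set_mul G P Q" using p q unfolding set_mul_def by blast
    have s: "src G (mul G p q) = rng G g" using p q pq by (simp add: src_mul)
    show ?thesis
      using domI[OF m q(3) s] act_eq[OF sheet_mul[OF assms] m s] p q pq by (simp add: mul_assoc)
  qed
  show "g \<in> dom_of (set_mul G P Q) \<longleftrightarrow> g \<in> dom_of Q \<and> act Q g \<in> dom_of P"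
  proof
    assume "g \<in> dom_of (set_mul G P Q)"
    then obtain p q where pq: "p \<in> P" "q \<in> Q" "src G p = rng G q" "src G (mul G p q) = rng G g" "g
      \<in> elts G"
      unfolding dom_of_def set_mul_def by force
    then have e: "p \<in> elts G" "q \<in> elts G" using sheet_elts assms by blast+
    then have s: "src G q = rng G g" using pq src_mul by metis
    have "act Q g = mul G q g" by (rule act_eq[OF assms(2) pq(2) s])
    moreover have "mul G q g \<in> dom_of P"
      by (rule domI[OF pq(1)]) (use pq e s in \<open>simp_all add: mul_closed rng_mul\<close>)
    ultimately show "g \<in> dom_of Q \<and> act Q g \<in> dom_of P" using domI[OF pq(2,5) s] by simp
  qed (use * in blast)
  show "g \<in> dom_of Q \<Longrightarrow> act Q g \<in> dom_of P \<Longrightarrow> act (set_mul G P Q) g = act P (act Q g)" using *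
    by blast
qed

lemma inv_mul:
  assumes "sheet P" "sheet Q"
  shows "ivs G ` set_mul G P Q = set_mul G (ivs G ` Q) (ivs G ` P)"
proof (intro set_eqI iffI)
  fix x assume "x \<in> ivs G ` set_mul G P Q"
  then obtain p q where pq: "p \<in> P" "q \<in> Q" "src G p = rng G q" "x = ivs G (mul G p q)"
    unfolding set_mul_def by blast
  then have e: "p \<in> elts G" "q \<in> elts G" using sheet_elts assms by blast+
  then have "x = mul G (ivs G q) (ivs G p)" "src G (ivs G q) = rng G (ivs G p)"
    using ivs_mul_dist pq by (simp_all add: src_ivs rng_ivs)
  then show "x \<in> set_mul G (ivs G ` Q) (ivs G ` P)" using pq unfolding set_mul_def by blast
next
  fix x assume "x \<in> set_mul G (ivs G ` Q) (ivs G ` P)"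
  then obtain p q where pq: "p \<in> P" "q \<in> Q" "src G (ivs G q) = rng G (ivs G p)" "x
    = mul G (ivs G q) (ivs G p)"
    unfolding set_mul_def by blast
  then have e: "p \<in> elts G" "q \<in> elts G" using sheet_elts assms by blast+
  then have s: "src G p = rng G q" using pq by (simp add: src_ivs rng_ivs)
  then have "x = ivs G (mul G p q)" using ivs_mul_dist e pq by simp
  then show "x \<in> ivs G ` set_mul G P Q" using pq s unfolding set_mul_def by blast
qed

lemma set_mul_units:
  assumes P: "P \<subseteq> elts G" and A: "A \<subseteq> units G"
  shows "set_mul G P A = {p \<in> P. src G p \<in> A}" "set_mul G A P = {p \<in> P. rng G p \<in> A}"
proof -
  have 1: "mul G p x = p \<and> src G p = x" if "p \<in> P" "x \<in> A" "src G p = rng G x" for p x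
    using that P A mul_src[of p] rng_unit[of x] by (metis subsetD)
  show "set_mul G P A = {p \<in> P. src G p \<in> A}"
  proof (intro set_eqI iffI)
    fix g assume "g \<in> {p \<in> P. src G p \<in> A}"
    then have "g \<in> P" "src G g \<in> A" "mul G g (src G g) = g" "src G g = rng G (src G g)"
      using P A mul_src rng_unit by auto
    then show "g \<in> set_mul G P A"
      unfolding set_mul_def by (intro CollectI exI[of _ g] exI[of _ "src G g"]) simp
  qed (use 1 A rng_unit in \<open>auto simp: set_mul_def subset_iff\<close>)
  have 2: "mul G x p = p \<and> rng G p = x" if "p \<in> P" "x \<in> A" "src G x = rng G p" for p x
    using that P A rng_mul_left[of p] src_unit[of x] by (metis subsetD)
  show "set_mul G A P = {p \<in> P. rng G p \<in> A}"
  proof (intro set_eqI iffI)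
    fix g assume "g \<in> {p \<in> P. rng G p \<in> A}"
    then have "g \<in> P" "rng G g \<in> A" "mul G (rng G g) g = g" "src G (rng G g) = rng G g"
      using P A rng_mul_left src_unit by auto
    then show "g \<in> set_mul G A P"
      unfolding set_mul_def by (intro CollectI exI[of _ "rng G g"] exI[of _ g]) simp
  qed (use 2 A src_unit in \<open>auto simp: set_mul_def subset_iff\<close>)
qed

text \<open>By cancellation only a unit can fix an element. Diagonal entries of operators and closed
  paths in the tree both become statements about the units contained in a sheet.\<close>

lemma fixed_iff:
  assumes "sheet P" "g \<in> elts G"
  shows "g \<in> dom_of P \<and> act P g = g \<longleftrightarrow> rng G g \<in> P"
proof
  assume *: "g \<in> dom_of P \<and> act P g = g"
  obtain p where "p \<in> P" "p \<in> elts G" "src G p = rng G g" "act P g = mul G p g"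
    using domE[of g P] * assms by blast
  then show "rng G g \<in> P" using mul_eq_right_unit[of p g] assms * by simp
next
  assume r: "rng G g \<in> P"
  have s: "src G (rng G g) = rng G g" by (rule src_unit[OF rng_units[OF assms(2)]])
  show "g \<in> dom_of P \<and> act P g = g"
    using domI[OF r assms(2) s] act_eq[OF assms(1) r s] rng_mul_left[OF assms(2)] by simp
qed

text \<open>A product is a unit only if its factors are mutually inverse. The units in the two
  products are thus the ranges and the sources of one and the same sheet, so invariance will give
  them equal measure; this is the trace property for two translations.\<close>

lemma mul_Int_units:
  assumes "sheet P" "sheet Q"
  shows "set_mul G P Q \<inter> units G = rng G ` (P \<inter> ivs G ` Q)"
    "set_mul G Q P \<inter> units G = src G ` (P \<inter> ivs G ` Q)"
proof -
  have PQ: "P \<subseteq> elts G" "Q \<subseteq> elts G" using assms unfolding sheet_def by auto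
  have inv: "p = ivs G q" if "p \<in> elts G" "q \<in> elts G" "src G p = rng G q" "mul G p q \<in> units G"
    for p q
  proof -
    have r: "mul G p q = rng G p" using that by (metis rng_mul rng_unit)
    then have "rng G p = src G q" using that by (metis src_mul src_unit)
    have "mul G (mul G p q) (ivs G q) = p"
      using that(1-3) mul_src[of p] by (subst mul_assoc) (simp_all add: ivs_closed rng_ivs mul_ivs)
    then show ?thesis using r \<open>rng G p = src G q\<close> that rng_mul_left[of "ivs G q"]
      by (simp add: ivs_closed rng_ivs)
  qed
  show "set_mul G P Q \<inter> units G = rng G ` (P \<inter> ivs G ` Q)"
  proof (intro set_eqI iffI)
    fix x assume "x \<in> set_mul G P Q \<inter> units G"
    then obtain p q where *: "x = mul G p q" "p \<in> P" "q \<in> Q" "src G p = rng G q" "x \<in> units G"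
      unfolding set_mul_def by blast
    then have "p = ivs G q" using inv PQ by blast
    moreover have "x = rng G p" using * PQ by (metis rng_mul rng_unit subsetD)
    ultimately show "x \<in> rng G ` (P \<inter> ivs G ` Q)" using * by blast
  next
    fix x assume "x \<in> rng G ` (P \<inter> ivs G ` Q)"
    then obtain q where *: "q \<in> Q" "ivs G q \<in> P" "x = rng G (ivs G q)" by blast
    then have "x = mul G (ivs G q) q" "src G (ivs G q) = rng G q" "x \<in> units G"
      using PQ by (auto simp: src_ivs rng_ivs ivs_mul src_units)
    then show "x \<in> set_mul G P Q \<inter> units G" using * unfolding set_mul_def by blast
  qed
  show "set_mul G Q P \<inter> units G = src G ` (P \<inter> ivs G ` Q)"
  proof (intro set_eqI iffI)
    fix x assume "x \<in> set_mul G Q P \<inter> units G"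
    then obtain p q where *: "x = mul G q p" "p \<in> P" "q \<in> Q" "src G q = rng G p" "x \<in> units G"
      unfolding set_mul_def by blast
    then have "q = ivs G p" using inv PQ by blast
    then have "p = ivs G q" using * PQ ivs_ivs by auto
    moreover have "x = src G p" using * PQ by (metis src_mul src_unit subsetD)
    ultimately show "x \<in> src G ` (P \<inter> ivs G ` Q)" using * by blast
  next
    fix x assume "x \<in> src G ` (P \<inter> ivs G ` Q)"
    then obtain q where *: "q \<in> Q" "ivs G q \<in> P" "x = src G (ivs G q)" by blast
    then have "x = mul G q (ivs G q)" "src G q = rng G (ivs G q)" "x \<in> units G"
      using PQ by (auto simp: src_ivs rng_ivs mul_ivs rng_units)
    then show "x \<in> set_mul G Q P \<inter> units G" using * unfolding set_mul_def by blast
  qed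
qed

end

section \<open>Borel one-sheeted sets are closed under inverse and product\<close>

context discrete_borel_groupoid
begin

lemma src_M [measurable]: "src G \<in> borel_str G \<rightarrow>\<^sub>M borel_str G"
  and rng_M [measurable]: "rng G \<in> borel_str G \<rightarrow>\<^sub>M borel_str G"
  using src_borel rng_borel measurable_restrict_space2_iff by blast+

lemma units_sets [measurable]: "units G \<in> sets (borel_str G)"
proof -
  have "units G = {x \<in> elts G. src G x = x}" using units_subset src_unit src_units by (auto, metis)
  also have "\<dots> \<in> sets (borel_str G)" by (intro measurable_eq_set[OF standard]) simp_all
  finally show ?thesis .
qed

lemma osD: "P \<in> one_sheeted G \<Longrightarrow> sheet P" "P \<in> one_sheeted G \<Longrightarrow> P \<in> sets (borel_str G)"
  unfolding one_sheeted_def sheet_def using sets.sets_into_space by auto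

lemma osI: "sheet P \<Longrightarrow> P \<in> sets (borel_str G) \<Longrightarrow> P \<in> one_sheeted G"
  unfolding one_sheeted_def sheet_def by auto

lemma os_subset: "P \<in> one_sheeted G \<Longrightarrow> Q \<subseteq> P \<Longrightarrow> Q \<in> sets (borel_str G) \<Longrightarrow> Q \<in> one_sheeted G"
  using osI osD sheet_subset by blast

lemma os_units: "A \<subseteq> units G \<Longrightarrow> A \<in> sets (borel_str G) \<Longrightarrow> A \<in> one_sheeted G"
  using osI sheet_units by blast

lemma src_image_sets: "P \<in> one_sheeted G \<Longrightarrow> src G ` P \<in> sets (borel_str G)"
  and rng_image_sets: "P \<in> one_sheeted G \<Longrightarrow> rng G ` P \<in> sets (borel_str G)"
  using lusin_souslin[OF standard src_M] lusin_souslin[OF standard rng_M]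
  unfolding one_sheeted_def by simp_all

lemma os_inv:
  assumes "P \<in> one_sheeted G"
  shows "ivs G ` P \<in> one_sheeted G"
proof (rule osI[OF sheet_inv[OF osD(1)[OF assms]]])
  have "ivs G ` P = ivs G -` P \<inter> elts G"
    using sheet_elts[OF osD(1)[OF assms]] ivs_closed ivs_ivs by (force simp: image_iff)
  then show "ivs G ` P \<in> sets (borel_str G)" using measurable_sets[OF ivs_borel osD(2)[OF assms]]
    by simp
qed

text \<open>The left factor of an element of the product is determined by the range of that element.
  Dividing it off is a measurable map, by the Lusin-Souslin theorem applied to ranges, and the
  product is the preimage of \<open>Q\<close> under this map.\<close>

lemma os_mul:
  assumes P: "P \<in> one_sheeted G" and Q: "Q \<in> one_sheeted G"
  shows "set_mul G P Q \<in> one_sheeted G"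
proof (rule osI[OF sheet_mul[OF osD(1)[OF P] osD(1)[OF Q]]])
  let ?M = "borel_str G" and ?R = "rng G -` (rng G ` P) \<inter> elts G"
  have inj: "inj_on (rng G) P" and Pe: "P \<subseteq> elts G" and Qe: "Q \<subseteq> elts G"
    using osD(1)[OF P] osD(1)[OF Q] unfolding sheet_def by auto
  define s where "s = the_inv_into P (rng G)"
  have s: "s (rng G p) = p" if "p \<in> P" for p unfolding s_def using the_inv_into_f_f[OF inj that] .
  have RM: "?R \<in> sets ?M" by (rule measurable_sets[OF rng_M rng_image_sets[OF P]])
  let ?N = "restrict_space ?M ?R"
  have spN: "space ?N = ?R" by (auto simp: space_restrict_space)
  have s_meas: "(\<lambda>g. s (rng G g)) \<in> ?N \<rightarrow>\<^sub>M ?M"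
  proof (rule measurableI)
    fix g assume "g \<in> space ?N"
    then show "s (rng G g) \<in> space ?M" using s Pe unfolding spN by auto
  next
    fix D assume D: "D \<in> sets ?M"
    have "(\<lambda>g. s (rng G g)) -` D \<inter> space ?N = rng G -` (rng G ` (P \<inter> D)) \<inter> elts G"
      unfolding spN using s by auto
    also have "\<dots> \<in> sets ?M"
      by (intro measurable_sets[OF rng_M] rng_image_sets os_subset[OF P]) (use D osD(2)[OF P]
        in auto)
    finally show "(\<lambda>g. s (rng G g)) -` D \<inter> space ?N \<in> sets ?N"
      using RM spN by (subst sets_restrict_space_iff) auto
  qed
  have id: "(\<lambda>g. g) \<in> ?N \<rightarrow>\<^sub>M ?M" by (rule measurable_restrict_space1) simp
  have "(\<lambda>g. (ivs G (s (rng G g)), g)) \<in> ?N \<rightarrow>\<^sub>M restrict_space (?M \<Otimes>\<^sub>M ?M) {(g, h). src G g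
    = rng G h}"
  proof (rule measurable_restrict_space2)
    show "(\<lambda>g. (ivs G (s (rng G g)), g)) \<in> ?N \<rightarrow>\<^sub>M ?M \<Otimes>\<^sub>M ?M"
      by (rule measurable_Pair[OF measurable_compose[OF s_meas ivs_borel] id])
    show "(\<lambda>g. (ivs G (s (rng G g)), g)) \<in> space ?N \<rightarrow> {(g, h). src G g = rng G h}"
      unfolding spN using s Pe by (auto simp: src_ivs subset_iff)
  qed
  from measurable_compose[OF this mul_borel]
  have m: "(\<lambda>g. mul G (ivs G (s (rng G g))) g) \<in> ?N \<rightarrow>\<^sub>M ?M" by simp
  have "set_mul G P Q = (\<lambda>g. mul G (ivs G (s (rng G g))) g) -` Q \<inter> space ?N"
  proof (intro set_eqI iffI)
    fix g assume "g \<in> set_mul G P Q"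
    then obtain p q where *: "g = mul G p q" "p \<in> P" "q \<in> Q" "src G p = rng G q"
      unfolding set_mul_def by blast
    then have e: "p \<in> elts G" "q \<in> elts G" using Pe Qe by auto
    then have "rng G g = rng G p" "g \<in> elts G" using * by (simp_all add: rng_mul mul_closed)
    moreover have "mul G (ivs G (s (rng G g))) g = q" using calculation * e s ivs_mul_cancel by simp
    ultimately show "g \<in> (\<lambda>g. mul G (ivs G (s (rng G g))) g) -` Q \<inter> space ?N" unfolding spN using *
      by simp
  next
    fix g assume g: "g \<in> (\<lambda>g. mul G (ivs G (s (rng G g))) g) -` Q \<inter> space ?N"
    then obtain p where p: "p \<in> P" "rng G g = rng G p" "g \<in> elts G" unfolding spN by auto
    then have "mul G (ivs G p) g \<in> Q" using g s by simp
    moreover have "g = mul G p (mul G (ivs G p) g)" using mul_ivs_cancel[of p g] p Pe by auto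
    moreover have "src G p = rng G (mul G (ivs G p) g)" using p Pe
      by (subst rng_mul) (auto simp: ivs_closed src_ivs rng_ivs)
    ultimately show "g \<in> set_mul G P Q" using p unfolding set_mul_def by blast
  qed
  then show "set_mul G P Q \<in> sets ?M"
    using measurable_sets[OF m osD(2)[OF Q]] RM spN sets_restrict_space_iff[of ?R ?M] by simp
qed

lemma os_letter: "fst a \<in> one_sheeted G \<Longrightarrow> letter_set G a \<in> one_sheeted G"
  by (cases a) (simp add: os_inv)

lemma os_word: "fst ` set w \<subseteq> one_sheeted G \<Longrightarrow> word_set G w \<in> one_sheeted G"
  by (induction w) (simp_all add: os_units os_mul os_letter)

end

section \<open>Invariance and the lifted measure on one-sheeted sets\<close>

context pmp_discrete_groupoid
begin

lemma sets_muI: "A \<in> sets (borel_str G) \<Longrightarrow> A \<subseteq> units G \<Longrightarrow> A \<in> sets \<mu>"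
  unfolding sets_mu by (simp add: sets_restrict_space_iff)

lemma space_mu: "space \<mu> = units G"
  using sets_eq_imp_space_eq[OF sets_mu] units_subset by (auto simp: space_restrict_space)

lemma src_image_mu: "P \<in> one_sheeted G \<Longrightarrow> src G ` P \<in> sets \<mu>"
  and rng_image_mu: "P \<in> one_sheeted G \<Longrightarrow> rng G ` P \<in> sets \<mu>"
  using sets_muI[OF src_image_sets] sets_muI[OF rng_image_sets] sheet_elts[OF osD(1)] src_units
    rng_units
  by (simp_all add: image_subset_iff)

lemma mu_src_rng:
  assumes P: "P \<in> one_sheeted G"
  shows "emeasure \<mu> (rng G ` P) = emeasure \<mu> (src G ` P)"
proof -
  have "sheet_map G P ` (src G ` P) = rng G ` P"
    using osD(1)[OF P] unfolding sheet_map_def sheet_def image_image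
    by (intro image_cong) (simp_all add: the_inv_into_f_f)
  then show ?thesis using invariant[OF P src_image_mu[OF P]] by simp
qed

text \<open>The first bound compares sources, the second compares ranges and returns to sources by
  invariance.\<close>

lemma mu_mul_le:
  assumes P: "P \<in> one_sheeted G" and Q: "Q \<in> one_sheeted G"
  shows "emeasure \<mu> (src G ` set_mul G P Q) \<le> emeasure \<mu> (src G ` Q)"
    "emeasure \<mu> (src G ` set_mul G P Q) \<le> emeasure \<mu> (src G ` P)"
proof -
  have e: "P \<subseteq> elts G" "Q \<subseteq> elts G" using osD(1)[OF P] osD(1)[OF Q] unfolding sheet_def by auto
  show "emeasure \<mu> (src G ` set_mul G P Q) \<le> emeasure \<mu> (src G ` Q)"
    by (intro emeasure_mono src_image_mu Q) (use e in \<open>auto simp: set_mul_def src_mul subset_iff\<close>)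
  have "emeasure \<mu> (rng G ` set_mul G P Q) \<le> emeasure \<mu> (rng G ` P)"
    by (intro emeasure_mono rng_image_mu P) (use e in \<open>auto simp: set_mul_def rng_mul subset_iff\<close>)
  then show "emeasure \<mu> (src G ` set_mul G P Q) \<le> emeasure \<mu> (src G ` P)"
    using mu_src_rng[OF P] mu_src_rng[OF os_mul[OF P Q]] by simp
qed

lemma lifted_measure_os:
  assumes P: "P \<in> one_sheeted G"
  shows "lifted_measure G \<mu> P = emeasure \<mu> (src G ` P)"
proof -
  have "emeasure (count_space UNIV) {g \<in> P. src G g = x} = indicator (src G ` P) x" for x
  proof (cases "x \<in> src G ` P")
    case True
    then obtain p where p: "p \<in> P" "x = src G p" by blast
    then have "{g \<in> P. src G g = x} = {p}" using osD(1)[OF P] unfolding sheet_def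
      by (auto dest: inj_onD)
    then show ?thesis using True by simp
  next
    case False
    then have "{g \<in> P. src G g = x} = {}" by blast
    then show ?thesis using False by (metis emeasure_empty indicator_simps(2))
  qed
  then show ?thesis unfolding lifted_measure_def using src_image_mu[OF P] by simp
qed

lemma lifted_measure_null:
  assumes B: "lifted_measure G \<mu> B = 0" and P: "P \<in> one_sheeted G" "P \<subseteq> B"
  shows "emeasure \<mu> (src G ` P) = 0"
proof -
  have "lifted_measure G \<mu> P \<le> lifted_measure G \<mu> B"
    unfolding lifted_measure_def by (intro nn_integral_mono emeasure_mono) (use P(2) in auto)
  then show ?thesis using B lifted_measure_os[OF P(1)] by simp
qed

end

section \<open>Operators generated by partial translations and their trace\<close>

definition pt :: "'a \<Rightarrow> 'a \<Rightarrow> real" where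
  "pt b = (\<lambda>a. if a = b then 1 else 0)"

context groupoid
begin

text \<open>\<open>transl j P i\<close> moves the mass of \<open>v\<close> at \<open>(i, g)\<close> to \<open>(j, p g)\<close>, where \<open>p\<close> is the element of
  \<open>P\<close> that can be composed with \<open>g\<close>, and discards it if there is none.\<close>

definition transl :: "'j \<Rightarrow> 'g set \<Rightarrow> 'i \<Rightarrow> ('i \<times> 'g \<Rightarrow> real) \<Rightarrow> 'j \<times> 'g \<Rightarrow> real" where
  "transl j P i v a = (if fst a = j \<and> snd a \<in> dom_of (ivs G ` P)
     then v (i, act (ivs G ` P) (snd a)) else 0)"

fun opsum :: "(real \<times> 'j \<times> 'g set \<times> 'i) list \<Rightarrow> ('i \<times> 'g \<Rightarrow> real) \<Rightarrow> 'j \<times> 'g \<Rightarrow> real" where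
  "opsum [] v a = 0"
| "opsum ((c, j, P, i) # L) v a = c * transl j P i v a + opsum L v a"

text \<open>Two views of the same operators: as formal lists they have a termwise adjoint and a norm
  bound, while as functions they form a class closed under composition, on which the trace is
  defined.\<close>

definition oprs :: "'j set \<Rightarrow> 'i set \<Rightarrow> (('i \<times> 'g \<Rightarrow> real) \<Rightarrow> 'j \<times> 'g \<Rightarrow> real) set" where
  "oprs J I = {opsum L | L. \<forall>(c, j, P, i)\<in>set L. j \<in> J \<and> i \<in> I \<and> P \<in> one_sheeted G}"

lemma transl_lin: "transl j P i (\<lambda>a. v a + c * w a) = (\<lambda>a. transl j P i v a + c * transl j P i w a)"
  unfolding transl_def by auto

lemma transl_zero: "transl j P i (\<lambda>a. 0) = (\<lambda>a. 0)"
  unfolding transl_def by auto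

lemma opsum_lin: "opsum L (\<lambda>a. v a + c * w a) = (\<lambda>a. opsum L v a + c * opsum L w a)"
  by (induction L rule: list.induct) (auto simp: transl_lin fun_eq_iff algebra_simps)

lemma opsum_append: "opsum (L @ L') v a = opsum L v a + opsum L' v a"
  by (induction L v a rule: opsum.induct) auto

lemma opsum_scale: "opsum (map (\<lambda>(c, x). (d * c, x)) L) v a = d * opsum L v a"
  by (induction L v a rule: opsum.induct) (auto simp: algebra_simps)

lemma transl_pt:
  fixes j :: 'j and i k :: 'i
  assumes "sheet P" "g \<in> elts G"
  shows "transl j P i (pt (k, g)) = (if i = k \<and> g \<in> dom_of P then pt (j, act P g) else (\<lambda>a. 0))"
proof
  fix a :: "'j \<times> 'g"
  obtain l h where a: "a = (l, h)" by (cases a)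
  show "transl j P i (pt (k, g)) a = (if i = k \<and> g \<in> dom_of P then pt (j, act P g) else (\<lambda>a. 0)) a"
    unfolding transl_def pt_def a using act_inv[OF assms(1)] act_inv'[OF assms(1)] by auto
qed

lemma transl_transl:
  assumes "sheet P" "sheet Q"
  shows "transl k P j (transl j' Q i v) = (if j
    = j' then transl k (set_mul G P Q) i v else (\<lambda>a. 0))"
  using act_mul[OF sheet_inv[OF assms(2)] sheet_inv[OF assms(1)]]
  by (auto simp: fun_eq_iff transl_def inv_mul[OF assms])

lemma oprs_lin:
  assumes "T \<in> oprs J I"
  shows "T (\<lambda>a. v a + c * w a) = (\<lambda>a. T v a + c * T w a)"
  using assms opsum_lin unfolding oprs_def by force

lemma oprs_zero_arg: "T \<in> oprs J I \<Longrightarrow> T (\<lambda>a. 0) = (\<lambda>a. 0)"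
  using oprs_lin[of T J I "\<lambda>a. 0" "-1" "\<lambda>a. 0"] by (auto simp: fun_eq_iff)

lemma oprs_zero: "(\<lambda>v a. 0) \<in> oprs J I"
  unfolding oprs_def by (intro CollectI exI[of _ "[]"]) (auto simp: fun_eq_iff)

lemma oprs_transl: "j \<in> J \<Longrightarrow> i \<in> I \<Longrightarrow> P \<in> one_sheeted G \<Longrightarrow> transl j P i \<in> oprs J I"
  unfolding oprs_def by (intro CollectI exI[of _ "[(1, j, P, i)]"]) (auto simp: fun_eq_iff)

lemma oprs_add:
  assumes "T \<in> oprs J I" "U \<in> oprs J I"
  shows "(\<lambda>v a. T v a + c * U v a) \<in> oprs J I"
proof -
  obtain L L' where L: "T = opsum L" "\<forall>(c, j, P, i)\<in>set L. j \<in> J \<and> i \<in> I \<and> P \<in> one_sheeted G"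
    and L': "U = opsum L'" "\<forall>(c, j, P, i)\<in>set L'. j \<in> J \<and> i \<in> I \<and> P \<in> one_sheeted G"
    using assms unfolding oprs_def by blast
  show ?thesis unfolding oprs_def
    by (intro CollectI exI[of _ "L @ map (\<lambda>(d, x). (c * d, x)) L'"])
      (use L L' in \<open>auto simp: fun_eq_iff opsum_append opsum_scale\<close>)
qed

lemma oprs_induct [consumes 1, case_names zero add]:
  fixes T :: "('a \<times> 'g \<Rightarrow> real) \<Rightarrow> 'b \<times> 'g \<Rightarrow> real"
  assumes "T \<in> oprs J I" and zero: "R (\<lambda>v a. 0)"
    and add: "\<And>T c j P i. T \<in> oprs J I \<Longrightarrow> R T \<Longrightarrow> j \<in> J \<Longrightarrow> i \<in> I \<Longrightarrow> P \<in> one_sheeted G \<Longrightarrow>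
      R (\<lambda>v a. T v a + c * transl j P i v a)"
  shows "R T"
proof -
  obtain L where L: "T = opsum L" "\<forall>(c, j, P, i)\<in>set L. j \<in> J \<and> i \<in> I \<and> P \<in> one_sheeted G"
    using assms unfolding oprs_def by blast
  have "R (opsum L)" using L(2)
  proof (induction L)
    case Nil
    have "opsum [] = (\<lambda>(v :: 'a \<times> 'g \<Rightarrow> real) (a :: 'b \<times> 'g). 0)" by (auto simp: fun_eq_iff)
    then show ?case using zero by simp
  next
    case (Cons x L)
    obtain c j P i where x: "x = (c, j, P, i)" by (cases x)
    have "opsum (x # L) = (\<lambda>v a. opsum L v a + c * transl j P i v a)" unfolding x
      by (auto simp: fun_eq_iff)
    moreover have "opsum L \<in> oprs J I" unfolding oprs_def using Cons.prems by auto
    ultimately show ?case using add[of "opsum L" j i P c] Cons x by auto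
  qed
  then show ?thesis using L by simp
qed

end

context discrete_borel_groupoid
begin

lemma oprs_comp:
  assumes T: "T \<in> oprs K J" and U: "U \<in> oprs J I"
  shows "(\<lambda>v. T (U v)) \<in> oprs K I"
  using T
proof (induction rule: oprs_induct)
  case zero then show ?case by (rule oprs_zero)
next
  case (add T c k P j)
  have "(\<lambda>v. transl k P j (U v)) \<in> oprs K I" using U
  proof (induction rule: oprs_induct)
    case zero then show ?case using oprs_zero by (simp add: transl_zero)
  next
    case (add U d j' Q i)
    have "(\<lambda>v. transl k P j (transl j' Q i v)) \<in> oprs K I"
      using transl_transl[OF osD(1)[OF \<open>P \<in> one_sheeted G\<close>] osD(1)[OF \<open>Q \<in> one_sheeted G\<close>], of k j j' i]
        oprs_zero oprs_transl[OF \<open>k \<in> K\<close> \<open>i \<in> I\<close> os_mul[OF \<open>P \<in> one_sheeted G\<close> \<open>Q \<in> one_sheeted G\<close>]]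
      by (cases "j = j'") auto
    from oprs_add[OF add.IH this, of d] show ?case by (simp add: transl_lin)
  qed
  from oprs_add[OF add.IH this, of c] show ?case .
qed

end

context pmp_discrete_groupoid
begin

definition optrace :: "'i set \<Rightarrow> (('i \<times> 'g \<Rightarrow> real) \<Rightarrow> 'i \<times> 'g \<Rightarrow> real) \<Rightarrow> real" where
  "optrace I T = (\<integral>x. (\<Sum>i\<in>I. T (pt (i, x)) (i, x)) \<partial>\<mu>)"

lemma diag_transl:
  assumes "sheet P" "x \<in> units G"
  shows "transl j P i (pt (k, x)) (k, x) = (if k = j \<and> k = i then indicator (P \<inter> units G) x else 0)"
proof -
  have x: "x \<in> elts G" using assms units_subset by blast
  show ?thesis
    using fixed_iff[OF assms(1) x] assms(2) rng_unit[of x]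
    by (subst transl_pt[OF assms(1) x]) (auto simp: pt_def indicator_def)
qed

lemma P_units_mu: "P \<in> one_sheeted G \<Longrightarrow> P \<inter> units G \<in> sets \<mu>"
  using osD(2) by (intro sets_muI) auto

lemma integrable_diag:
  assumes "T \<in> oprs J I"
  shows "integrable \<mu> (\<lambda>x. T (pt (k, x)) (k, x))"
  using assms
proof (induction rule: oprs_induct)
  case (add T c j P i)
  have "integrable \<mu> (\<lambda>x. if k = j \<and> k = i then indicat_real (P \<inter> units G) x else 0)"
    using P_units_mu[OF add(4)]
    by (cases "k = j"; cases "k = i") (auto intro!: integrable_real_indicator simp:
      emeasure_eq_measure)
  also have "?this \<longleftrightarrow> integrable \<mu> (\<lambda>x. transl j P i (pt (k, x)) (k, x))"
    by (intro Bochner_Integration.integrable_cong) (auto simp: space_mu diag_transl[OF osD(1)[OF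
      add(4)]])
  finally show ?case using add by auto
qed simp

lemma optrace_add:
  assumes "T \<in> oprs I I" "U \<in> oprs I I"
  shows "optrace I (\<lambda>v a. T v a + c * U v a) = optrace I T + c * optrace I U"
  unfolding optrace_def using integrable_diag[OF assms(1)] integrable_diag[OF assms(2)]
  by (simp add: sum.distrib Bochner_Integration.integral_add flip: sum_distrib_left)

lemma optrace_zero: "optrace I (\<lambda>v a. 0) = 0"
  unfolding optrace_def by simp

lemma optrace_transl:
  assumes "finite I" "i \<in> I" "j \<in> I" "P \<in> one_sheeted G"
  shows "optrace I (transl j P i) = (if i = j then measure \<mu> (P \<inter> units G) else 0)"
proof -
  have "optrace I (transl j P i) = (\<integral>x. (if i = j then indicator (P \<inter> units G) x else 0) \<partial>\<mu>)"
    unfolding optrace_def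
  proof (intro Bochner_Integration.integral_cong refl)
    fix x assume "x \<in> space \<mu>"
    then have "(\<Sum>k\<in>I. transl j P i (pt (k, x)) (k, x)) = (\<Sum>k\<in>I. if k = j then (if i
      = j then indicator (P \<inter> units G) x else 0) else 0)"
      using space_mu by (intro sum.cong) (auto simp: diag_transl[OF osD(1)[OF assms(4)]])
    then show "(\<Sum>k\<in>I. transl j P i (pt (k, x)) (k, x)) = (if i = j then indicator (P
      \<inter> units G) x else 0)"
      using assms by simp
  qed
  also have "\<dots> = (if i = j then measure \<mu> (P \<inter> units G) else 0)"
    using P_units_mu[OF assms(4)] by (simp add: Int_absorb2 sets.sets_into_space)
  finally show ?thesis .
qed

text \<open>Linearity in both operators reduces this to two translations, whose products meet the
  units in the ranges and in the sources of one sheet. Here the invariance of \<mu> enters the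
  trace.\<close>

lemma optrace_comm:
  assumes fin: "finite I" "finite J" and T: "T \<in> oprs J I" and U: "U \<in> oprs I J"
  shows "optrace I (\<lambda>v. U (T v)) = optrace J (\<lambda>v. T (U v))"
  using T
proof (induction rule: oprs_induct)
  case zero then show ?case using oprs_zero_arg[OF U] by (simp add: optrace_zero)
next
  case (add T c j P i)
  note P = oprs_transl[OF add(2-4)]
  have *: "optrace I (\<lambda>v. U (transl j P i v)) = optrace J (\<lambda>v. transl j P i (U v))"
    using U
  proof (induction rule: oprs_induct)
    case zero then show ?case by (simp add: optrace_zero transl_zero)
  next
    case (add U d i' Q j')
    note Q = oprs_transl[OF add(2-4)]
    have PQ: "P \<in> one_sheeted G" "Q \<in> one_sheeted G" by fact+
    have D: "P \<inter> ivs G ` Q \<in> one_sheeted G"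
      using os_subset[OF PQ(1)] osD(2)[OF PQ(1)] osD(2)[OF os_inv[OF PQ(2)]] by auto
    have "measure \<mu> (set_mul G Q P \<inter> units G) = measure \<mu> (set_mul G P Q \<inter> units G)"
      using mu_src_rng[OF D] mul_Int_units[OF osD(1)[OF PQ(1)] osD(1)[OF PQ(2)]]
        by (simp add: measure_def)
    then have "optrace I (\<lambda>v. transl i' Q j' (transl j P i v))
      = optrace J (\<lambda>v. transl j P i (transl i' Q j' v))"
      using optrace_transl[OF fin(1) _ _ os_mul[OF PQ(2,1)]] optrace_transl[OF fin(2) _ _ os_mul[OF
        PQ]]
        \<open>i' \<in> I\<close> \<open>j' \<in> J\<close> \<open>i \<in> I\<close> \<open>j \<in> J\<close>
      by (cases "j' = j"; cases "i = i'") (simp_all add: transl_transl osD(1) PQ optrace_zero)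
    moreover have "optrace I (\<lambda>v a. U (transl j P i v) a + d * transl i' Q j' (transl j P i v) a)
       = optrace I (\<lambda>v. U (transl j P i v)) + d * optrace I (\<lambda>v. transl i' Q j' (transl j P i v))"
      by (rule optrace_add[OF oprs_comp[OF add(1) P] oprs_comp[OF Q P]])
    moreover have "optrace J (\<lambda>v a. transl j P i (U v) a + d * transl j P i (transl i' Q j' v) a)
       = optrace J (\<lambda>v. transl j P i (U v)) + d * optrace J (\<lambda>v. transl j P i (transl i' Q j' v))"
      by (rule optrace_add[OF oprs_comp[OF P add(1)] oprs_comp[OF P Q]])
    ultimately show ?case using add.IH by (simp add: transl_lin)
  qed
  have "optrace I (\<lambda>v a. U (T v) a + c * U (transl j P i v) a)
     = optrace I (\<lambda>v. U (T v)) + c * optrace I (\<lambda>v. U (transl j P i v))"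
    by (rule optrace_add[OF oprs_comp[OF U add(1)] oprs_comp[OF U P]])
  moreover have "optrace J (\<lambda>v a. T (U v) a + c * transl j P i (U v) a)
     = optrace J (\<lambda>v. T (U v)) + c * optrace J (\<lambda>v. transl j P i (U v))"
    by (rule optrace_add[OF oprs_comp[OF add(1) U] oprs_comp[OF P U]])
  ultimately show ?case using add.IH * by (simp add: oprs_lin[OF U])
qed

text \<open>\<open>EI\<close> and \<open>EJ\<close> act as identities, and \<open>B\<close>
  intertwines \<open>S\<close> with \<open>S'\<close>. Passing from \<open>n\<close> to
  \<open>Suc n\<close> subtracts \<open>t\<close> times the trace of \<open>S^n B' B\<close> on one
  side and of \<open>S'^n B B'\<close> on the other. These agree, because cyclicity turns the first
  into the trace of \<open>B S^n B'\<close>, and \<open>B S^n = S'^n B\<close>.\<close>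

lemma optrace_power:
  fixes I :: "'i set" and J :: "'j set"
  assumes fin: "finite I" "finite J"
    and B: "B \<in> oprs J I" and B': "B' \<in> oprs I J" and EI: "EI \<in> oprs I I" and EJ: "EJ \<in> oprs J J"
    and EI_EI: "\<And>v. EI (EI v) = EI v" and EJ_EJ: "\<And>v. EJ (EJ v) = EJ v"
    and BEI: "\<And>v. B (EI v) = B v" and EJB: "\<And>v. EJ (B v) = B v" and B'EJ: "\<And>v. B' (EJ v) = B' v"
    and S: "\<And>v. S v = (\<lambda>a. EI v a - t * B' (B v) a)"
      and S': "\<And>w. S' w = (\<lambda>a. EJ w a - t * B (B' w) a)"
  shows "optrace I EI - optrace I (\<lambda>v. (S ^^ n) (EI v)) = optrace J EJ
    - optrace J (\<lambda>v. (S' ^^ n) (EJ v))"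
    and "(\<lambda>v. (S ^^ n) (EI v)) \<in> oprs I I" and "(\<lambda>v. (S' ^^ n) (EJ v)) \<in> oprs J J"
proof -
  have SO: "S \<in> oprs I I"
    using oprs_add[OF EI oprs_comp[OF B' B], of "-t"] by (simp add: S[abs_def])
  have S'O: "S' \<in> oprs J J"
    using oprs_add[OF EJ oprs_comp[OF B B'], of "-t"] by (simp add: S'[abs_def])
  \<comment> \<open>The same fact is stated again as \<open>SnO'\<close>, because the type of
    \<open>K\<close> is fixed within a proof and both index types occur.\<close>
  have SnO: "(\<lambda>v. (S ^^ n) (T v)) \<in> oprs I K" if "T \<in> oprs I K" for T n and K :: "'j set"
    by (induction n) (use that oprs_comp[OF SO] in auto)
  have S'nO: "(\<lambda>v. (S' ^^ n) (T v)) \<in> oprs J K" if "T \<in> oprs J K" for T n and K :: "'j set"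
    by (induction n) (use that oprs_comp[OF S'O] in auto)
  have SnO': "(\<lambda>v. (S ^^ n) (T v)) \<in> oprs I K" if "T \<in> oprs I K" for T n and K :: "'i set"
    by (induction n) (use that oprs_comp[OF SO] in auto)
  show "(\<lambda>v. (S ^^ n) (EI v)) \<in> oprs I I" using SnO'[OF EI] .
  show "(\<lambda>v. (S' ^^ n) (EJ v)) \<in> oprs J J" using S'nO[OF EJ] .
  have lin: "(S ^^ n) (\<lambda>a. v a + c * w a) = (\<lambda>a. (S ^^ n) v a + c * (S ^^ n) w a)" for n v c w
    by (induction n) (auto simp: oprs_lin[OF SO])
  have lin': "(S' ^^ n) (\<lambda>a. v a + c * w a) = (\<lambda>a. (S' ^^ n) v a + c * (S' ^^ n) w a)" for n v c w
    by (induction n) (auto simp: oprs_lin[OF S'O])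
  have BS: "B (S v) = S' (B v)" for v
    unfolding S S' using oprs_lin[OF B, of "EI v" "-t" "B' (B v)"] BEI EJB by simp
  have BSn: "B ((S ^^ n) v) = (S' ^^ n) (B v)" for n v by (induction n) (auto simp: BS)
  have SE: "S (EI v) = S v" and SE': "S' (EJ w) = S' w" for v w unfolding S S' EI_EI EJ_EJ BEI B'EJ
    by simp_all
  show "optrace I EI - optrace I (\<lambda>v. (S ^^ n) (EI v)) = optrace J EJ
    - optrace J (\<lambda>v. (S' ^^ n) (EJ v))"
  proof (induction n)
    case (Suc n)
    have 1: "(S ^^ Suc n) (EI v) = (\<lambda>a. (S ^^ n) (EI v) a + (-t) * (S ^^ n) (B' (B v)) a)" for v
      using lin[of n "EI v" "-t" "B' (B v)"] unfolding funpow_Suc_right comp_def SE by (simp add: S)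
    have 2: "(S' ^^ Suc n) (EJ w) = (\<lambda>a. (S' ^^ n) (EJ w) a + (-t) * (S' ^^ n) (B (B' w)) a)" for w
      using lin'[of n "EJ w" "-t" "B (B' w)"] unfolding funpow_Suc_right comp_def SE'
        by (simp add: S')
    have "optrace I (\<lambda>v. (S ^^ n) (B' (B v))) = optrace J (\<lambda>v. B ((S ^^ n) (B' v)))"
      by (rule optrace_comm[OF fin B SnO[OF B']])
    then have "optrace I (\<lambda>v. (S ^^ n) (B' (B v))) = optrace J (\<lambda>v. (S' ^^ n) (B (B' v)))"
      by (simp add: BSn)
    then show ?case
      unfolding 1 2 optrace_add[OF SnO'[OF EI] SnO'[OF oprs_comp[OF B' B]]] optrace_add[OF S'nO[OF
        EJ] S'nO[OF oprs_comp[OF B B']]]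
      using Suc by simp
  qed simp
qed

end

section \<open>The trace inequality\<close>

text \<open>Summing over the support of the first argument gives a meaningful value for arbitrary
  \<open>w\<close> once \<open>v\<close> has finite support; symmetry holds when both supports are
  finite.\<close>

definition ip :: "('a \<Rightarrow> real) \<Rightarrow> ('a \<Rightarrow> real) \<Rightarrow> real" where
  "ip v w = (\<Sum>a\<in>{a. v a \<noteq> 0}. v a * w a)"

definition finsupp :: "('a \<Rightarrow> real) \<Rightarrow> bool" where
  "finsupp v \<longleftrightarrow> finite {a. v a \<noteq> 0}"

lemma ip_eq: "finite Z \<Longrightarrow> {a. v a \<noteq> 0} \<subseteq> Z \<Longrightarrow> ip v w = (\<Sum>a\<in>Z. v a * w a)"
  unfolding ip_def by (rule sum.mono_neutral_left) auto

lemma finsupp_lin: "finsupp v \<Longrightarrow> finsupp w \<Longrightarrow> finsupp (\<lambda>a. d * v a + c * w a)"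
  unfolding finsupp_def by (rule finite_subset[of _ "{a. v a \<noteq> 0} \<union> {a. w a \<noteq> 0}"]) auto

lemma finsupp_lin1: "finsupp v \<Longrightarrow> finsupp w \<Longrightarrow> finsupp (\<lambda>a. v a + c * w a)"
  using finsupp_lin[of v w 1 c] by simp

lemma finsupp_pt: "finsupp (pt b)" unfolding finsupp_def pt_def by simp

lemma ip_commute: "finsupp v \<Longrightarrow> finsupp w \<Longrightarrow> ip v w = ip w v"
  unfolding finsupp_def
  using ip_eq[of "{a. v a \<noteq> 0} \<union> {a. w a \<noteq> 0}" v w] ip_eq[of "{a. v a \<noteq> 0} \<union> {a. w a \<noteq> 0}" w v]
  by (simp add: mult.commute)

lemma ip_lin_right: "ip v (\<lambda>a. u a + c * w a) = ip v u + c * ip v w"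
  unfolding ip_def by (simp add: sum.distrib sum_distrib_left algebra_simps)

lemma ip_lin_left:
  assumes "finsupp v" "finsupp w"
  shows "ip (\<lambda>a. v a + c * w a) u = ip v u + c * ip w u"
proof -
  let ?Z = "{a. v a \<noteq> 0} \<union> {a. w a \<noteq> 0}"
  have Z: "finite ?Z" using assms unfolding finsupp_def by simp
  have "ip (\<lambda>a. v a + c * w a) u = (\<Sum>a\<in>?Z. (v a + c * w a) * u a)"
    by (rule ip_eq[OF Z]) auto
  also have "\<dots> = (\<Sum>a\<in>?Z. v a * u a) + c * (\<Sum>a\<in>?Z. w a * u a)"
    unfolding sum_distrib_left sum.distrib[symmetric] by (simp add: algebra_simps)
  also have "\<dots> = ip v u + c * ip w u" using ip_eq[OF Z, of v u] ip_eq[OF Z, of w u] by auto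
  finally show ?thesis .
qed

lemma ip_pt: "ip (pt b) w = w b"
  using ip_eq[of "{b}" "pt b" w] by (auto simp: pt_def)

lemma nsq_nonneg: "0 \<le> ip v v" unfolding ip_def by (intro sum_nonneg) auto

lemma nsq_add:
  assumes "finsupp v" "finsupp w"
  shows "ip (\<lambda>a. c * v a + w a) (\<lambda>a. c * v a + w a) \<le> 2 * c\<^sup>2 * ip v v + 2 * ip w w"
proof -
  let ?Z = "{a. v a \<noteq> 0} \<union> {a. w a \<noteq> 0}"
  have Z: "finite ?Z" using assms unfolding finsupp_def by simp
  have "ip (\<lambda>a. c * v a + w a) (\<lambda>a. c * v a + w a) = (\<Sum>a\<in>?Z. (c * v a + w a) * (c * v a + w a))"
    by (rule ip_eq[OF Z]) auto
  also have "\<dots> \<le> (\<Sum>a\<in>?Z. 2 * c\<^sup>2 * (v a * v a) + 2 * (w a * w a))"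
  proof (rule sum_mono)
    fix a
    have "0 \<le> (c * v a - w a)\<^sup>2" by simp
    then show "(c * v a + w a) * (c * v a + w a) \<le> 2 * c\<^sup>2 * (v a * v a) + 2 * (w a * w a)"
      by (simp add: power2_eq_square algebra_simps)
  qed
  also have "\<dots> = 2 * c\<^sup>2 * ip v v + 2 * ip w w"
    using ip_eq[OF Z, of v v] ip_eq[OF Z, of w w] by (auto simp: sum.distrib sum_distrib_left)
  finally show ?thesis .
qed

text \<open>One step of gradient descent for \<open>v \<mapsto> |B v|^2\<close>.\<close>

lemma contraction:
  assumes v: "finsupp v" "finsupp (B' (B v))" and K: "K > 0" "D > 0"
    and adj: "ip v (B' (B v)) = ip (B v) (B v)"
    and bound: "ip (B' (B v)) (B' (B v)) \<le> K * ip (B v) (B v)"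
    and lower: "ip v v \<le> D * ip (B v) (B v)"
  shows "ip (\<lambda>a. v a - 1 / K * B' (B v) a) (\<lambda>a. v a - 1 / K * B' (B v) a) \<le> (1 - 1 / (K * D))
    * ip v v"
proof -
  let ?w = "B' (B v)" and ?s = "ip (B v) (B v)"
  let ?S = "\<lambda>a. v a + (- 1 / K) * ?w a"
  have "ip ?S ?S = ip v v - 2 / K * ?s + ip ?w ?w / K\<^sup>2"
    unfolding ip_lin_left[OF v] ip_lin_right using adj ip_commute[OF v] K
    by (simp add: field_simps power2_eq_square)
  also have "\<dots> \<le> ip v v - 2 / K * ?s + K * ?s / K\<^sup>2"
    using bound K by (intro add_left_mono divide_right_mono) auto
  also have "\<dots> = ip v v - ?s / K" using K by (simp add: power2_eq_square field_simps)
  also have "\<dots> \<le> ip v v - (ip v v / D) / K"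
    using lower K by (intro diff_left_mono divide_right_mono) (auto simp: field_simps)
  also have "\<dots> = (1 - 1 / (K * D)) * ip v v" using K by (simp add: field_simps)
  finally show ?thesis by simp
qed

section \<open>Adjoints and norm bounds for finite sums of translations\<close>

context groupoid
begin

lemma transl_supp:
  assumes "sheet P"
  shows "{a. transl j P i v a \<noteq> 0} = (\<lambda>a. (j, act P (snd a))) ` {a. v a \<noteq> 0 \<and> fst a = i \<and> snd a
    \<in> dom_of P}"
    (is "?L = ?f ` ?A")
proof (intro set_eqI iffI)
  fix a assume "a \<in> ?L"
  then have a: "fst a = j" "snd a \<in> dom_of (ivs G ` P)" "v (i, act (ivs G ` P) (snd a)) \<noteq> 0"
    unfolding transl_def by (auto split: if_splits)
  then have "(i, act (ivs G ` P) (snd a)) \<in> ?A" "?f (i, act (ivs G ` P) (snd a)) = a"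
    using act_inv'[OF assms a(2)] by (auto simp: prod_eq_iff)
  then show "a \<in> ?f ` ?A" by (intro image_eqI[of a ?f "(i, act (ivs G ` P) (snd a))"]) (simp_all
    only:)
next
  fix b assume "b \<in> ?f ` ?A"
  then obtain g where "b = (j, act P g)" "v (i, g) \<noteq> 0" "g \<in> dom_of P" by auto
  then show "b \<in> ?L" using act_inv[OF assms] unfolding transl_def by simp
qed

lemma transl_inj:
  assumes "sheet P"
  shows "inj_on (\<lambda>a. (j, act P (snd a))) {a. v a \<noteq> 0 \<and> fst a = i \<and> snd a \<in> dom_of P}"
proof (rule inj_onI)
  fix a b
  assume a: "a \<in> {a. v a \<noteq> 0 \<and> fst a = i \<and> snd a \<in> dom_of P}"
    and b: "b \<in> {a. v a \<noteq> 0 \<and> fst a = i \<and> snd a \<in> dom_of P}"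
    and eq: "(j, act P (snd a)) = (j, act P (snd b))"
  have "act (ivs G ` P) (act P (snd a)) = snd a" "act (ivs G ` P) (act P (snd b)) = snd b"
    using act_inv(2)[OF assms] a b by blast+
  moreover have "act P (snd a) = act P (snd b)" using eq by (simp only: prod.inject)
  ultimately have "snd a = snd b" by (metis (no_types))
  then show "a = b" using a b by (simp add: prod_eq_iff)
qed

lemma finsupp_transl:
  assumes "sheet P" "finsupp v"
  shows "finsupp (transl j P i v)"
proof -
  have "finite {a. v a \<noteq> 0 \<and> fst a = i \<and> snd a \<in> dom_of P}"
    using assms(2) unfolding finsupp_def by (rule rev_finite_subset) auto
  then show ?thesis unfolding finsupp_def transl_supp[OF assms(1)] by (rule finite_imageI)
qed

lemma transl_adjoint:
  assumes P: "sheet P" and v: "finsupp v"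
  shows "ip (transl j P i v) w = ip v (transl i (ivs G ` P) j w)"
proof -
  let ?A = "{a. v a \<noteq> 0 \<and> fst a = i \<and> snd a \<in> dom_of P}"
  have "ip (transl j P i v) w = (\<Sum>a\<in>?A. transl j P i v (j, act P (snd a)) * w (j, act P (snd a)))"
    unfolding ip_def transl_supp[OF P] by (subst sum.reindex[OF transl_inj[OF P]]) simp
  also have "\<dots> = (\<Sum>a\<in>?A. v a * transl i (ivs G ` P) j w a)"
    by (rule sum.cong) (auto simp: transl_def act_inv[OF P] inv_inv[OF P])
  also have "\<dots> = ip v (transl i (ivs G ` P) j w)"
    unfolding ip_def using v unfolding finsupp_def
    by (intro sum.mono_neutral_left) (auto simp: transl_def inv_inv[OF P])
  finally show ?thesis .
qed

text \<open>A translation is a partial isometry: followed by its adjoint it merely cuts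
  \<open>v\<close> down to the domain of \<open>P\<close>.\<close>

lemma nsq_transl:
  assumes P: "sheet P" and v: "finsupp v"
  shows "ip (transl j P i v) (transl j P i v) \<le> ip v v"
proof -
  have "transl i (ivs G ` P) j (transl j P i v) a = (if fst a = i \<and> snd a
    \<in> dom_of P then v a else 0)" for a
    by (cases a) (simp add: transl_def inv_inv[OF P] act_inv[OF P])
  then show ?thesis unfolding transl_adjoint[OF assms] unfolding ip_def by (intro sum_mono) auto
qed

definition adj :: "(real \<times> 'j \<times> 'g set \<times> 'i) list \<Rightarrow> (real \<times> 'i \<times> 'g set \<times> 'j) list" where
  "adj L = map (\<lambda>(c, j, P, i). (c, i, ivs G ` P, j)) L"

definition sheets :: "(real \<times> 'j \<times> 'g set \<times> 'i) list \<Rightarrow> bool" where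
  "sheets L \<longleftrightarrow> (\<forall>(c, j, P, i)\<in>set L. sheet P)"

lemma sheets_simps [simp]: "sheets []" "sheets ((c, j, P, i) # L) \<longleftrightarrow> sheet P \<and> sheets L"
  unfolding sheets_def by auto

lemma opsum_Cons: "opsum ((c, j, P, i) # L) v = (\<lambda>a. opsum L v a + c * transl j P i v a)"
  by (auto simp: fun_eq_iff)

lemma adj_Cons: "adj ((c, j, P, i) # L) = (c, i, ivs G ` P, j) # adj L"
  unfolding adj_def by simp

lemma finsupp_opsum: "sheets L \<Longrightarrow> finsupp v \<Longrightarrow> finsupp (opsum L v)"
proof (induction L)
  case Nil then show ?case by (simp add: finsupp_def)
next
  case (Cons x L)
  obtain c j P i where x: "x = (c, j, P, i)" by (cases x)
  show ?case using Cons finsupp_lin1[OF _ finsupp_transl, of "opsum L v" P v c j i]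
    unfolding x opsum_Cons by simp
qed

lemma opsum_adjoint: "sheets L \<Longrightarrow> finsupp v \<Longrightarrow> ip (opsum L v) w = ip v (opsum (adj L) w)"
proof (induction L)
  case Nil then show ?case by (simp add: ip_def adj_def)
next
  case (Cons x L)
  obtain c j P i where x: "x = (c, j, P, i)" by (cases x)
  have P: "sheet P" and L: "sheets L" using Cons.prems x by auto
  show ?case
    unfolding x adj_Cons opsum_Cons ip_lin_left[OF finsupp_opsum[OF L Cons.prems(2)]
      finsupp_transl[OF P Cons.prems(2)]]
      ip_lin_right Cons.IH[OF L Cons.prems(2)] transl_adjoint[OF P Cons.prems(2)] ..
qed

lemma opsum_bounded:
  "sheets L \<Longrightarrow> \<exists>K>0. \<forall>v. finsupp v \<longrightarrow> ip (opsum L v) (opsum L v) \<le> K * ip v v"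
proof (induction L)
  case Nil then show ?case using nsq_nonneg by (intro exI[of _ 1]) (auto simp: ip_def)
next
  case (Cons x L)
  obtain c j P i where x: "x = (c, j, P, i)" by (cases x)
  have P: "sheet P" and L: "sheets L" using Cons.prems x by auto
  obtain K where K: "K > 0" "\<forall>v. finsupp v \<longrightarrow> ip (opsum L v) (opsum L v) \<le> K * ip v v"
    using Cons.IH[OF L] by blast
  show ?case
  proof (intro exI[of _ "2 * c\<^sup>2 + 2 * K"] conjI allI impI)
    show "2 * c\<^sup>2 + 2 * K > 0" using K by (simp add: add_nonneg_pos)
    fix v :: "'b \<times> 'g \<Rightarrow> real" assume v: "finsupp v"
    have "opsum (x # L) v = (\<lambda>a. c * transl j P i v a + opsum L v a)" by (auto simp: x)
    then have "ip (opsum (x # L) v) (opsum (x # L) v) \<le> 2 * c\<^sup>2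
      * ip (transl j P i v) (transl j P i v) + 2 * ip (opsum L v) (opsum L v)"
      using nsq_add[OF finsupp_transl[OF P v] finsupp_opsum[OF L v]] by simp
    also have "\<dots> \<le> 2 * c\<^sup>2 * ip v v + 2 * (K * ip v v)"
      using nsq_transl[OF P v] K(2) v by (intro add_mono mult_left_mono) auto
    finally show "ip (opsum (x # L) v) (opsum (x # L) v) \<le> (2 * c\<^sup>2 + 2 * K) * ip v v"
      by (simp add: algebra_simps)
  qed
qed

text \<open>The identity of a space of functions on edges, extended by 0: an edge of kind
  \<open>i\<close> starts at \<open>g\<close> only if the range of \<open>g\<close> lies in
  \<open>D i\<close>. Its trace is the total measure of the sets \<open>D i\<close>.\<close>

definition ident :: "'i set \<Rightarrow> ('i \<Rightarrow> 'g set) \<Rightarrow> ('i \<times> 'g \<Rightarrow> real) \<Rightarrow> 'i \<times> 'g \<Rightarrow> real" where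
  "ident I D v a = (if fst a \<in> I \<and> snd a \<in> elts G \<and> rng G (snd a) \<in> D (fst a) then v a else 0)"

lemma ident_ident: "ident I D (ident I D v) = ident I D v" unfolding ident_def by auto

lemma ident_lin: "ident I D (\<lambda>a. v a + c * w a) = (\<lambda>a. ident I D v a + c * ident I D w a)"
  unfolding ident_def by auto

lemma ident_pt:
  "ident I D (pt (i, x)) = (if i \<in> I \<and> x \<in> elts G \<and> rng G x \<in> D i then pt (i, x) else (\<lambda>a. 0))"
  unfolding ident_def pt_def by auto

lemma finsupp_ident: "finsupp v \<Longrightarrow> finsupp (ident I D v)"
  unfolding finsupp_def by (rule finite_subset[of _ "{a. v a \<noteq> 0}"]) (auto simp: ident_def)

lemma ident_adjoint: "ip (ident I D v) w = ip v (ident I D w)" if "finsupp v"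
proof -
  have "ip (ident I D v) w = (\<Sum>a\<in>{a. v a \<noteq> 0}. ident I D v a * w a)"
    by (rule ip_eq) (use that in \<open>auto simp: finsupp_def ident_def\<close>)
  also have "\<dots> = ip v (ident I D w)" unfolding ip_def by (rule sum.cong) (auto simp: ident_def)
  finally show ?thesis .
qed

lemma src_inv_image: "sheet P \<Longrightarrow> src G ` ivs G ` P = rng G ` P"
  using sheet_elts src_ivs by (force simp: image_iff)

lemma rng_inv_image: "sheet P \<Longrightarrow> rng G ` ivs G ` P = src G ` P"
  using sheet_elts rng_ivs by (force simp: image_iff)

lemma ident_transl_right:
  assumes "sheet P" "src G ` P \<subseteq> D i" "i \<in> I"
  shows "transl j P i (ident I D v) = transl j P i v"
  using act_inv'(1)[OF assms(1)] assms(2,3) unfolding transl_def ident_def dom_of_def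
    by (auto simp: fun_eq_iff)

lemma ident_transl_left:
  assumes "sheet P" "rng G ` P \<subseteq> D j" "j \<in> J"
  shows "ident J D (transl j P i v) = transl j P i v"
  using assms src_inv_image[OF assms(1)] unfolding transl_def ident_def dom_of_def
    by (auto simp: fun_eq_iff)

lemma ident_opsum:
  "\<forall>(c, j, P, i)\<in>set L. sheet P \<and> i \<in> I \<and> src G ` P \<subseteq> D i \<Longrightarrow> opsum L (ident I D v) = opsum L v"
  "\<forall>(c, j, P, i)\<in>set L. sheet P \<and> j \<in> J \<and> rng G ` P \<subseteq> E j \<Longrightarrow> ident J E (opsum L v) = opsum L v"
proof (induction L)
  case Nil
  { case 1 show ?case by (simp add: fun_eq_iff) }
  { case 2 show ?case by (simp add: fun_eq_iff ident_def) }
next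
  case (Cons x L)
  obtain c j P i where x: "x = (c, j, P, i)" by (cases x)
  { case 1 then show ?case using Cons.IH(1) ident_transl_right[of P D i I j v]
    unfolding x opsum_Cons by simp }
  { case 2 then show ?case using Cons.IH(2) ident_transl_left[of P E j J i v]
    unfolding x opsum_Cons ident_lin by simp }
qed

text \<open>The forest property is available only off a null set \<open>N\<close> of units. When
  \<open>N\<close> is saturated under the sheets involved, the operators preserve the functions that
  avoid it.\<close>

definition avoids :: "'g set \<Rightarrow> ('i \<times> 'g \<Rightarrow> real) \<Rightarrow> bool" where
  "avoids N v \<longleftrightarrow> (\<forall>a. v a \<noteq> 0 \<longrightarrow> snd a \<in> elts G \<and> rng G (snd a) \<notin> N)"

lemma avoids_lin: "avoids N v \<Longrightarrow> avoids N w \<Longrightarrow> avoids N (\<lambda>a. v a + c * w a)"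
  unfolding avoids_def by (metis add_0 mult_zero_right)

lemma avoids_transl:
  assumes "sheet P" "\<And>p. p \<in> P \<Longrightarrow> src G p \<in> N \<longleftrightarrow> rng G p \<in> N" "avoids N v"
  shows "avoids N (transl j P i v)"
  unfolding avoids_def
proof (intro allI impI)
  fix a assume "transl j P i v a \<noteq> 0"
  then have "a \<in> (\<lambda>a. (j, act P (snd a))) ` {a. v a \<noteq> 0 \<and> fst a = i \<and> snd a \<in> dom_of P}"
    using transl_supp[OF assms(1), of j i v] by blast
  then obtain g where g: "a = (j, act P g)" "v (i, g) \<noteq> 0" "g \<in> dom_of P" by auto
  obtain p where p: "p \<in> P" "p \<in> elts G" "g \<in> elts G" "src G p = rng G g" "act P g = mul G p g"
    by (rule domE[OF g(3) assms(1)])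
  have "rng G g \<notin> N" using assms(3) g(2) unfolding avoids_def by force
  then have "rng G p \<notin> N" using assms(2)[OF p(1)] p(4) by simp
  then show "snd a \<in> elts G \<and> rng G (snd a) \<notin> N" using p g by (simp add: rng_mul mul_closed)
qed

lemma avoids_opsum:
  "\<forall>(c, j, P, i)\<in>set L. sheet P \<and> (\<forall>p\<in>P. src G p \<in> N \<longleftrightarrow> rng G p \<in> N) \<Longrightarrow> avoids N v
    \<Longrightarrow> avoids N (opsum L v)"
proof (induction L)
  case Nil then show ?case by (simp add: avoids_def)
next
  case (Cons x L)
  obtain c j P i where x: "x = (c, j, P, i)" by (cases x)
  show ?case using Cons avoids_lin[OF _ avoids_transl[of P N v j i], of "opsum L v" c]
    unfolding x opsum_Cons by simp
qed

end

section \<open>Comparison of dimensions by traces of powers\<close>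

context pmp_discrete_groupoid
begin

lemma ident_oprs:
  assumes "finite I" "\<And>i. i \<in> I \<Longrightarrow> D i \<in> sets (borel_str G) \<and> D i \<subseteq> units G"
  shows "ident I D \<in> oprs I I"
proof -
  have "ident K D \<in> oprs I I" if "finite K" "K \<subseteq> I" for K
    using that
  proof (induction K)
    case empty
    have "ident {} D = (\<lambda>v a. 0)" unfolding ident_def by (auto simp: fun_eq_iff)
    then show ?case using oprs_zero by simp
  next
    case (insert k K)
    have k: "D k \<subseteq> units G" "D k \<in> one_sheeted G" using assms(2)[of k] insert.prems os_units by auto
    have inv: "ivs G ` D k = D k" using k(1) ivs_unit by (force simp: image_iff subset_iff)
    have "ident (insert k K) D = (\<lambda>v a. ident K D v a + 1 * transl k (D k) k v a)"
      using insert.hyps act_units[OF k(1)] dom_elts[of _ "D k"]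
      unfolding ident_def transl_def inv by (auto simp: fun_eq_iff)
    then show ?case
      using oprs_add[OF insert.IH oprs_transl[OF _ _ k(2), of k I k I], of 1] insert.prems by simp
  qed
  then show ?thesis using assms by blast
qed

lemma optrace_ident:
  assumes "finite I" "\<And>i. i \<in> I \<Longrightarrow> D i \<in> sets \<mu>"
  shows "optrace I (ident I D) = (\<Sum>i\<in>I. measure \<mu> (D i))"
proof -
  have "optrace I (ident I D) = (\<integral>x. (\<Sum>i\<in>I. indicator (D i) x) \<partial>\<mu>)"
    unfolding optrace_def
  proof (intro Bochner_Integration.integral_cong sum.cong refl)
    fix x i assume "x \<in> space \<mu>" "i \<in> I"
    then show "ident I D (pt (i, x)) (i, x) = indicator (D i) x"
      unfolding ident_pt using space_mu units_subset rng_unit[of x]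
        by (auto simp: pt_def indicator_def)
  qed
  also have "\<dots> = (\<Sum>i\<in>I. \<integral>x. indicator (D i) x \<partial>\<mu>)"
    by (rule Bochner_Integration.integral_sum) (use assms
      in \<open>auto intro!: integrable_real_indicator simp: emeasure_eq_measure\<close>)
  also have "\<dots> = (\<Sum>i\<in>I. measure \<mu> (D i))"
    by (rule sum.cong) (use assms in \<open>auto simp: Int_absorb2 sets.sets_into_space\<close>)
  finally show ?thesis .
qed

text \<open>The two sums are the dimensions of the domain and of the target of the operator, and
  \<open>lower\<close> gives it a bounded left inverse. A lower bound for functions avoiding
  \<open>N\<close> suffices since the trace integrates over almost every unit.\<close>

lemma trace_inequality:
  fixes I :: "'i set" and J :: "'j set"
  assumes fin: "finite I" "finite J"
    and D: "\<And>i. i \<in> I \<Longrightarrow> D i \<in> sets (borel_str G) \<and> D i \<subseteq> units G"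
    and E: "\<And>j. j \<in> J \<Longrightarrow> E j \<in> sets (borel_str G) \<and> E j \<subseteq> units G"
    and L: "\<And>c j P i. (c, j, P, i) \<in> set L \<Longrightarrow> P \<in> one_sheeted G \<and> i \<in> I \<and> src G ` P \<subseteq> D i \<and> j \<in> J
      \<and> rng G ` P \<subseteq> E j"
    and N: "AE x in \<mu>. x \<notin> N"
    and stable: "\<And>c j P i p. (c, j, P, i) \<in> set L \<Longrightarrow> p \<in> P \<Longrightarrow> src G p \<in> N \<longleftrightarrow> rng G p \<in> N"
    and C: "C > 0"
    and lower: "\<And>v. finsupp v \<Longrightarrow> avoids N v \<Longrightarrow> ident I D v = v \<Longrightarrow> ip v v \<le> C
      * ip (opsum L v) (opsum L v)"
  shows "(\<Sum>i\<in>I. measure \<mu> (D i)) \<le> (\<Sum>j\<in>J. measure \<mu> (E j))"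
proof -
  define B where "B = opsum L"
  define B' where "B' = opsum (adj L)"
  define P where "P = ident I D"
  define Q where "Q = ident J E"
  have shL: "sheets L" unfolding sheets_def using L osD by blast
  have adjL: "Q \<in> one_sheeted G \<and> sheet Q \<and> j \<in> J \<and> src G ` Q \<subseteq> E j \<and> i \<in> I \<and> rng G ` Q \<subseteq> D i
      \<and> (\<forall>q\<in>Q. src G q \<in> N \<longleftrightarrow> rng G q \<in> N)"
    if Q: "(c, i, Q, j) \<in> set (adj L)" for c i Q j
  proof -
    obtain P where P: "(c, j, P, i) \<in> set L" "Q = ivs G ` P" using Q unfolding adj_def by auto
    have p: "P \<in> one_sheeted G \<and> i \<in> I \<and> src G ` P \<subseteq> D i \<and> j \<in> J \<and> rng G ` P \<subseteq> E j" "sheet P"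
      using L[OF P(1)] osD by blast+
    have "src G q \<in> N \<longleftrightarrow> rng G q \<in> N" if q: "q \<in> Q" for q
    proof -
      obtain p where "p \<in> P" "q = ivs G p" using q P by blast
      then show ?thesis using stable[OF P(1)] sheet_elts[OF p(2)] by (simp add: src_ivs rng_ivs)
    qed
    then show ?thesis using p os_inv osD src_inv_image[OF p(2)] rng_inv_image[OF p(2)]
      unfolding P(2) by simp
  qed
  have shL': "sheets (adj L)" unfolding sheets_def using adjL by blast
  have BO: "B \<in> oprs J I" unfolding B_def oprs_def using L by blast
  have B'O: "B' \<in> oprs I J" unfolding B'_def oprs_def using adjL by blast
  have PO: "P \<in> oprs I I" unfolding P_def by (rule ident_oprs[OF fin(1) D])
  have QO: "Q \<in> oprs J J" unfolding Q_def by (rule ident_oprs[OF fin(2) E])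
  have BP: "B (P v) = B v" and QB: "Q (B v) = B v" for v
    unfolding B_def P_def Q_def by (rule ident_opsum; use L osD in blast)+
  have PB': "P (B' w) = B' w" and B'Q: "B' (Q w) = B' w" for w
    unfolding B'_def P_def Q_def by (rule ident_opsum; use adjL in blast)+
  have fsB: "finsupp (B v)" if "finsupp v" for v unfolding B_def
    by (rule finsupp_opsum[OF shL that])
  have fsB': "finsupp (B' w)" if "finsupp w" for w unfolding B'_def
    by (rule finsupp_opsum[OF shL' that])
  have BB': "ip (B v) w = ip v (B' w)" if "finsupp v" for v w
    unfolding B_def B'_def by (rule opsum_adjoint[OF shL that])
  have B'B: "ip (B' w) v = ip w (B v)" if "finsupp v" "finsupp w" for v w
    using BB'[OF that(1), of w] ip_commute[OF that(1) fsB'[OF that(2)]] ip_commute[OF that(2) fsB[OF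
      that(1)]] by simp
  \<comment> \<open>The step size \<open>1 / K\<close> comes from a bound for the adjoint, the form
    in which \<open>contraction\<close> uses it.\<close>
  obtain K where K: "K > 0" "\<And>w. finsupp w \<Longrightarrow> ip (B' w) (B' w) \<le> K * ip w w"
    using opsum_bounded[OF shL'] unfolding B'_def by blast
  \<comment> \<open>Enlarging \<open>C\<close> by \<open>1 / K\<close> makes \<open>K * C'\<close>
    at least 1, so that the rate \<rho> is nonnegative as well as below 1.\<close>
  define C' where "C' = C + 1 / K"
  define \<rho> where "\<rho> = 1 - 1 / (K * C')"
  have C': "C' > 0" "C \<le> C'" using C K by (auto simp: C'_def add_pos_pos)
  have \<rho>: "0 \<le> \<rho>" "\<rho> < 1"
  proof -
    have "K * C' \<ge> 1" using C K by (simp add: C'_def distrib_left)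
    then show "0 \<le> \<rho>" unfolding \<rho>_def by simp
    show "\<rho> < 1" unfolding \<rho>_def using K C' by simp
  qed
  define S where "S v = (\<lambda>a. P v a - 1 / K * B' (B v) a)" for v
  define S' where "S' w = (\<lambda>a. Q w a - 1 / K * B (B' w) a)" for w
  have PP: "P (P v) = P v" and QQ: "Q (Q w) = Q w" for v w
    unfolding P_def Q_def by (rule ident_ident)+
  have tr: "optrace I P - optrace I (\<lambda>v. (S ^^ n) (P v)) = optrace J Q
    - optrace J (\<lambda>v. (S' ^^ n) (Q v))"
    and SO: "(\<lambda>v. (S ^^ n) (P v)) \<in> oprs I I" and S'O: "(\<lambda>v. (S' ^^ n) (Q v)) \<in> oprs J J" for n
    by (fact optrace_power[OF fin BO B'O PO QO PP QQ BP QB B'Q S_def S'_def, of n])+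
  have fsS: "finsupp (S v)" if "finsupp v" for v
    using finsupp_lin1[OF finsupp_ident[OF that] fsB'[OF fsB[OF that]], of I D "-1/K"]
      unfolding S_def P_def by simp
  have fsS': "finsupp (S' v)" if "finsupp v" for v
    using finsupp_lin1[OF finsupp_ident[OF that] fsB[OF fsB'[OF that]], of J E "-1/K"]
      unfolding S'_def Q_def by simp
  have fsSn: "finsupp ((S ^^ n) v)" if "finsupp v" for v n by (induction n) (use that fsS in auto)
  have fsS'n: "finsupp ((S' ^^ n) v)" if "finsupp v" for v n by (induction n) (use that fsS'
    in auto)
  have S_adj: "ip (S v) w = ip v (S w)" if "finsupp v" "finsupp w" for v w
    using ip_lin_left[OF finsupp_ident[OF that(1)] fsB'[OF fsB[OF that(1)]], of I D "-1/K" w]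
      ip_lin_right[of v "P w" "-1/K" "B' (B w)"] ident_adjoint[OF that(1), of I D w]
      B'B[OF that(2) fsB[OF that(1)]] BB'[OF that(1), of "B w"]
    unfolding S_def P_def by simp
  have S'_adj: "ip (S' v) w = ip v (S' w)" if "finsupp v" "finsupp w" for v w
    using ip_lin_left[OF finsupp_ident[OF that(1)] fsB[OF fsB'[OF that(1)]], of J E "-1/K" w]
      ip_lin_right[of v "Q w" "-1/K" "B (B' w)"] ident_adjoint[OF that(1), of J E w]
      BB'[OF fsB'[OF that(1)], of w] B'B[OF fsB'[OF that(2)] that(1)]
    unfolding S'_def Q_def by simp
  have Sn_adj: "ip ((S ^^ n) v) w = ip v ((S ^^ n) w)" if "finsupp v" "finsupp w" for v w n
    using that(2)
  proof (induction n arbitrary: w)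
    case (Suc n)
    have "ip ((S ^^ Suc n) v) w = ip ((S ^^ n) v) (S w)" using S_adj[OF fsSn[OF that(1)] Suc.prems]
      by simp
    also have "\<dots> = ip v ((S ^^ Suc n) w)" using Suc.IH[OF fsS[OF Suc.prems]]
      by (simp add: funpow_swap1)
    finally show ?case .
  qed simp
  have S'n_adj: "ip ((S' ^^ n) v) w = ip v ((S' ^^ n) w)" if "finsupp v" "finsupp w" for v w n
    using that(2)
  proof (induction n arbitrary: w)
    case (Suc n)
    have "ip ((S' ^^ Suc n) v) w = ip ((S' ^^ n) v) (S' w)"
      using S'_adj[OF fsS'n[OF that(1)] Suc.prems] by simp
    also have "\<dots> = ip v ((S' ^^ Suc n) w)" using Suc.IH[OF fsS'[OF Suc.prems]]
      by (simp add: funpow_swap1)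
    finally show ?case .
  qed simp
  \<comment> \<open>Self-adjointness moves half of the factors to the other side, which turns a
    diagonal entry of an even power into a squared norm.\<close>
  have diag: "(S ^^ (2 * n)) (pt b) b = ip ((S ^^ n) (pt b)) ((S ^^ n) (pt b))" for b n
  proof -
    have "(S ^^ (2 * n)) (pt b) b = ip (pt b) ((S ^^ n) ((S ^^ n) (pt b)))"
      unfolding ip_pt by (simp add: mult_2 funpow_add)
    then show ?thesis using Sn_adj[OF finsupp_pt fsSn[OF finsupp_pt]] by simp
  qed
  have diag': "(S' ^^ (2 * n)) (pt b) b = ip ((S' ^^ n) (pt b)) ((S' ^^ n) (pt b))" for b n
  proof -
    have "(S' ^^ (2 * n)) (pt b) b = ip (pt b) ((S' ^^ n) ((S' ^^ n) (pt b)))"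
      unfolding ip_pt by (simp add: mult_2 funpow_add)
    then show ?thesis using S'n_adj[OF finsupp_pt fsS'n[OF finsupp_pt]] by simp
  qed
  have S0: "(S ^^ n) (P (\<lambda>a. 0)) = (\<lambda>a. 0)" for n using oprs_zero_arg[OF SO] .
  have S'0: "(S' ^^ n) (Q (\<lambda>a. 0)) = (\<lambda>a. 0)" for n using oprs_zero_arg[OF S'O] .
  have P0: "P (\<lambda>a. 0) = (\<lambda>a. 0)" and Q0: "Q (\<lambda>a. 0) = (\<lambda>a. 0)" unfolding P_def Q_def ident_def
    by auto
  have stL: "\<forall>(c, j, P, i)\<in>set L. sheet P \<and> (\<forall>p\<in>P. src G p \<in> N \<longleftrightarrow> rng G p \<in> N)"
  proof clarify
    fix c j P i assume m: "(c, j, P, i) \<in> set L"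
    have "sheet P" using L[OF m] osD(1) by blast
    then show "sheet P \<and> (\<forall>p\<in>P. src G p \<in> N \<longleftrightarrow> rng G p \<in> N)" using stable[OF m] by blast
  qed
  have stL': "\<forall>(c, i, Q, j)\<in>set (adj L). sheet Q \<and> (\<forall>p\<in>Q. src G p \<in> N \<longleftrightarrow> rng G p \<in> N)"
    using adjL by blast
  \<comment> \<open>The functions to which the lower bound applies; \<open>S\<close> preserves them,
    so the contraction can be iterated.\<close>
  define good where "good v \<longleftrightarrow> finsupp v \<and> avoids N v \<and> P v = v" for v
  have goodS: "good (S v)" and shrink: "ip (S v) (S v) \<le> \<rho> * ip v v" if "good v" for v
  proof -
    have v: "finsupp v" "avoids N v" "P v = v" using that unfolding good_def by blast+
    have w: "finsupp (B' (B v))" by (rule fsB'[OF fsB[OF v(1)]])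
    have "avoids N (B v)" unfolding B_def by (rule avoids_opsum[OF stL v(2)])
    then have "avoids N (B' (B v))" unfolding B'_def by (rule avoids_opsum[OF stL'])
    then have "avoids N (S v)" using avoids_lin[OF v(2), of _ "-1/K"] unfolding S_def v(3) by simp
    moreover have "P (S v) = S v"
      using ident_lin[of I D v "-1/K" "B' (B v)"] PB'[of "B v"] v(3) unfolding S_def P_def by simp
    ultimately show "good (S v)" unfolding good_def using fsS[OF v(1)] by blast
    have "ip v v \<le> C * ip (B v) (B v)" using lower[OF v(1,2)] v(3) unfolding P_def B_def by blast
    also have "\<dots> \<le> C' * ip (B v) (B v)" using C' nsq_nonneg by (intro mult_right_mono) auto
    finally show "ip (S v) (S v) \<le> \<rho> * ip v v"
      using contraction[where v = v and B = B and B' = B', OF v(1) w K(1) C'(1) _ K(2)[OF fsB[OF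
        v(1)]]] BB'[OF v(1), of "B v"]
      unfolding S_def v(3) \<rho>_def by simp
  qed
  have goodSn: "good ((S ^^ n) v) \<and> ip ((S ^^ n) v) ((S ^^ n) v) \<le> \<rho> ^ n * ip v v" if "good v"
    for v n
  proof (induction n)
    case (Suc n)
    have "ip ((S ^^ Suc n) v) ((S ^^ Suc n) v) \<le> \<rho> * (\<rho> ^ n * ip v v)"
      using shrink[of "(S ^^ n) v"] Suc mult_left_mono[OF _ \<rho>(1)] by (fastforce intro: order.trans)
    then show ?case using goodS Suc by (simp add: mult.assoc)
  qed (use that in simp)
  have D_mu: "D i \<in> sets \<mu>" if "i \<in> I" for i using D[OF that] sets_muI by blast
  have E_mu: "E j \<in> sets \<mu>" if "j \<in> J" for j using E[OF that] sets_muI by blast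
  \<comment> \<open>Off \<open>N\<close> a point mass over \<open>D i\<close> is good and has norm
    1, so its diagonal entry is at most \<open>\<rho> ^ n\<close>; over other units the entry is
    0.\<close>
  have upper: "optrace I (\<lambda>v. (S ^^ (2 * n)) (P v)) \<le> \<rho> ^ n * (\<Sum>i\<in>I. measure \<mu> (D i))" for n
  proof -
    have "optrace I (\<lambda>v. (S ^^ (2 * n)) (P v)) \<le> (\<integral>x. (\<Sum>i\<in>I. \<rho> ^ n * indicator (D i) x) \<partial>\<mu>)"
      unfolding optrace_def
    proof (rule integral_mono_AE)
      show "integrable \<mu> (\<lambda>x. \<Sum>i\<in>I. (S ^^ (2 * n)) (P (pt (i, x))) (i, x))"
        by (intro Bochner_Integration.integrable_sum integrable_diag[OF SO])
      show "integrable \<mu> (\<lambda>x. \<Sum>i\<in>I. \<rho> ^ n * indicator (D i) x)"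
        using D_mu by (auto intro!: Bochner_Integration.integrable_sum integrable_real_indicator
          simp: emeasure_eq_measure)
      show "AE x in \<mu>. (\<Sum>i\<in>I. (S ^^ (2 * n)) (P (pt (i, x))) (i, x)) \<le> (\<Sum>i\<in>I. \<rho> ^ n
        * indicator (D i) x)"
        using N AE_space
      proof (eventually_elim, intro sum_mono)
        fix x i assume x: "x \<notin> N" "x \<in> space \<mu>" and i: "i \<in> I"
        have xu: "x \<in> elts G" "rng G x = x" using x space_mu units_subset rng_unit by auto
        show "(S ^^ (2 * n)) (P (pt (i, x))) (i, x) \<le> \<rho> ^ n * indicator (D i) x"
        proof (cases "x \<in> D i")
          case True
          then have Pp: "P (pt (i, x)) = pt (i, x)" unfolding P_def ident_pt using i xu by simp
          then have "good (pt (i, x))" unfolding good_def avoids_def using finsupp_pt x xu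
            by (auto simp: pt_def)
          from goodSn[OF this, of n] show ?thesis unfolding Pp diag using True
            by (simp add: ip_pt) (simp add: pt_def)
        next
          case False
          then have "P (pt (i, x)) = (\<lambda>a. 0)" unfolding P_def ident_pt using xu by simp
          then show ?thesis using S0[of "2 * n"] P0 False by simp
        qed
      qed
    qed
    also have "\<dots> = \<rho> ^ n * (\<Sum>i\<in>I. measure \<mu> (D i))"
      using D_mu by (subst Bochner_Integration.integral_sum)
        (auto intro!: integrable_real_indicator sum.cong simp: emeasure_eq_measure sum_distrib_left
          Int_absorb2 sets.sets_into_space)
    finally show ?thesis .
  qed
  have nonneg: "0 \<le> optrace J (\<lambda>v. (S' ^^ (2 * n)) (Q v))" for n
    unfolding optrace_def
  proof (intro Bochner_Integration.integral_nonneg_AE AE_I2 sum_nonneg)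
    fix x j
    show "0 \<le> (S' ^^ (2 * n)) (Q (pt (j, x))) (j, x)"
    proof (cases "Q (pt (j, x)) = pt (j, x)")
      case True then show ?thesis using diag' nsq_nonneg by simp
    next
      case False
      then have "Q (pt (j, x)) = (\<lambda>a. 0)" unfolding Q_def ident_pt by (auto split: if_splits)
      then show ?thesis using S'0[of "2 * n"] Q0 by simp
    qed
  qed
  let ?s = "\<Sum>i\<in>I. measure \<mu> (D i)"
  \<comment> \<open>The upper bound for the powers of \<open>S\<close> gives the left side, the
    trace identity passes to \<open>J\<close>, and positivity drops the trace of the powers of
    \<open>S'\<close>.\<close>
  have "(1 - \<rho> ^ n) * ?s \<le> (\<Sum>j\<in>J. measure \<mu> (E j))" for n
    using tr[of "2 * n"] upper[of n] nonneg[of n] optrace_ident[OF fin(1) D_mu] optrace_ident[OF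
      fin(2) E_mu]
    unfolding P_def Q_def by (simp add: algebra_simps)
  moreover have "(\<lambda>n. (1 - \<rho> ^ n) * ?s) \<longlonglongrightarrow> (1 - 0) * ?s"
    using \<rho> by (intro tendsto_intros LIMSEQ_realpow_zero)
  ultimately show ?thesis by (intro LIMSEQ_le_const2[where X = "\<lambda>n. (1 - \<rho> ^ n) * ?s"]) auto
qed

end

section \<open>Paths in the tree\<close>

context groupoid
begin

lemma sheet_letter: "sheet (fst a) \<Longrightarrow> sheet (letter_set G a)"
  by (cases a) (simp add: sheet_inv)

lemma sheet_word: "\<forall>a\<in>set w. sheet (fst a) \<Longrightarrow> sheet (word_set G w)"
  by (induction w) (simp_all add: sheet_units sheet_mul sheet_letter)

lemma dom_units: "g \<in> dom_of (units G) \<longleftrightarrow> g \<in> elts G" "g \<in> elts G \<Longrightarrow> act (units G) g = g"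
proof -
  show 1: "g \<in> dom_of (units G) \<longleftrightarrow> g \<in> elts G"
    using act_units(1)[OF order.refl, of g] dom_elts rng_units by blast
  show "g \<in> elts G \<Longrightarrow> act (units G) g = g"
    using act_units(2)[OF order.refl] 1 by blast
qed

lemma act_subset:
  assumes "sheet Q" "P \<subseteq> Q" "g \<in> dom_of P"
  shows "g \<in> dom_of Q" "act P g = act Q g"
proof -
  have P: "sheet P" by (rule sheet_subset[OF assms(1,2)])
  obtain p where p: "p \<in> P" "p \<in> elts G" "g \<in> elts G" "src G p = rng G g" "act P g = mul G p g"
    by (rule domE[OF assms(3) P])
  then have "p \<in> Q" using assms(2) by blast
  then show "g \<in> dom_of Q" "act P g = act Q g"
    using domI[OF _ p(3,4)] act_eq[OF assms(1) _ p(4)] p(5) by simp_all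
qed

lemma act_inj: "sheet P \<Longrightarrow> g \<in> dom_of P \<Longrightarrow> h \<in> dom_of P \<Longrightarrow> act P g = act P h \<Longrightarrow> g = h"
  by (metis act_inv(2))

lemma word_Cons:
  assumes "sheet (fst a)" "\<forall>a\<in>set w. sheet (fst a)"
  shows "g \<in> dom_of (word_set G (a # w)) \<longleftrightarrow> g \<in> dom_of (word_set G w) \<and> act (word_set G w) g
    \<in> dom_of (letter_set G a)"
    and "g \<in> dom_of (word_set G (a # w)) \<Longrightarrow> act (word_set G (a # w)) g
      = act (letter_set G a) (act (word_set G w) g)"
  using act_mul[OF sheet_letter[OF assms(1)] sheet_word[OF assms(2)], of g] by simp_all

text \<open>\<open>walk a w h z\<close>: the word \<open>w\<close>, read from right to left, leads from \<open>h\<close> to \<open>z\<close>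
  without crossing the edge \<open>a\<close>.\<close>

fun walk :: "'g set \<times> 'g \<Rightarrow> 'g word \<Rightarrow> 'g \<Rightarrow> 'g \<Rightarrow> bool" where
  "walk a [] h z \<longleftrightarrow> z = h"
| "walk a ((E, e) # w) h z \<longleftrightarrow> (\<exists>y. walk a w h y \<and>
     (if e then y \<in> dom_of E \<and> z = act E y \<and> (E, y) \<noteq> a
      else z \<in> dom_of E \<and> y = act E z \<and> (E, z) \<noteq> a))"

lemma walk_append: "walk a (u @ w) h z \<longleftrightarrow> (\<exists>y. walk a w h y \<and> walk a u y z)"
proof (induction u arbitrary: z)
  case (Cons b u)
  obtain E e where b: "b = (E, e)" by (cases b)
  show ?case unfolding b append_Cons walk.simps Cons.IH by blast
qed simp

lemma walk_word:
  assumes "walk a w h z" "h \<in> elts G" "\<forall>a\<in>set w. sheet (fst a)"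
  shows "h \<in> dom_of (word_set G w) \<and> act (word_set G w) h = z"
  using assms
proof (induction a w h z rule: walk.induct)
  case (1 a h z)
  then show ?case using dom_units by simp
next
  case (2 a E e w h z)
  obtain y where y: "walk a w h y" and st: "if e then y \<in> dom_of E \<and> z = act E y \<and> (E, y) \<noteq> a
      else z \<in> dom_of E \<and> y = act E z \<and> (E, z) \<noteq> a" using 2(2) by auto
  have E: "sheet E" and w: "\<forall>a\<in>set w. sheet (fst a)" using 2 by auto
  have IH: "h \<in> dom_of (word_set G w)" "act (word_set G w) h = y" using 2(1)[OF y 2(3) w] by auto
  have "y \<in> dom_of (letter_set G (E, e)) \<and> act (letter_set G (E, e)) y = z"
    using st act_inv[OF E] by (cases e) auto
  then show ?case using word_Cons[of "(E, e)" w h] E w IH by simp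
qed

lemma not_successively:
  "\<not> successively R xs \<Longrightarrow> \<exists>ys x y zs. xs = ys @ x # y # zs \<and> \<not> R x y"
proof (induction xs)
  case (Cons x xs)
  show ?case
  proof (cases xs)
    case (Cons y zs)
    show ?thesis
    proof (cases "R x y")
      case True
      then have "\<not> successively R xs" using Cons.prems Cons by simp
      then obtain ys x' y' zs' where "xs = ys @ x' # y' # zs'" "\<not> R x' y'" using Cons.IH by blast
      then show ?thesis by (intro exI[of _ "x # ys"] exI) auto
    next
      case False
      then show ?thesis using Cons by (intro exI[of _ "[]"] exI[of _ x] exI[of _ y] exI[of _ zs])
        simp
    qed
  qed (use Cons.prems in simp)
qed simp

text \<open>Two adjacent mutually inverse letters lead back to the same vertex, so a shortest walk
  has none. Removing them introduces no new crossing of \<open>a\<close>.\<close>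

lemma walk_shortest:
  assumes sh: "\<And>E. E \<in> \<E> \<Longrightarrow> sheet E" and w: "walk a w h z" "fst ` set w \<subseteq> \<E>"
  shows "\<exists>w. walk a w h z \<and> fst ` set w \<subseteq> \<E> \<and> successively (\<lambda>(E, \<epsilon>) (F, \<delta>). E = F \<longrightarrow> \<epsilon> = \<delta>) w"
proof -
  let ?R = "\<lambda>(E, \<epsilon>) (F, \<delta>). E = F \<longrightarrow> \<epsilon> = \<delta>"
  define Q where "Q w \<longleftrightarrow> walk a w h z \<and> fst ` set w \<subseteq> \<E>" for w
  obtain w where Qw: "Q w" and min: "\<And>w'. Q w' \<Longrightarrow> length w \<le> length w'"
    using ex_has_least_nat[of Q w length] w unfolding Q_def by blast
  have "successively ?R w"
  proof (rule ccontr)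
    assume "\<not> successively ?R w"
    then obtain u x y v where uv: "w = u @ x # y # v" "\<not> ?R x y" using not_successively by blast
    obtain E e where x: "x = (E, e)" by (cases x)
    then have y: "y = (E, \<not> e)" using uv(2) by (cases y) auto
    have "E \<in> \<E>" using Qw uv x unfolding Q_def by auto
    then have E: "sheet E" by (rule sh)
    have "walk a (u @ [x, y] @ v) h z" using Qw uv unfolding Q_def by simp
    then obtain p q where pq: "walk a v h p" "walk a [x, y] p q" "walk a u q z"
      unfolding walk_append by blast
    have "p = q" using pq(2) act_inj[OF E] unfolding x y by (cases e) auto
    then have "Q (u @ v)" unfolding Q_def walk_append using pq Qw uv unfolding Q_def by auto
    then show False using min uv by fastforce
  qed
  then show ?thesis using Qw unfolding Q_def by blast
qed

text \<open>The indicator function of the part of the tree on the far side of an edge.\<close>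

lemma potential:
  assumes sh: "\<And>E. E \<in> \<E> \<Longrightarrow> sheet E" and E0: "E0 \<in> \<E>" "g0 \<in> dom_of E0"
    and tree: "\<And>w. w \<in> reduced_words \<E> \<Longrightarrow> rng G g0 \<notin> word_set G w"
  shows "\<exists>\<phi> :: 'g \<Rightarrow> real. \<forall>E\<in>\<E>. \<forall>g\<in>dom_of E. \<phi> (act E g) - \<phi> g = (if (E, g)
    = (E0, g0) then 1 else 0)"
proof -
  let ?a = "(E0, g0)" and ?R = "\<lambda>(E, \<epsilon>) (F, \<delta>). E = F \<longrightarrow> \<epsilon> = \<delta>"
  define h0 where "h0 = act E0 g0"
  \<comment> \<open>\<open>X\<close> is the set of vertices reachable from the head of the edge
    without crossing it.\<close>
  define X where "X = {z. \<exists>w. walk ?a w h0 z \<and> fst ` set w \<subseteq> \<E>}"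
  have h0: "h0 \<in> X" unfolding X_def by (intro CollectI exI[of _ "[]"]) simp
  \<comment> \<open>Otherwise a reduced walk from the head back to \<open>g0\<close>, preceded by
    the edge itself, would be a reduced word fixing \<open>g0\<close>, and the unit
    \<open>rng G g0\<close> would lie in that word.\<close>
  have g0: "g0 \<notin> X"
  proof
    assume "g0 \<in> X"
    then obtain w' where "walk ?a w' h0 g0" "fst ` set w' \<subseteq> \<E>" unfolding X_def by blast
    from walk_shortest[OF sh this]
    obtain w where w: "walk ?a w h0 g0" "fst ` set w \<subseteq> \<E>" "successively ?R w" by blast
    have shw: "\<forall>a\<in>set w. sheet (fst a)" using w(2) sh by auto
    let ?w = "w @ [(E0, True)]"
    \<comment> \<open>Words act from the right, so the last letter of \<open>w\<close> acts directly
      after the appended edge. If it were the inverse letter, injectivity would make it cross the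
      forbidden edge backwards.\<close>
    have last: "?R (last w) (E0, True)" if ne: "w \<noteq> []"
    proof (rule ccontr)
      assume "\<not> ?R (last w) (E0, True)"
      then have l: "last w = (E0, False)" by (cases "last w") auto
      have "walk ?a (butlast w @ [(E0, False)]) h0 g0" using w(1) append_butlast_last_id[OF ne] l
        by simp
      then obtain z where z: "z \<in> dom_of E0" "h0 = act E0 z" "(E0, z) \<noteq> ?a" unfolding walk_append
        by auto
      have "z = g0" by (rule act_inj[OF sh[OF E0(1)] z(1) E0(2)]) (use z(2) h0_def in simp)
      then show False using z(3) by simp
    qed
    have "?w \<in> reduced_words \<E>"
      unfolding reduced_words_def using w(2,3) E0(1) last
      by (cases "w = []") (simp_all add: successively_append_iff)
    then have n: "rng G g0 \<notin> word_set G ?w" by (rule tree)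
    have h0e: "h0 \<in> elts G" unfolding h0_def by (rule act_elts[OF E0(2) sh[OF E0(1)]])
    have ww: "h0 \<in> dom_of (word_set G w)" "act (word_set G w) h0 = g0"
      using walk_word[OF w(1) h0e shw] by auto
    \<comment> \<open>Generalized from \<open>w\<close> to an arbitrary \<open>u\<close> for
      induction: appending the edge shifts the starting point from \<open>h0\<close> back to
      \<open>g0\<close>.\<close>
    have app: "g0 \<in> dom_of (word_set G (u @ [(E0, True)])) \<and> act (word_set G (u @ [(E0, True)])) g0
      = act (word_set G u) h0"
      if "h0 \<in> dom_of (word_set G u)" "\<forall>a\<in>set u. sheet (fst a)" for u
      using that
    proof (induction u)
      case Nil
      have "g0 \<in> elts G" by (rule dom_elts[OF E0(2)])
      then show ?case using word_Cons[of "(E0, True)" "[]" g0] sh[OF E0(1)] E0(2) dom_units h0e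
        by (simp add: h0_def)
    next
      case (Cons b u)
      have b: "sheet (fst b)" and u: "\<forall>a\<in>set u. sheet (fst a)"
        "\<forall>a\<in>set (u @ [(E0, True)]). sheet (fst a)"
        using Cons.prems sh[OF E0(1)] by auto
      have "h0 \<in> dom_of (word_set G u)" "act (word_set G u) h0 \<in> dom_of (letter_set G b)"
        using word_Cons(1)[OF b u(1), of h0] Cons.prems by blast+
      then show ?case
        using word_Cons[OF b u(1), of h0] word_Cons[OF b u(2), of g0] Cons.IH u Cons.prems by simp
    qed
    have "sheet (word_set G ?w)" by (rule sheet_word) (use shw sh[OF E0(1)] in auto)
    then have "rng G g0 \<in> word_set G ?w"
      using fixed_iff[OF _ dom_elts[OF E0(2)]] app[OF ww(1) shw] ww(2) by simp
    then show False using n by blast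
  qed
  show ?thesis
  proof (intro exI[of _ "indicator X"] ballI)
    fix E g assume E: "E \<in> \<E>" "g \<in> dom_of E"
    show "indicat_real X (act E g) - indicat_real X g = (if (E, g) = ?a then 1 else 0)"
    proof (cases "(E, g) = ?a")
      case True then show ?thesis using h0 g0 by (simp add: h0_def)
    next
      case False
      have "act E g \<in> X" if "g \<in> X"
      proof -
        obtain w where "walk ?a w h0 g" "fst ` set w \<subseteq> \<E>" using \<open>g \<in> X\<close> unfolding X_def by blast
        then show ?thesis unfolding X_def using E False
          by (intro CollectI exI[of _ "(E, True) # w"]) auto
      qed
      moreover have "g \<in> X" if "act E g \<in> X"
      proof -
        obtain w where "walk ?a w h0 (act E g)" "fst ` set w \<subseteq> \<E>" using \<open>act E g \<in> X\<close>
          unfolding X_def by blast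
        then show ?thesis unfolding X_def using E False
          by (intro CollectI exI[of _ "(E, False) # w"]) auto
      qed
      ultimately show ?thesis using False by (auto simp: indicator_def)
    qed
  qed
qed

text \<open>The edges crossed by the path of a word, with signs; the edge \<open>(c, E, w')\<close> starts at the
  vertex reached by \<open>w'\<close>.\<close>

fun moves :: "'g word \<Rightarrow> (real \<times> 'g set \<times> 'g word) list" where
  "moves [] = []"
| "moves ((E, e) # w) = (if e then (1, E, w) else (- 1, E, (E, e) # w)) # moves w"

lemma moves_set: "(c, E, w') \<in> set (moves w) \<Longrightarrow> E \<in> fst ` set w \<and> set w' \<subseteq> set w"
  by (induction w rule: moves.induct) (auto split: if_splits)

lemma moves_dom:
  assumes "(c, E, w') \<in> set (moves w)" "\<forall>a\<in>set w. sheet (fst a)" "g \<in> dom_of (word_set G w)"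
  shows "g \<in> dom_of (word_set G w') \<and> act (word_set G w') g \<in> dom_of E"
  using assms
proof (induction w rule: moves.induct)
  case (2 F e w)
  have F: "sheet F" and w: "\<forall>a\<in>set w. sheet (fst a)" using 2(3) by auto
  have g: "g \<in> dom_of (word_set G w)" "act (word_set G w) g \<in> dom_of (letter_set G (F, e))"
    and eq: "act (word_set G ((F, e) # w)) g = act (letter_set G (F, e)) (act (word_set G w) g)"
    using word_Cons[of "(F, e)" w g] F w 2(4) by (auto simp del: word_set.simps letter_set.simps)
  show ?case
  proof (cases "(c, E, w') \<in> set (moves w)")
    case True then show ?thesis using 2(1) w g by blast
  next
    case False
    then have *: "E = F" "w' = (if e then w else (F, e) # w)" using 2(2) by (auto split: if_splits)
    show ?thesis
    proof (cases e)
      case True then show ?thesis using * g by simp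
    next
      case False
      then have "act (word_set G w) g \<in> dom_of (ivs G ` F)" using g(2) by simp
      from act_inv'(1)[OF F this] show ?thesis using * 2(4) eq False by (simp del: word_set.simps)
    qed
  qed
qed simp

text \<open>When \<phi> is the potential of a tree edge, the left side counts the signed crossings
  of that edge by the path.\<close>

lemma moves_telescope:
  assumes "\<forall>a\<in>set w. sheet (fst a)" "g \<in> dom_of (word_set G w)"
  shows "(\<Sum>(c, E, w')\<leftarrow>moves w. c * (\<phi> (act E (act (word_set G w') g)) - \<phi> (act (word_set G w') g)))
    = \<phi> (act (word_set G w) g) - (\<phi> g :: real)"
  using assms
proof (induction w rule: moves.induct)
  case 1
  then show ?case using dom_units by simp
next
  case (2 F e w)
  have F: "sheet F" and w: "\<forall>a\<in>set w. sheet (fst a)" using 2(2) by auto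
  have g: "g \<in> dom_of (word_set G w)" "act (word_set G w) g \<in> dom_of (letter_set G (F, e))"
    and eq: "act (word_set G ((F, e) # w)) g = act (letter_set G (F, e)) (act (word_set G w) g)"
    using word_Cons[of "(F, e)" w g] F w 2(3) by (auto simp del: word_set.simps letter_set.simps)
  note IH = 2(1)[OF w g(1)]
  show ?case
  proof (cases e)
    case True then show ?thesis using IH eq by (simp del: word_set.simps)
  next
    case False
    then have "act (word_set G w) g \<in> dom_of (ivs G ` F)" using g(2) by simp
    from act_inv'(2)[OF F this] show ?thesis using IH eq False by (simp del: word_set.simps)
  qed
qed

text \<open>The operator that sends the edge \<open>(i, g)\<close> to the signed chain of edges on
  the path \<open>u i\<close> starting at \<open>g\<close>. The right factor in each product
  restricts the translation to starting points at which \<open>X i\<close> is defined.\<close>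

definition path_ops :: "'i list \<Rightarrow> ('i \<Rightarrow> 'g set) \<Rightarrow> ('i \<Rightarrow> 'g word) \<Rightarrow> (real \<times> 'g set \<times> 'g set \<times> 'i)
  list" where
  "path_ops xs X u = concat (map (\<lambda>i. map (\<lambda>(c, D, w). (c, D, set_mul G (word_set G w) (src G ` X
    i), i)) (moves (u i))) xs)"

lemma path_ops_set:
  "(c, D, P, i) \<in> set (path_ops xs X u) \<longleftrightarrow>
    i \<in> set xs \<and> (\<exists>w. (c, D, w) \<in> set (moves (u i)) \<and> P = set_mul G (word_set G w) (src G ` X i))"
  unfolding path_ops_def by force

lemma set_mul_src:
  assumes W: "sheet W" and X: "sheet X"
  shows "set_mul G W (src G ` X) = {p \<in> W. src G p \<in> src G ` X}"
    "g \<in> dom_of (set_mul G W (src G ` X)) \<longleftrightarrow> g \<in> dom_of W \<and> g \<in> dom_of X"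
    "g \<in> dom_of W \<Longrightarrow> g \<in> dom_of X \<Longrightarrow> act (set_mul G W (src G ` X)) g = act W g"
proof -
  have U: "src G ` X \<subseteq> units G" using sheet_elts[OF X] src_units by blast
  have We: "W \<subseteq> elts G" using W unfolding sheet_def by blast
  have dX: "g \<in> dom_of (src G ` X) \<longleftrightarrow> g \<in> dom_of X"
    using act_units(1)[OF U, of g] dom_elts unfolding dom_of_def by blast
  show "set_mul G W (src G ` X) = {p \<in> W. src G p \<in> src G ` X}" using set_mul_units(1)[OF We U] .
  show 1: "g \<in> dom_of (set_mul G W (src G ` X)) \<longleftrightarrow> g \<in> dom_of W \<and> g \<in> dom_of X"
    using act_mul(1)[OF W sheet_units[OF U]] act_units(2)[OF U] dX by metis
  show "g \<in> dom_of W \<Longrightarrow> g \<in> dom_of X \<Longrightarrow> act (set_mul G W (src G ` X)) g = act W g"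
    using act_mul(2)[OF W sheet_units[OF U]] act_units(2)[OF U] dX by metis
qed

lemma opsum_concat: "opsum (concat Ls) v a = (\<Sum>L\<leftarrow>Ls. opsum L v a)"
  by (induction Ls) (simp_all add: opsum_append)

lemma path_ops_pt:
  assumes "distinct xs" "i \<in> set xs" and X: "sheet (X i)" "X i \<subseteq> word_set G (u i)"
    and u: "\<And>i. i \<in> set xs \<Longrightarrow> \<forall>a\<in>set (u i). sheet (fst a)" and Xs: "\<And>i. i \<in> set xs \<Longrightarrow> sheet (X i)"
    and g: "g \<in> dom_of (X i)"
  shows "opsum (path_ops xs X u) (pt (i, g)) = (\<lambda>a. \<Sum>(c, D, w)\<leftarrow>moves (u i). c
    * pt (D, act (word_set G w) g) a)"
proof
  fix a
  let ?L = "\<lambda>i. map (\<lambda>(c, D, w). (c, D, set_mul G (word_set G w) (src G ` X i), i)) (moves (u i))"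
  have ge: "g \<in> elts G" using g by (rule dom_elts)
  have sh: "sheet (word_set G w)" "sheet (set_mul G (word_set G w) (src G ` X j))"
    if "j \<in> set xs" "set w \<subseteq> set (u j)" for w j
  proof -
    show "sheet (word_set G w)" by (rule sheet_word) (use u[OF that(1)] that(2) in blast)
    then show "sheet (set_mul G (word_set G w) (src G ` X j))"
      using set_mul_src(1)[OF _ Xs[OF that(1)]] sheet_subset
        by (metis (no_types, lifting) mem_Collect_eq subsetI)
  qed
  have other: "opsum (?L j) (pt (i, g)) a = 0" if "j \<in> set xs" "j \<noteq> i" for j
  proof -
    have "opsum (map (\<lambda>(c, D, w). (c, D, set_mul G (word_set G w) (src G ` X j), j)) ms) (pt (i, g))
      a = 0"
      if "set ms \<subseteq> set (moves (u j))" for ms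
      using that
    proof (induction ms)
      case (Cons m ms)
      obtain c D w where m: "m = (c, D, w)" by (cases m)
      have "set w \<subseteq> set (u j)" using moves_set[of c D w "u j"] Cons.prems m by simp
      then show ?case
        using Cons \<open>j \<noteq> i\<close> unfolding m
        by (simp add: transl_pt[OF sh(2)[OF \<open>j \<in> set xs\<close>] ge])
    qed simp
    then show ?thesis by blast
  qed
  have gw: "g \<in> dom_of (word_set G (u i))"
    using act_subset(1)[OF sh(1)[OF assms(2) order.refl] X(2) g] .
  have "opsum (map (\<lambda>(c, D, w). (c, D, set_mul G (word_set G w) (src G ` X i), i)) ms) (pt (i, g)) a
      = (\<Sum>(c, D, w)\<leftarrow>ms. c * pt (D, act (word_set G w) g) a)"
    if "set ms \<subseteq> set (moves (u i))" for ms
    using that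
  proof (induction ms)
    case (Cons m ms)
    obtain c D w where m: "m = (c, D, w)" by (cases m)
    have w: "set w \<subseteq> set (u i)" using moves_set[of c D w "u i"] Cons.prems m by simp
    have "g \<in> dom_of (word_set G w)" using moves_dom[OF _ u[OF assms(2)] gw] Cons.prems m by auto
    then have "transl D (set_mul G (word_set G w) (src G ` X i)) i (pt (i, g))
      = pt (D, act (word_set G w) g)"
      using set_mul_src(2,3)[OF sh(1)[OF assms(2) w] X(1), of g] g
      by (simp add: transl_pt[OF sh(2)[OF assms(2) w] ge])
    then show ?case using Cons unfolding m by simp
  qed simp
  then have this_i: "opsum (?L i) (pt (i, g)) a = (\<Sum>(c, D, w)\<leftarrow>moves (u i). c
    * pt (D, act (word_set G w) g) a)" by blast
  have "opsum (path_ops xs X u) (pt (i, g)) a = (\<Sum>j\<leftarrow>xs. opsum (?L j) (pt (i, g)) a)"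
    unfolding path_ops_def opsum_concat by (simp add: comp_def)
  also have "\<dots> = (\<Sum>j\<in>set xs. opsum (?L j) (pt (i, g)) a)"
    by (rule sum_list_distinct_conv_sum_set[OF assms(1)])
  also have "\<dots> = (\<Sum>j\<in>{i}. opsum (?L j) (pt (i, g)) a)"
    by (rule sum.mono_neutral_right) (use assms(2) other in auto)
  finally show "opsum (path_ops xs X u) (pt (i, g)) a = (\<Sum>(c, D, w)\<leftarrow>moves (u i). c
    * pt (D, act (word_set G w) g) a)"
    using this_i by simp
qed

lemma opsum_zero_arg: "opsum L (\<lambda>a. 0) a = 0"
  using fun_cong[OF opsum_lin[of L "\<lambda>a. 0" "-1" "\<lambda>a. 0"], of a] by simp

lemma opsum_sum: "finite S \<Longrightarrow> opsum L (\<lambda>a. \<Sum>b\<in>S. f b * k b a) a = (\<Sum>b\<in>S. f b * opsum L (k b) a)"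
proof (induction S rule: finite_induct)
  case (insert b S)
  then show ?case
    using fun_cong[OF opsum_lin[of L "\<lambda>a. \<Sum>b\<in>S. f b * k b a" "f b" "k b"], of a]
      by (simp add: add.commute)
qed (simp add: opsum_zero_arg)

lemma opsum_sum_list: "opsum L (\<lambda>a. \<Sum>(c, D, w)\<leftarrow>ms. c * k D w a) a = (\<Sum>(c, D, w)\<leftarrow>ms. c
  * opsum L (k D w) a)"
proof (induction ms)
  case (Cons m ms)
  obtain c D w where m: "m = (c, D, w)" by (cases m)
  show ?case
    using Cons fun_cong[OF opsum_lin[of L "\<lambda>a. \<Sum>(c, D, w)\<leftarrow>ms. c * k D w a" c "k D w"], of a]
      unfolding m by (simp add: add.commute)
qed (simp add: opsum_zero_arg)

lemma finsupp_decomp: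
  assumes "finsupp v"
  shows "v = (\<lambda>a. \<Sum>b\<in>{b. v b \<noteq> 0}. v b * pt b a)"
proof
  fix a
  have "(\<Sum>b\<in>{b. v b \<noteq> 0}. v b * pt b a) = (\<Sum>b\<in>{b. v b \<noteq> 0}. if a = b then v b else 0)"
    by (rule sum.cong) (auto simp: pt_def)
  then show "v a = (\<Sum>b\<in>{b. v b \<noteq> 0}. v b * pt b a)" using assms unfolding finsupp_def by simp
qed

end

section \<open>Comparing a treeing with a cut-up graphing\<close>

context pmp_discrete_groupoid
begin

lemma word_stable:
  assumes "\<forall>D\<in>J. \<forall>d\<in>D. src G d \<in> N \<longleftrightarrow> rng G d \<in> N"
    and "fst ` set w \<subseteq> J" "J \<subseteq> one_sheeted G" "p \<in> word_set G w"
  shows "src G p \<in> N \<longleftrightarrow> rng G p \<in> N"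
  using assms(2,4)
proof (induction w arbitrary: p)
  case Nil
  then show ?case by (simp add: src_unit rng_unit)
next
  case (Cons a w)
  obtain D e where a: "a = (D, e)" by (cases a)
  have D: "D \<in> J" "sheet D" using Cons.prems a assms(3) osD(1) by auto
  have w: "sheet (word_set G w)" "sheet (letter_set G a)"
    using Cons.prems assms(3) osD(1) by (auto intro!: sheet_word sheet_letter)
  obtain q r where qr: "p = mul G q r" "q \<in> letter_set G a" "r \<in> word_set G w" "src G q = rng G r"
    using Cons.prems(2) unfolding word_set.simps set_mul_def by blast
  have "src G q \<in> N \<longleftrightarrow> rng G q \<in> N"
    using qr(2) bspec[OF assms(1) D(1)] sheet_elts[OF D(2)] unfolding a
      by (cases e) (auto simp: src_ivs rng_ivs)
  moreover have "src G r \<in> N \<longleftrightarrow> rng G r \<in> N" using Cons.IH[OF _ qr(3)] Cons.prems by simp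
  moreover have "src G p = src G r" "rng G p = rng G q"
    using qr sheet_elts[OF w(1)] sheet_elts[OF w(2)] by (simp_all add: src_mul rng_mul)
  ultimately show ?case using qr(4) by simp
qed

text \<open>Take the potential \<phi> of the edge \<open>(E0, g0)\<close>. The coefficient at this
  edge of the tree path of an edge \<open>(D, h)\<close> is the increment of \<phi> along
  \<open>(D, h)\<close>, by telescoping. Telescoping once more along the path \<open>u i\<close>
  leaves the increment of \<phi> along the original tree edge, which is 1 or 0. It does not matter
  which words represent the paths.\<close>

lemma tree_inverse:
  assumes xs: "distinct xs" "distinct ys"
    and X: "\<And>i. i \<in> set xs \<Longrightarrow> sheet (X i) \<and> X i \<subseteq> own i \<and> own i \<in> \<E> \<and> X i \<subseteq> word_set G (u i)
      \<and> fst ` set (u i) \<subseteq> set ys"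
    and Y: "\<And>D. D \<in> set ys \<Longrightarrow> sheet D \<and> D \<subseteq> word_set G (p D) \<and> fst ` set (p D) \<subseteq> \<E>"
    and E: "\<And>E. E \<in> \<E> \<Longrightarrow> sheet E"
    and i: "i \<in> set xs" "g \<in> dom_of (X i)"
    and E0: "E0 \<in> \<E>" "g0 \<in> dom_of E0" and tree: "\<And>w. w \<in> reduced_words \<E> \<Longrightarrow> rng G g0 \<notin> word_set G w"
  shows "opsum (path_ops ys (\<lambda>D. D) p) (opsum (path_ops xs X u) (pt (i, g))) (E0, g0)
    = (if (own i, g) = (E0, g0) then 1 else 0)"
proof -
  obtain \<phi> :: "'g \<Rightarrow> real"
    where "\<forall>E\<in>\<E>. \<forall>g\<in>dom_of E. \<phi> (act E g) - \<phi> g = (if (E, g) = (E0, g0) then 1 else 0)"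
    using potential[OF E E0 tree] by blast
  then have \<phi>: "\<phi> (act E g) - \<phi> g = (if (E, g) = (E0, g0) then 1 else 0)" if "E \<in> \<E>" "g \<in> dom_of E"
    for E g
    using that by blast
  let ?A = "opsum (path_ops ys (\<lambda>D. D) p)"
  have su: "\<forall>a\<in>set (u j). sheet (fst a)" if "j \<in> set xs" for j using X[OF that] Y by auto
  have sp: "\<forall>a\<in>set (p D). sheet (fst a)" if "D \<in> set ys" for D using Y[OF that] E by auto
  have A: "?A (pt (D, h)) (E0, g0) = \<phi> (act D h) - \<phi> h" if D: "D \<in> set ys" and h: "h \<in> dom_of D"
    for D h
  proof -
    have sD: "sheet D" "D \<subseteq> word_set G (p D)" using Y[OF D] by auto
    have hw: "h \<in> dom_of (word_set G (p D))" "act D h = act (word_set G (p D)) h"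
      using act_subset[OF sheet_word[OF sp[OF D]] sD(2) h] by auto
    have "?A (pt (D, h)) (E0, g0) = (\<Sum>(c, E, w)\<leftarrow>moves (p D). c
      * pt (E, act (word_set G w) h) (E0, g0))"
      using path_ops_pt[of ys D "\<lambda>D. D" p h, OF xs(2) D sD sp _ h] Y by simp
    also have "\<dots> = (\<Sum>(c, E, w)\<leftarrow>moves (p D). c * (\<phi> (act E (act (word_set G w) h))
      - \<phi> (act (word_set G w) h)))"
    proof (intro arg_cong[of _ _ sum_list] map_cong refl)
      fix m assume m: "m \<in> set (moves (p D))"
      obtain c E w where mm: "m = (c, E, w)" by (cases m)
      have "E \<in> \<E>" using moves_set[of c E w "p D"] m mm Y[OF D] by blast
      moreover have "act (word_set G w) h \<in> dom_of E" using moves_dom[OF _ sp[OF D] hw(1)] m mm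
        by blast
      ultimately have "\<phi> (act E (act (word_set G w) h)) - \<phi> (act (word_set G w) h)
        = pt (E, act (word_set G w) h) (E0, g0)"
        using \<phi> unfolding pt_def by auto
      then show "(case m of (c, E, w) \<Rightarrow> c * pt (E, act (word_set G w) h) (E0, g0)) =
        (case m of (c, E, w) \<Rightarrow> c * (\<phi> (act E (act (word_set G w) h)) - \<phi> (act (word_set G w) h)))"
        unfolding mm by simp
    qed
    also have "\<dots> = \<phi> (act D h) - \<phi> h" unfolding hw(2) by (rule moves_telescope[OF sp[OF D] hw(1)])
    finally show ?thesis .
  qed
  have Xi: "sheet (X i)" "X i \<subseteq> own i" "own i \<in> \<E>" "X i \<subseteq> word_set G (u i)" using X[OF i(1)] by auto
  have gw: "g \<in> dom_of (word_set G (u i))" "act (X i) g = act (word_set G (u i)) g"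
    using act_subset[OF sheet_word[OF su[OF i(1)]] Xi(4) i(2)] by auto
  have go: "g \<in> dom_of (own i)" "act (X i) g = act (own i) g"
    using act_subset[OF E[OF Xi(3)] Xi(2) i(2)] by auto
  have "?A (opsum (path_ops xs X u) (pt (i, g))) (E0, g0)
      = ?A (\<lambda>a. \<Sum>(c, D, w)\<leftarrow>moves (u i). c * pt (D, act (word_set G w) g) a) (E0, g0)"
    using path_ops_pt[of xs i X u g, OF xs(1) i(1) Xi(1,4) su _ i(2)] X by simp
  also have "\<dots> = (\<Sum>(c, D, w)\<leftarrow>moves (u i). c * ?A (pt (D, act (word_set G w) g)) (E0, g0))"
    by (rule opsum_sum_list)
  also have "\<dots> = (\<Sum>(c, D, w)\<leftarrow>moves (u i). c * (\<phi> (act D (act (word_set G w) g))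
    - \<phi> (act (word_set G w) g)))"
  proof (intro arg_cong[of _ _ sum_list] map_cong refl)
    fix m assume m: "m \<in> set (moves (u i))"
    obtain c D w where mm: "m = (c, D, w)" by (cases m)
    have "D \<in> set ys" using moves_set[of c D w "u i"] m mm X[OF i(1)] by blast
    moreover have "act (word_set G w) g \<in> dom_of D" using moves_dom[OF _ su[OF i(1)] gw(1)] m mm
      by blast
    ultimately show "(case m of (c, D, w) \<Rightarrow> c * ?A (pt (D, act (word_set G w) g)) (E0, g0)) =
        (case m of (c, D, w) \<Rightarrow> c * (\<phi> (act D (act (word_set G w) g)) - \<phi> (act (word_set G w) g)))"
      unfolding mm using A by simp
  qed
  also have "\<dots> = \<phi> (act (own i) g) - \<phi> g"
    using moves_telescope[OF su[OF i(1)] gw(1), of \<phi>] gw(2) go(2) by simp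
  also have "\<dots> = (if (own i, g) = (E0, g0) then 1 else 0)" by (rule \<phi>[OF Xi(3) go(1)])
  finally show ?thesis .
qed

text \<open>The finite core of the comparison: \<open>L\<close> replaces tree edges by paths of
  pieces, \<open>A\<close> goes back along tree paths, and the norm bound for \<open>A\<close>
  yields the lower bound for \<open>L\<close>. An index \<open>i\<close> labels a piece of the
  member \<open>own i\<close> of the treeing.\<close>

lemma treeing_le_pieces:
  fixes xs :: "'i list"
  assumes xs: "distinct xs"
    and X: "\<And>i. i \<in> set xs \<Longrightarrow> X i \<in> one_sheeted G \<and> X i \<subseteq> own i \<and> own i \<in> \<E> \<and> X i \<subseteq> word_set G (u i)
      \<and> fst ` set (u i) \<subseteq> J"
    and disj: "\<And>i j. i \<in> set xs \<Longrightarrow> j \<in> set xs \<Longrightarrow> own i = own j \<Longrightarrow> i \<noteq> j \<Longrightarrow> X i \<inter> X j = {}"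
    and J: "finite J" "J \<subseteq> one_sheeted G"
    and Y: "\<And>D. D \<in> J \<Longrightarrow> D \<subseteq> word_set G (p D) \<and> fst ` set (p D) \<subseteq> \<E>"
    and E: "\<E> \<subseteq> one_sheeted G"
    and N: "AE x in \<mu>. x \<notin> N" and stable: "\<forall>D\<in>J. \<forall>d\<in>D. src G d \<in> N \<longleftrightarrow> rng G d \<in> N"
    and tree: "\<And>w x. w \<in> reduced_words \<E> \<Longrightarrow> x \<in> word_set G w \<Longrightarrow> x \<in> units G \<Longrightarrow> x \<in> N"
  shows "(\<Sum>i\<in>set xs. measure \<mu> (src G ` X i)) \<le> (\<Sum>D\<in>J. measure \<mu> (src G ` D))"
proof -
  obtain ys where ys: "distinct ys" "set ys = J" using finite_distinct_list[OF J(1)] by blast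
  let ?L = "path_ops xs X u" and ?A = "path_ops ys (\<lambda>D. D) p"
  have sE: "sheet E" if "E \<in> \<E>" for E using that E osD(1) by blast
  have sJ: "sheet D" if "D \<in> J" for D using that J osD(1) by blast
  have sX: "sheet (X i)" if "i \<in> set xs" for i using X[OF that] osD(1) by blast
  have su: "\<forall>a\<in>set (u i). sheet (fst a)" if "i \<in> set xs" for i using X[OF that] sJ by auto
  have L: "P \<in> one_sheeted G \<and> i \<in> set xs \<and> src G ` P \<subseteq> src G ` X i \<and> D \<in> J \<and> rng G ` P \<subseteq> src G ` D
      \<and> (\<forall>q\<in>P. src G q \<in> N \<longleftrightarrow> rng G q \<in> N)"
    if m: "(c, D, P, i) \<in> set ?L" for c D P i
  proof -
    obtain w where i: "i \<in> set xs" and w: "(c, D, w) \<in> set (moves (u i))"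
      and P: "P = set_mul G (word_set G w) (src G ` X i)"
      using m unfolding path_ops_set by blast
    have DJ: "D \<in> J" and wJ: "fst ` set w \<subseteq> J" using moves_set[OF w] X[OF i] by blast+
    have W: "word_set G w \<in> one_sheeted G" by (rule os_word) (use wJ J in blast)
    have sW: "sheet (word_set G w)" by (rule osD(1)[OF W])
    have Xi: "X i \<in> one_sheeted G" using X[OF i] by blast
    have "src G ` X i \<in> one_sheeted G"
      by (rule os_units[OF _ src_image_sets[OF Xi]]) (use sheet_elts[OF sX[OF i]] src_units
        in blast)
    then have 1: "P \<in> one_sheeted G" unfolding P by (rule os_mul[OF W])
    have Pe: "P = {p \<in> word_set G w. src G p \<in> src G ` X i}" unfolding P
      by (rule set_mul_src(1)[OF sW sX[OF i]])
    \<comment> \<open>Seen as a vertex over its own source, \<open>q\<close> is reached from that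
      unit by the path \<open>w\<close>, and from there the next move crosses an edge of
      \<open>D\<close>.\<close>
    have "rng G q \<in> src G ` D" if q: "q \<in> P" for q
    proof -
      have qw: "q \<in> word_set G w" "src G q \<in> src G ` X i" using q Pe by auto
      have qe: "q \<in> elts G" by (rule sheet_elts[OF sW qw(1)])
      let ?x = "src G q"
      have x: "?x \<in> elts G" "rng G ?x = ?x" using src_elts[OF qe] rng_unit[OF src_units[OF qe]]
        by auto
      have "?x \<in> dom_of (X i)" unfolding dom_of_def using x qw(2) by simp
      then have "?x \<in> dom_of (word_set G (u i))"
        using act_subset(1)[OF sheet_word[OF su[OF i]]] X[OF i] by blast
      then have "act (word_set G w) ?x \<in> dom_of D" using moves_dom[OF w su[OF i]] by blast
      moreover have "act (word_set G w) ?x = q" using act_eq[OF sW qw(1), of ?x] x(2) mul_src[OF qe]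
        by simp
      ultimately show ?thesis unfolding dom_of_def by simp
    qed
    moreover have "src G q \<in> N \<longleftrightarrow> rng G q \<in> N" if "q \<in> P" for q
      using word_stable[OF stable wJ J(2)] that Pe by blast
    ultimately show ?thesis using 1 i DJ Pe by blast
  qed
  have A: "sheets ?A"
    unfolding sheets_def
  proof clarify
    fix c E P D assume "(c, E, P, D) \<in> set ?A"
    then obtain w where D: "D \<in> J" and w: "(c, E, w) \<in> set (moves (p D))"
      and P: "P = set_mul G (word_set G w) (src G ` D)"
      unfolding path_ops_set ys(2) by blast
    have "\<forall>a\<in>set w. sheet (fst a)" using moves_set[OF w] Y[OF D] sE by blast
    then have "sheet (word_set G w)" by (rule sheet_word)
    then show "sheet P" unfolding P using set_mul_src(1)[OF _ sJ[OF D]] sheet_subset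
      by (metis (no_types, lifting) mem_Collect_eq subsetI)
  qed
  have shL: "sheets ?L" unfolding sheets_def using L osD(1) by blast
  obtain K where K: "K > 0" "\<And>w. finsupp w \<Longrightarrow> ip (opsum ?A w) (opsum ?A w) \<le> K * ip w w"
    using opsum_bounded[OF A] by blast
  \<comment> \<open>The operator \<open>A\<close> returns the values of \<open>v\<close>, relabelled
    by \<open>f\<close> from pieces to members of the treeing. It may also produce other nonzero
    values; these only increase the norm.\<close>
  have lower: "ip v v \<le> K * ip (opsum ?L v) (opsum ?L v)"
    if v: "finsupp v" "avoids N v" "ident (set xs) (\<lambda>i. src G ` X i) v = v" for v
  proof -
    let ?S = "{b. v b \<noteq> 0}" and ?w = "opsum ?A (opsum ?L v)"
    define f where "f b = (own (fst b), snd b)" for b :: "'i \<times> 'g"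
    have fin: "finite ?S" using v(1) unfolding finsupp_def .
    have S: "fst b \<in> set xs \<and> snd b \<in> dom_of (X (fst b)) \<and> rng G (snd b) \<notin> N" if b: "b \<in> ?S" for b
    proof -
      have "ident (set xs) (\<lambda>i. src G ` X i) v b \<noteq> 0" using b v(3) by simp
      then have "fst b \<in> set xs \<and> snd b \<in> dom_of (X (fst b))" unfolding ident_def dom_of_def
        by (auto split: if_splits)
      then show ?thesis using v(2) b unfolding avoids_def by blast
    qed
    have own: "snd b \<in> dom_of (own (fst b))" if b: "b \<in> ?S" for b
      using act_subset(1)[OF sE, of "own (fst b)" "X (fst b)" "snd b"] S[OF b] X by blast
    \<comment> \<open>A tree edge determines its piece: the element of the member composed at that
      edge is unique, and the pieces of one member are disjoint.\<close>
    have inj: "inj_on f ?S"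
    proof (rule inj_onI)
      fix b c assume bc: "b \<in> ?S" "c \<in> ?S" "f b = f c"
      then have eq: "own (fst b) = own (fst c)" "snd b = snd c" unfolding f_def by auto
      obtain q where q: "q \<in> X (fst b)" "src G q = rng G (snd b)"
        using domE[of "snd b" "X (fst b)"] S[OF bc(1)] sX by metis
      obtain r where r: "r \<in> X (fst c)" "src G r = rng G (snd b)"
        using domE[of "snd c" "X (fst c)"] S[OF bc(2)] sX eq(2) by metis
      have "q \<in> own (fst b)" "r \<in> own (fst b)" using q r X S bc eq by (blast, metis subsetD)
      moreover have "inj_on (src G) (own (fst b))" using sE X S bc unfolding sheet_def by blast
      ultimately have "q = r" using q r by (metis inj_onD)
      then have "fst b = fst c" using disj[OF _ _ eq(1)] S bc q r by blast
      then show "b = c" using eq by (simp add: prod_eq_iff)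
    qed
    have w: "?w (f b) = v b" if b: "b \<in> ?S" for b
    proof -
      have "opsum ?L v = opsum ?L (\<lambda>a. \<Sum>c\<in>?S. v c * pt c a)" using finsupp_decomp[OF v(1)] by simp
      also have "\<dots> = (\<lambda>a. \<Sum>c\<in>?S. v c * opsum ?L (pt c) a)" using opsum_sum[OF fin] by (rule ext)
      finally have "?w (f b) = opsum ?A (\<lambda>a. \<Sum>c\<in>?S. v c * opsum ?L (pt c) a) (f b)" by simp
      also have "\<dots> = (\<Sum>c\<in>?S. v c * opsum ?A (opsum ?L (pt c)) (f b))" by (rule opsum_sum[OF fin])
      also have "\<dots> = (\<Sum>c\<in>?S. if c = b then v c else 0)"
      proof (rule sum.cong[OF refl])
        fix c assume c: "c \<in> ?S"
        have "opsum ?A (opsum ?L (pt (fst c, snd c))) (own (fst b), snd b)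
          = (if (own (fst c), snd c) = (own (fst b), snd b) then 1 else 0)"
        proof (rule tree_inverse[OF xs ys(1)])
          show "rng G (snd b) \<notin> word_set G w" if "w \<in> reduced_words \<E>" for w
            using tree[OF that] S[OF b] rng_units dom_elts[OF own[OF b]] by blast
          show "own (fst b) \<in> \<E>" using X S[OF b] by blast
        qed (use X sX Y sJ sE S[OF c] own[OF b] ys in auto)
        moreover have "(own (fst c), snd c) = (own (fst b), snd b) \<longleftrightarrow> c = b"
          using inj_onD[OF inj, of c b] c b unfolding f_def by auto
        ultimately show "v c * opsum ?A (opsum ?L (pt c)) (f b) = (if c = b then v c else 0)"
          unfolding f_def by simp
      qed
      also have "\<dots> = v b" using fin b by simp
      finally show ?thesis .
    qed
    have fsw: "finsupp (opsum ?L v)" "finsupp ?w"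
      using finsupp_opsum[OF shL v(1)] finsupp_opsum[OF A] by auto
    have "ip v v = (\<Sum>b\<in>?S. ?w (f b) * ?w (f b))" unfolding ip_def
      by (rule sum.cong) (simp_all add: w)
    also have "\<dots> = (\<Sum>a\<in>f ` ?S. ?w a * ?w a)" by (simp add: sum.reindex[OF inj])
    also have "\<dots> \<le> (\<Sum>a\<in>{a. ?w a \<noteq> 0}. ?w a * ?w a)"
      by (rule sum_mono2) (use fsw(2) w in \<open>auto simp: finsupp_def\<close>)
    also have "\<dots> = ip ?w ?w" unfolding ip_def ..
    also have "\<dots> \<le> K * ip (opsum ?L v) (opsum ?L v)" by (rule K(2)[OF fsw(1)])
    finally show ?thesis .
  qed
  have unitsX: "src G ` X i \<in> sets (borel_str G) \<and> src G ` X i \<subseteq> units G" if "i \<in> set xs" for i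
    using src_image_sets X[OF that] sheet_elts[OF sX[OF that]] src_units by blast
  have unitsJ: "src G ` D \<in> sets (borel_str G) \<and> src G ` D \<subseteq> units G" if "D \<in> J" for D
    using src_image_sets J(2) that sheet_elts[OF sJ[OF that]] src_units by blast
  show ?thesis
  proof (rule trace_inequality[where L = ?L and N = N and C = K])
    show "src G p \<in> N \<longleftrightarrow> rng G p \<in> N" if "(c, D, P, i) \<in> set ?L" "p \<in> P" for c D P i p
      using L[OF that(1)] that(2) by blast
    show "P \<in> one_sheeted G \<and> i \<in> set xs \<and> src G ` P \<subseteq> src G ` X i \<and> D \<in> J \<and> rng G ` P \<subseteq> src G ` D"
      if "(c, D, P, i) \<in> set ?L" for c D P i using L[OF that] by blast
  qed (use J unitsX unitsJ N K(1) lower in simp_all)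
qed

end

section \<open>Cutting up graphings\<close>

text \<open>Unreduced words are kept, since substituting words into words need not give reduced
  ones. The empty word contributes the units, so the words of a graphing cover the groupoid up to a
  null set.\<close>

definition words :: "'g set set \<Rightarrow> 'g word set" where
  "words \<E> = {w. fst ` set w \<subseteq> \<E>}"

lemma words_simps: "[] \<in> words \<E>" "(E, e) # w \<in> words \<E> \<longleftrightarrow> E \<in> \<E> \<and> w \<in> words \<E>"
  unfolding words_def by auto

lemma reduced_words_subset: "reduced_words \<E> \<subseteq> words \<E>"
  unfolding words_def reduced_words_def by auto

lemma countable_words:
  assumes "countable \<E>"
  shows "countable (words \<E>)"
proof -
  have "words \<E> \<subseteq> lists (\<E> \<times> UNIV)" unfolding words_def by auto
  moreover have "countable (lists (\<E> \<times> (UNIV :: bool set)))" using assms by simp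
  ultimately show ?thesis by (rule countable_subset)
qed

definition enum_words :: "'g set set \<Rightarrow> nat \<Rightarrow> 'g word" where
  "enum_words \<E> = from_nat_into (words \<E>)"

lemma range_enum_words: "countable \<E> \<Longrightarrow> range (enum_words \<E>) = words \<E>"
  unfolding enum_words_def using words_simps(1) by (intro range_from_nat_into countable_words) auto

context pmp_discrete_groupoid
begin

definition piece :: "'g set set \<Rightarrow> 'g set \<Rightarrow> nat \<Rightarrow> 'g set" where
  "piece \<E> F m = F \<inter> word_set G (enum_words \<E> m) - (\<Union>k<m. word_set G (enum_words \<E> k))"

lemma piece_disjoint: "m \<noteq> n \<Longrightarrow> piece \<E> F m \<inter> piece \<E> F n = {}"
  unfolding piece_def by (cases m n rule: linorder_cases) auto

lemma UN_piece:
  assumes "countable \<E>"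
  shows "(\<Union>m. piece \<E> F m) = F \<inter> (\<Union>w\<in>words \<E>. word_set G w)"
proof -
  have "\<exists>m. g \<in> piece \<E> F m" if "g \<in> F" "\<exists>m. g \<in> word_set G (enum_words \<E> m)" for g
    using that(1) LeastI_ex[OF that(2)] not_less_Least unfolding piece_def by blast
  then have "(\<Union>m. piece \<E> F m) = F \<inter> (\<Union>m. word_set G (enum_words \<E> m))" unfolding piece_def by blast
  also have "(\<Union>m. word_set G (enum_words \<E> m)) = (\<Union>w\<in>words \<E>. word_set G w)"
    unfolding range_enum_words[OF assms, symmetric] by simp
  finally show ?thesis .
qed

lemma words_os: "\<E> \<subseteq> one_sheeted G \<Longrightarrow> w \<in> words \<E> \<Longrightarrow> word_set G w \<in> one_sheeted G"
  unfolding words_def by (intro os_word) auto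

lemma UN_words_sets:
  assumes "countable \<E>" "\<E> \<subseteq> one_sheeted G"
  shows "(\<Union>w\<in>words \<E>. word_set G w) \<in> sets (borel_str G)"
  using words_os[OF assms(2)] osD(2) by (intro sets.countable_UN'' countable_words[OF assms(1)])
    blast

lemma enum_words: "countable \<E> \<Longrightarrow> enum_words \<E> m \<in> words \<E>"
  using range_enum_words by blast

lemma piece_os:
  assumes "countable \<E>" "\<E> \<subseteq> one_sheeted G" "F \<in> one_sheeted G"
  shows "piece \<E> F m \<in> one_sheeted G"
proof (rule os_subset[OF assms(3)])
  show "piece \<E> F m \<in> sets (borel_str G)"
    unfolding piece_def
    using osD(2)[OF assms(3)] osD(2)[OF words_os[OF assms(2) enum_words[OF assms(1)]]] by auto
qed (auto simp: piece_def)

definition pieces :: "'g set set \<Rightarrow> 'g set set \<Rightarrow> 'g set set" where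
  "pieces \<E> \<F> = {piece \<E> F m | F m. F \<in> \<F>}"

lemma pieces_countable: "countable \<F> \<Longrightarrow> countable (pieces \<E> \<F>)"
proof -
  assume "countable \<F>"
  moreover have "pieces \<E> \<F> = (\<lambda>(F, m). piece \<E> F m) ` (\<F> \<times> UNIV)" unfolding pieces_def by auto
  ultimately show ?thesis by simp
qed

lemma pieces_os: "countable \<E> \<Longrightarrow> \<E> \<subseteq> one_sheeted G \<Longrightarrow> \<F> \<subseteq> one_sheeted G \<Longrightarrow> pieces \<E> \<F> \<subseteq> one_sheeted G"
  unfolding pieces_def using piece_os by blast

lemma src_null_Un:
  assumes "P \<in> one_sheeted G" "A \<in> one_sheeted G" "B \<in> one_sheeted G" "P \<subseteq> A \<union> B"
    and "emeasure \<mu> (src G ` A) = 0" "emeasure \<mu> (src G ` B) = 0"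
  shows "emeasure \<mu> (src G ` P) = 0"
proof -
  have "src G ` A \<union> src G ` B \<in> null_sets \<mu>" using assms src_image_mu
    by (intro null_sets.Un null_setsI) auto
  moreover have "src G ` P \<subseteq> src G ` A \<union> src G ` B" using assms(4) by blast
  ultimately show ?thesis using null_sets_subset[OF _ src_image_mu[OF assms(1)]] by blast
qed

lemma uncovered_null:
  assumes gr: "graphing G \<mu> \<E>" and F: "F \<in> one_sheeted G"
  shows "emeasure \<mu> (src G ` (F - (\<Union>w\<in>words \<E>. word_set G w))) = 0"
proof -
  have E: "countable \<E>" "\<E> \<subseteq> one_sheeted G" using gr unfolding graphing_def countable_sheets_def
    by auto
  show ?thesis
  proof (rule lifted_measure_null)
    show "lifted_measure G \<mu> (elts G - (units G \<union> (\<Union>w\<in>reduced_words \<E>. word_set G w))) = 0"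
      using gr unfolding graphing_def by blast
    show "F - (\<Union>w\<in>words \<E>. word_set G w) \<in> one_sheeted G"
      using os_subset[OF F] osD(2)[OF F] UN_words_sets[OF E] by auto
    have "units G \<subseteq> (\<Union>w\<in>words \<E>. word_set G w)" using UN_upper[OF words_simps(1), of "word_set G" \<E>]
      by simp
    then show "F - (\<Union>w\<in>words \<E>. word_set G w) \<subseteq> elts G - (units G
      \<union> (\<Union>w\<in>reduced_words \<E>. word_set G w))"
      using reduced_words_subset[of \<E>] sheet_elts[OF osD(1)[OF F]] by blast
  qed
qed

lemma letter_null:
  assumes "F \<in> one_sheeted G" "emeasure \<mu> (src G ` F) = 0"
  shows "emeasure \<mu> (src G ` letter_set G (F, e)) = 0"
  using assms mu_src_rng[OF assms(1)] src_inv_image[OF osD(1)[OF assms(1)]] by simp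

text \<open>Cutting a letter into pieces loses only the part not covered by words of
  \<open>\<E>\<close>, which is null. By \<open>mu_mul_le\<close> a product with a null factor is
  null, so the loss stays null for words of any length.\<close>

lemma refined_words_null:
  assumes gr: "graphing G \<mu> \<E>" and F: "countable \<F>" "\<F> \<subseteq> one_sheeted G" and w: "w \<in> words \<F>"
  shows "emeasure \<mu> (src G ` (word_set G w - (\<Union>u\<in>words (pieces \<E> \<F>). word_set G u))) = 0"
  using w
proof (induction w)
  case Nil
  have "word_set G [] - (\<Union>u\<in>words (pieces \<E> \<F>). word_set G u) = {}" using words_simps(1) by blast
  then show ?case by (simp only: image_empty emeasure_empty)
next
  case (Cons a w)
  have E: "countable \<E>" "\<E> \<subseteq> one_sheeted G" using gr unfolding graphing_def countable_sheets_def
    by auto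
  let ?U = "\<Union>u\<in>words (pieces \<E> \<F>). word_set G u" and ?V = "\<Union>w\<in>words \<E>. word_set G w"
  obtain K e where a: "a = (K, e)" by (cases a)
  have K: "K \<in> \<F>" "K \<in> one_sheeted G" and w: "w \<in> words \<F>" using Cons.prems F
    unfolding a words_simps by auto
  have W: "word_set G w \<in> one_sheeted G" and aW: "word_set G (a # w) \<in> one_sheeted G"
    by (rule words_os[OF F(2)]; fact)+
  have U: "?U \<in> sets (borel_str G)"
    by (rule UN_words_sets[OF pieces_countable[OF F(1)] pieces_os[OF E F(2)]])
  have diff: "P - ?U \<in> one_sheeted G" if "P \<in> one_sheeted G" for P
    using os_subset[OF that] osD(2)[OF that] U by auto
  have K0: "K - ?V \<in> one_sheeted G" using os_subset[OF K(2)] osD(2)[OF K(2)] UN_words_sets[OF E]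
    by auto
  have L: "letter_set G (K, e) \<in> one_sheeted G" "letter_set G (K - ?V, e) \<in> one_sheeted G"
    using os_letter[of "(K, e)"] os_letter[of "(K - ?V, e)"] K(2) K0 unfolding fst_conv by blast+
  show ?case
  proof (rule src_null_Un[OF diff[OF aW] os_mul[OF L(2) W] os_mul[OF L(1) diff[OF W]]])
    have "emeasure \<mu> (src G ` letter_set G (K - ?V, e)) = 0"
      by (rule letter_null[OF K0 uncovered_null[OF gr K(2)]])
    then show "emeasure \<mu> (src G ` set_mul G (letter_set G (K - ?V, e)) (word_set G w)) = 0"
      using mu_mul_le(2)[OF L(2) W] by simp
    show "emeasure \<mu> (src G ` set_mul G (letter_set G (K, e)) (word_set G w - ?U)) = 0"
      using mu_mul_le(1)[OF L(1) diff[OF W]] Cons.IH[OF w] by simp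
    \<comment> \<open>An element lost by the product has either a lost first letter or a lost
      remainder: if the letter lies in a piece and the remainder in a word of pieces, so does the
      product.\<close>
    show "word_set G (a # w) - ?U \<subseteq> set_mul G (letter_set G (K - ?V, e)) (word_set G w) \<union>
        set_mul G (letter_set G (K, e)) (word_set G w - ?U)"
    proof
      fix g assume g: "g \<in> word_set G (a # w) - ?U"
      then obtain f h where fh: "g = mul G f h" "f \<in> letter_set G (K, e)" "h
        \<in> word_set G w" "src G f = rng G h"
        unfolding a word_set.simps set_mul_def by blast
      obtain k where k: "k \<in> K" "f = (if e then k else ivs G k)" using fh(2)
        by (auto split: if_splits)
      show "g \<in> set_mul G (letter_set G (K - ?V, e)) (word_set G w)
        \<union> set_mul G (letter_set G (K, e)) (word_set G w - ?U)"
      proof (cases "k \<in> ?V")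
        case False
        then have "f \<in> letter_set G (K - ?V, e)" using k by auto
        then show ?thesis using fh unfolding set_mul_def by blast
      next
        case True
        then obtain m where m: "k \<in> piece \<E> K m" using UN_piece[OF E(1), of K] k(1) by blast
        have D: "piece \<E> K m \<in> pieces \<E> \<F>" unfolding pieces_def using K(1) by blast
        have fD: "f \<in> letter_set G (piece \<E> K m, e)" using k m by auto
        have "h \<notin> ?U"
        proof
          assume "h \<in> ?U"
          then obtain u where u: "u \<in> words (pieces \<E> \<F>)" "h \<in> word_set G u" by blast
          have "g \<in> word_set G ((piece \<E> K m, e) # u)"
            unfolding word_set.simps set_mul_def using fh fD u by blast
          then show False using g u D words_simps(2) by blast
        qed
        then show ?thesis using fh unfolding set_mul_def by blast
      qed
    qed
  qed
qed

text \<open>The union over the countably many words of \<open>\<F>\<close> keeps the loss null, so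
  the pieces still generate almost everything.\<close>

lemma refined_uncovered_null:
  assumes E: "graphing G \<mu> \<E>" and F: "graphing G \<mu> \<F>" and P: "P \<in> one_sheeted G"
  shows "emeasure \<mu> (src G ` (P - (\<Union>u\<in>words (pieces \<E> \<F>). word_set G u))) = 0"
proof -
  have E': "countable \<E>" "\<E> \<subseteq> one_sheeted G" using E unfolding graphing_def countable_sheets_def
    by auto
  have F': "countable \<F>" "\<F> \<subseteq> one_sheeted G" using F unfolding graphing_def countable_sheets_def
    by auto
  let ?U = "\<Union>u\<in>words (pieces \<E> \<F>). word_set G u" and ?W = "\<Union>w\<in>words \<F>. word_set G w"
  have U: "?U \<in> sets (borel_str G)"
    by (rule UN_words_sets[OF pieces_countable[OF F'(1)] pieces_os[OF E' F'(2)]])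
  have diff: "Q - ?U \<in> one_sheeted G" if "Q \<in> one_sheeted G" for Q
    using os_subset[OF that] osD(2)[OF that] U by auto
  have P0: "P - ?W \<in> one_sheeted G" using os_subset[OF P] osD(2)[OF P] UN_words_sets[OF F'] by auto
  have "src G ` (word_set G w - ?U) \<in> null_sets \<mu>" if "w \<in> words \<F>" for w
    by (rule null_setsI[OF refined_words_null[OF E F' that] src_image_mu[OF diff[OF words_os[OF
      F'(2) that]]]])
  then have "(\<Union>w\<in>words \<F>. src G ` (word_set G w - ?U)) \<in> null_sets \<mu>"
    by (rule null_sets_UN'[OF countable_words[OF F'(1)]])
  moreover have "src G ` (P - ?W) \<in> null_sets \<mu>"
    by (rule null_setsI[OF uncovered_null[OF F P] src_image_mu[OF P0]])
  ultimately have "src G ` (P - ?W) \<union> (\<Union>w\<in>words \<F>. src G ` (word_set G w - ?U)) \<in> null_sets \<mu>"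
    by blast
  moreover have "src G ` (P - ?U) \<subseteq> src G ` (P - ?W) \<union> (\<Union>w\<in>words \<F>. src G ` (word_set G w - ?U))"
    by blast
  ultimately show ?thesis using null_sets_subset[OF _ src_image_mu[OF diff[OF P]]] by blast
qed

lemma mu_le_pieces:
  assumes E: "graphing G \<mu> \<E>" and F: "graphing G \<mu> \<F>" and P: "P \<in> one_sheeted G"
  shows "emeasure \<mu> (src G ` P) \<le> (\<Sum>n. emeasure \<mu> (src G ` piece (pieces \<E> \<F>) P n))"
proof -
  have E': "countable \<E>" "\<E> \<subseteq> one_sheeted G" using E unfolding graphing_def countable_sheets_def
    by auto
  have F': "countable \<F>" "\<F> \<subseteq> one_sheeted G" using F unfolding graphing_def countable_sheets_def
    by auto
  let ?J = "pieces \<E> \<F>" and ?U = "\<Union>u\<in>words (pieces \<E> \<F>). word_set G u"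
  have J: "countable ?J" "?J \<subseteq> one_sheeted G"
    by (rule pieces_countable[OF F'(1)], rule pieces_os[OF E' F'(2)])
  have "P - ?U \<in> one_sheeted G" using os_subset[OF P] osD(2)[OF P] UN_words_sets[OF J] by auto
  then have null: "src G ` (P - ?U) \<in> null_sets \<mu>"
    by (intro null_setsI[OF refined_uncovered_null[OF E F P]] src_image_mu)
  have os: "piece ?J P n \<in> one_sheeted G" for n by (rule piece_os[OF J P])
  have sets: "(\<Union>n. src G ` piece ?J P n) \<in> sets \<mu>" using src_image_mu[OF os] by blast
  have "src G ` P = (\<Union>n. src G ` piece ?J P n) \<union> src G ` (P - ?U)"
    using UN_piece[OF J(1), of P] by blast
  then have "emeasure \<mu> (src G ` P) = emeasure \<mu> (\<Union>n. src G ` piece ?J P n)"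
    using emeasure_Un_null_set[OF sets null] by simp
  also have "\<dots> \<le> (\<Sum>n. emeasure \<mu> (src G ` piece ?J P n))"
    by (rule emeasure_subadditive_countably) (use src_image_mu[OF os] in blast)
  finally show ?thesis .
qed

lemma sum_pieces_le:
  assumes E: "countable \<E>" "\<E> \<subseteq> one_sheeted G" and F: "F \<in> one_sheeted G"
  shows "(\<Sum>m<M. emeasure \<mu> (src G ` piece \<E> F m)) \<le> emeasure \<mu> (src G ` F)"
proof -
  have inj: "inj_on (src G) F" using osD(1)[OF F] unfolding sheet_def by blast
  have sub: "piece \<E> F m \<subseteq> F" for m unfolding piece_def by blast
  have "src G ` piece \<E> F m \<inter> src G ` piece \<E> F n = {}" if "m \<noteq> n" for m n
    using inj_on_image_Int[OF inj sub sub, of m n] piece_disjoint[OF that] by simp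
  then have "(\<Sum>m<M. emeasure \<mu> (src G ` piece \<E> F m)) = emeasure \<mu> (\<Union>m<M. src G ` piece \<E> F m)"
    using src_image_mu[OF piece_os[OF E F]] by (intro sum_emeasure) (auto simp:
      disjoint_family_on_def)
  also have "\<dots> \<le> emeasure \<mu> (src G ` F)"
    by (rule emeasure_mono[OF _ src_image_mu[OF F]]) (use sub in blast)
  finally show ?thesis .
qed

lemma family_cost_SUP:
  assumes "\<F> \<subseteq> one_sheeted G"
  shows "family_cost G \<mu> \<F> = (SUP A\<in>{A. finite A \<and> A \<subseteq> \<F>}. \<Sum>F\<in>A. emeasure \<mu> (src G ` F))"
proof -
  have "family_cost G \<mu> \<F> = (\<Sum>\<^sub>\<infinity>F\<in>\<F>. emeasure \<mu> (src G ` F))"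
    unfolding family_cost_def by (rule infsum_cong) (use assms lifted_measure_os in blast)
  then show ?thesis using nonneg_infsum_complete[of \<F> "\<lambda>F. emeasure \<mu> (src G ` F)"] by simp
qed

text \<open>One origin \<open>q D\<close> is chosen for each piece, since the same set may arise
  from several members. Grouped by member, the chosen pieces are disjoint parts of it and contribute
  at most its measure.\<close>

lemma sum_pieces_le_cost:
  assumes E: "countable \<E>" "\<E> \<subseteq> one_sheeted G" and F: "\<F> \<subseteq> one_sheeted G"
    and J: "finite J" "J \<subseteq> pieces \<E> \<F>"
  shows "(\<Sum>D\<in>J. emeasure \<mu> (src G ` D)) \<le> family_cost G \<mu> \<F>"
proof -
  have "\<forall>D\<in>J. \<exists>q. fst q \<in> \<F> \<and> D = piece \<E> (fst q) (snd q)" using J(2) unfolding pieces_def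
    by fastforce
  then obtain q where q: "\<And>D. D \<in> J \<Longrightarrow> fst (q D) \<in> \<F> \<and> D = piece \<E> (fst (q D)) (snd (q D))" by metis
  have inj: "inj_on q J" by (rule inj_onI) (metis q)
  define A where "A = fst ` q ` J"
  have A: "finite A" "A \<subseteq> \<F>" unfolding A_def using J(1) q by auto
  obtain M where M: "\<forall>m\<in>snd ` q ` J. m < M" using finite_nat_set_iff_bounded[of "snd ` q ` J"] J(1)
    by auto
  let ?f = "\<lambda>(F, m). emeasure \<mu> (src G ` piece \<E> F m)"
  have "(\<Sum>D\<in>J. emeasure \<mu> (src G ` D)) = (\<Sum>D\<in>J. ?f (q D))"
    by (rule sum.cong) (use q in \<open>auto simp: case_prod_beta\<close>)
  also have "\<dots> = (\<Sum>x\<in>q ` J. ?f x)" by (simp add: sum.reindex[OF inj])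
  also have "\<dots> \<le> (\<Sum>x\<in>A \<times> {..<M}. ?f x)"
  proof (rule sum_mono2)
    show "q ` J \<subseteq> A \<times> {..<M}" using M unfolding A_def
      by (auto simp: image_iff) (metis fst_conv, metis snd_conv)
  qed (use A in auto)
  also have "\<dots> = (\<Sum>F\<in>A. \<Sum>m<M. emeasure \<mu> (src G ` piece \<E> F m))"
    by (simp add: sum.cartesian_product)
  also have "\<dots> \<le> (\<Sum>F\<in>A. emeasure \<mu> (src G ` F))"
    by (rule sum_mono) (use sum_pieces_le[OF E] A F in blast)
  also have "\<dots> \<le> family_cost G \<mu> \<F>"
    unfolding family_cost_SUP[OF F] by (rule SUP_upper) (use A in blast)
  finally show ?thesis .
qed

text \<open>\<open>N\<close> collects the endpoints of all words in \<open>J\<close> that start in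
  \<open>N0\<close>. There are countably many words, and invariance makes each set of endpoints
  null.\<close>

lemma saturation:
  assumes J: "countable J" "J \<subseteq> one_sheeted G" and N0: "N0 \<in> null_sets \<mu>"
  obtains N where "N \<in> null_sets \<mu>" "N0 \<subseteq> N" "\<forall>D\<in>J. \<forall>d\<in>D. src G d \<in> N \<longleftrightarrow> rng G d \<in> N"
proof -
  define Q where "Q w = {p \<in> word_set G w. src G p \<in> N0}" for w
  define N where "N = (\<Union>w\<in>words J. rng G ` Q w)"
  have N0': "N0 \<subseteq> units G" "N0 \<in> sets (borel_str G)"
    using sets.sets_into_space[OF null_setsD2[OF N0]] null_setsD2[OF N0] space_mu sets_mu
    by (simp_all add: sets_restrict_space_iff)
  have Q: "Q w \<in> one_sheeted G" if "w \<in> words J" for w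
  proof -
    note W = words_os[OF J(2) that]
    have "Q w = set_mul G (word_set G w) N0"
      unfolding Q_def by (rule set_mul_units(1)[symmetric, OF _ N0'(1)]) (use sheet_elts[OF
        osD(1)[OF W]] in blast)
    then show ?thesis using os_mul[OF W os_units[OF N0']] by simp
  qed
  have "rng G ` Q w \<in> null_sets \<mu>" if "w \<in> words J" for w
  proof (rule null_setsI[OF _ rng_image_mu[OF Q[OF that]]])
    have "emeasure \<mu> (src G ` Q w) \<le> emeasure \<mu> N0"
      by (rule emeasure_mono) (use N0 in \<open>auto simp: Q_def\<close>)
    then show "emeasure \<mu> (rng G ` Q w) = 0" using mu_src_rng[OF Q[OF that]] N0 by auto
  qed
  then have 1: "N \<in> null_sets \<mu>" unfolding N_def
    by (rule null_sets_UN'[OF countable_words[OF J(1)]])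
  have 2: "N0 \<subseteq> N"
  proof
    fix x assume x: "x \<in> N0"
    then have "x \<in> Q []" "rng G x = x" using N0'(1) src_unit rng_unit unfolding Q_def by auto
    then show "x \<in> N" unfolding N_def using words_simps(1) by force
  qed
  \<comment> \<open>Prepending the letter to a word that leads from \<open>N0\<close> to the source
    of \<open>d\<close> gives one that leads to its range. Inverse letters yield the converse
    implication.\<close>
  have step: "rng G d \<in> N" if D: "D \<in> J" and d: "d \<in> letter_set G (D, e)" and s: "src G d \<in> N"
    for D d e
  proof -
    obtain w p where w: "w \<in> words J" "p \<in> Q w" "src G d = rng G p" using s unfolding N_def by blast
    have de: "d \<in> elts G" using sheet_elts[OF osD(1)[OF os_letter[of "(D, e)"]]] D J(2) d by auto
    have pe: "p \<in> elts G" using sheet_elts[OF osD(1)[OF Q[OF w(1)]] w(2)] .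
    have "mul G d p \<in> word_set G ((D, e) # w)" using d w unfolding word_set.simps set_mul_def Q_def
      by blast
    moreover have "src G (mul G d p) = src G p" "rng G (mul G d p) = rng G d"
      using src_mul rng_mul de pe w(3) by auto
    ultimately have "mul G d p \<in> Q ((D, e) # w)" "rng G d = rng G (mul G d p)" using w(2)
      unfolding Q_def by auto
    then show ?thesis unfolding N_def using words_simps(2) D w(1) by blast
  qed
  have 3: "\<forall>D\<in>J. \<forall>d\<in>D. src G d \<in> N \<longleftrightarrow> rng G d \<in> N"
  proof (intro ballI iffI)
    fix D d assume D: "D \<in> J" and d: "d \<in> D"
    have de: "d \<in> elts G" using sheet_elts[OF osD(1)] J(2) D d by blast
    show "rng G d \<in> N" if "src G d \<in> N" using step[OF D, of d True] d that by simp
    show "src G d \<in> N" if "rng G d \<in> N"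
      using step[OF D, of "ivs G d" False] d that de by (simp add: src_ivs rng_ivs)
  qed
  show thesis by (rule that[OF 1 2 3])
qed

text \<open>Costs may be infinite, whereas the core inequality concerns finite families. It is
  applied to finitely many members and the first \<open>M\<close> words of pieces; the bound does
  not depend on these choices and survives the suprema.\<close>

lemma treeing_cost_le:
  assumes tr: "treeing G \<mu> \<E>" and E: "graphing G \<mu> \<E>" and F: "graphing G \<mu> \<F>"
  shows "family_cost G \<mu> \<E> \<le> family_cost G \<mu> \<F>"
proof -
  have E': "countable \<E>" "\<E> \<subseteq> one_sheeted G" using E unfolding graphing_def countable_sheets_def
    by auto
  have F': "countable \<F>" "\<F> \<subseteq> one_sheeted G" using F unfolding graphing_def countable_sheets_def
    by auto
  let ?J = "pieces \<E> \<F>"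
  let ?u = "enum_words ?J"
  have J: "countable ?J" "?J \<subseteq> one_sheeted G"
    by (rule pieces_countable[OF F'(1)], rule pieces_os[OF E' F'(2)])
  have WX: "word_set G w \<inter> units G \<in> one_sheeted G \<and> src G ` (word_set G w \<inter> units G) = word_set G w
    \<inter> units G"
    if "w \<in> words \<E>" for w
  proof
    show "word_set G w \<inter> units G \<in> one_sheeted G"
      using words_os[OF E'(2) that] osD(2) by (intro os_units) auto
    show "src G ` (word_set G w \<inter> units G) = word_set G w \<inter> units G" using src_unit
      by (force simp: image_iff)
  qed
  \<comment> \<open>The units at which the forest property fails; the treeing condition makes this
    countable union null.\<close>
  define N0 where "N0 = (\<Union>w\<in>reduced_words \<E>. word_set G w \<inter> units G)"
  have "word_set G w \<inter> units G \<in> null_sets \<mu>" if w: "w \<in> reduced_words \<E>" for w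
  proof -
    have ww: "w \<in> words \<E>" using w reduced_words_subset by blast
    have "lifted_measure G \<mu> (word_set G w \<inter> units G) = 0" using tr w unfolding treeing_def by blast
    then show ?thesis using lifted_measure_os[of "word_set G w
      \<inter> units G"] src_image_mu[of "word_set G w \<inter> units G"] WX[OF ww]
      by (intro null_setsI) simp_all
  qed
  then have "N0 \<in> null_sets \<mu>"
    unfolding N0_def by (rule null_sets_UN'[OF countable_subset[OF reduced_words_subset
      countable_words[OF E'(1)]]])
  from saturation[OF J this] obtain N where N: "N \<in> null_sets \<mu>" "N0 \<subseteq> N"
    and stable: "\<forall>D\<in>?J. \<forall>d\<in>D. src G d \<in> N \<longleftrightarrow> rng G d \<in> N" by blast
  have "\<forall>D\<in>?J. \<exists>w. D \<subseteq> word_set G w \<and> fst ` set w \<subseteq> \<E>"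
  proof
    fix D assume "D \<in> ?J"
    then obtain K m where "D = piece \<E> K m" unfolding pieces_def by blast
    then have "D \<subseteq> word_set G (enum_words \<E> m)" unfolding piece_def by blast
    moreover have "fst ` set (enum_words \<E> m) \<subseteq> \<E>" using enum_words[OF E'(1), of m]
      unfolding words_def by blast
    ultimately show "\<exists>w. D \<subseteq> word_set G w \<and> fst ` set w \<subseteq> \<E>" by blast
  qed
  then obtain p where p: "\<And>D. D \<in> ?J \<Longrightarrow> D \<subseteq> word_set G (p D) \<and> fst ` set (p D) \<subseteq> \<E>" by metis
  let ?X = "\<lambda>(E, n). piece ?J E n"
  have finite_bound: "(\<Sum>n<M. \<Sum>E\<in>A. emeasure \<mu> (src G ` piece ?J E n)) \<le> family_cost G \<mu> \<F>"
    if A: "finite A" "A \<subseteq> \<E>" for A M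
  proof -
    obtain xs where xs: "distinct xs" "set xs = A \<times> {..<M}"
      using finite_distinct_list[of "A \<times> {..<M}"] A by auto
    \<comment> \<open>The letters of the first \<open>M\<close> words: the only pieces of
      \<open>\<F>\<close> that the chosen parts of the treeing can use, and finite in
      number.\<close>
    define J0 where "J0 = (\<Union>n<M. fst ` set (?u n))"
    have J0: "finite J0" "J0 \<subseteq> ?J" using enum_words[OF J(1)] unfolding J0_def words_def by auto
    have os: "?X i \<in> one_sheeted G" if "i \<in> set xs" for i
      using that xs A E'(2) piece_os[OF J] by auto
    have "(\<Sum>i\<in>set xs. measure \<mu> (src G ` ?X i)) \<le> (\<Sum>D\<in>J0. measure \<mu> (src G ` D))"
    proof (rule treeing_le_pieces[OF xs(1), where own = fst and u = "\<lambda>i. ?u (snd i)" and p = p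
      and N = N and \<E> = \<E>])
      fix i assume i: "i \<in> set xs"
      then obtain E n where En: "i = (E, n)" "E \<in> A" "n < M" using xs(2) by auto
      show "?X i \<in> one_sheeted G \<and> ?X i \<subseteq> fst i \<and> fst i \<in> \<E> \<and> ?X i \<subseteq> word_set G (?u (snd i))
        \<and> fst ` set (?u (snd i)) \<subseteq> J0"
        using os[OF i] En A unfolding J0_def piece_def by auto
    next
      fix i j assume "i \<in> set xs" "j \<in> set xs" "fst i = fst j" "i \<noteq> j"
      then show "?X i \<inter> ?X j = {}"
        using piece_disjoint[of "snd i" "snd j" ?J "fst i"]
          by (simp add: case_prod_beta prod_eq_iff)
    next
      show "AE x in \<mu>. x \<notin> N" using N(1) by (rule AE_not_in)
      show "x \<in> N" if "w \<in> reduced_words \<E>" "x \<in> word_set G w" "x \<in> units G" for w x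
        using that N(2) unfolding N0_def by blast
    qed (use J0 J p stable E'(2) in blast)+
    then have "ennreal (\<Sum>i\<in>set xs. measure \<mu> (src G ` ?X i))
      \<le> ennreal (\<Sum>D\<in>J0. measure \<mu> (src G ` D))"
      by (rule ennreal_leI)
    then have "(\<Sum>i\<in>set xs. emeasure \<mu> (src G ` ?X i)) \<le> (\<Sum>D\<in>J0. emeasure \<mu> (src G ` D))"
      by (simp add: emeasure_eq_measure)
    also have "\<dots> \<le> family_cost G \<mu> \<F>" by (rule sum_pieces_le_cost[OF E' F'(2) J0])
    finally have "(\<Sum>i\<in>A \<times> {..<M}. emeasure \<mu> (src G ` ?X i)) \<le> family_cost G \<mu> \<F>" unfolding xs(2) .
    moreover have "(\<Sum>n<M. \<Sum>E\<in>A. emeasure \<mu> (src G ` piece ?J E n))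
      = (\<Sum>i\<in>A \<times> {..<M}. emeasure \<mu> (src G ` ?X i))"
      by (subst sum.swap) (simp add: sum.cartesian_product case_prod_beta)
    ultimately show ?thesis by simp
  qed
  show ?thesis
    unfolding family_cost_SUP[OF E'(2)]
  proof (rule SUP_least)
    fix A assume "A \<in> {A. finite A \<and> A \<subseteq> \<E>}"
    then have A: "finite A" "A \<subseteq> \<E>" by auto
    \<comment> \<open>The finite sum over members is exchanged with the series over words, so that
      every partial sum falls under \<open>finite_bound\<close>.\<close>
    have "(\<Sum>E\<in>A. emeasure \<mu> (src G ` E)) \<le> (\<Sum>E\<in>A. \<Sum>n. emeasure \<mu> (src G ` piece ?J E n))"
      by (rule sum_mono) (use mu_le_pieces[OF E F] A E'(2) in blast)
    also have "\<dots> = (\<Sum>n. \<Sum>E\<in>A. emeasure \<mu> (src G ` piece ?J E n))"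
      by (rule suminf_sum[symmetric]) (rule summableI)
    also have "\<dots> = (SUP M. \<Sum>n<M. \<Sum>E\<in>A. emeasure \<mu> (src G ` piece ?J E n))" by (rule suminf_eq_SUP)
    also have "\<dots> \<le> family_cost G \<mu> \<F>" by (rule SUP_least) (rule finite_bound[OF A])
    finally show "(\<Sum>E\<in>A. emeasure \<mu> (src G ` E)) \<le> family_cost G \<mu> \<F>" .
  qed
qed

end

theorem theorem4p7:
  fixes G :: "'g groupoid_data" and \<mu> :: "'g measure" and \<E> :: "'g set set"
  assumes "pmp_discrete_groupoid G \<mu>"
    and "treeing G \<mu> \<E>"
    and "graphing G \<mu> \<E>"
  shows "groupoid_cost G \<mu> = family_cost G \<mu> \<E>"
proof -
  interpret pmp_discrete_groupoid G \<mu> by fact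
  show ?thesis
    unfolding groupoid_cost_def
    by (intro antisym INF_lower INF_greatest) (use treeing_cost_le[OF assms(2,3)] assms(3)
      in simp_all)
qed

end
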